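(* Let $n\ge 21$ and $2\le s\le 2^{n-1}$. Then: (a) Up to reordering the coordinates, $[n]^{(\ge 3)}\cup \{A\in [n]^{(2)}:1\in A\}$ is the unique family $\mathcal{A}\subset\mathcal{P}([n])$ of size $\sum_{k=3}^n \binom{n}{k}+n-1$ that maximises the number of intersecting subfamilies of size $s$ (over all families in $\mathcal{P}([n])$ of that size). (b) Up to reordering the coordinates, $[n]^{(\ge 3)}\cup \{A\in [n]^{(2)}:n\notin A\}$ is the unique family $\mathcal{A}\subset\mathcal{P}([n])$ of size $\sum_{k=3}^n \binom{n}{k}+\binom{n-1}{2}$ that maximises the number of intersecting subfamilies of size $s$ (over all families in $\mathcal{P}([n])$ of that size).
   Context: $[n]=\{1,\dots,n\}$, $\mathcal{P}([n])$ is its power set, $[n]^{(r)}$ is the set of $r$-element subsets of $[n]$ and $[n]^{(\ge r)}$ the set of subsets of size at least $r$. A family $\mathcal{F}$ of sets is intersecting if $F\cap F'\neq\emptyset$ for all $F,F'\in\mathcal{F}$. A subfamily of size $s$ of $\mathcal{A}$ is a subset of $\mathcal{A}$ with exactly $s$ members. *)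

theory Defs
  imports "HOL-Library.Ramsey" "HOL-Combinatorics.Permutations"
begin

text \<open>The case \<open>F = F'\<close> is included, so an intersecting family does not contain the empty set.\<close>

definition intersecting :: "'a set set \<Rightarrow> bool" where
  "intersecting \<F> \<longleftrightarrow> (\<forall>F\<in>\<F>. \<forall>F'\<in>\<F>. F \<inter> F' \<noteq> {})"

definition nsets_ge :: "'a set \<Rightarrow> nat \<Rightarrow> 'a set set" where
  "nsets_ge X r = {A. A \<subseteq> X \<and> finite A \<and> r \<le> card A}"

definition num_intersecting :: "nat \<Rightarrow> 'a set set \<Rightarrow> nat" where
  "num_intersecting s \<A> = card {\<F> \<in> nsets \<A> s. intersecting \<F>}"

definition maximises_intersecting :: "nat \<Rightarrow> nat \<Rightarrow> nat \<Rightarrow> nat set set \<Rightarrow> bool" where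
  "maximises_intersecting n m s \<A> \<longleftrightarrow>
     \<A> \<subseteq> Pow {1..n} \<and> card \<A> = m \<and>
     (\<forall>\<B>. \<B> \<subseteq> Pow {1..n} \<and> card \<B> = m \<longrightarrow> num_intersecting s \<B> \<le> num_intersecting s \<A>)"

definition same_up_to_reordering :: "nat \<Rightarrow> nat set set \<Rightarrow> nat set set \<Rightarrow> bool" where
  "same_up_to_reordering n \<A> \<B> \<longleftrightarrow> (\<exists>\<pi>. \<pi> permutes {1..n} \<and> \<B> = (\<lambda>A. \<pi> ` A) ` \<A>)"

text \<open>Existence and uniqueness in one: \<open>\<A>\<close> itself is a maximiser, and every maximiser arises
  from \<open>\<A>\<close> by permuting the ground set.\<close>

definition unique_maximiser_up_to_reordering :: "nat \<Rightarrow> nat \<Rightarrow> nat \<Rightarrow> nat set set \<Rightarrow> bool" where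
  "unique_maximiser_up_to_reordering n m s \<A> \<longleftrightarrow>
     maximises_intersecting n m s \<A> \<and>
     (\<forall>\<B>. maximises_intersecting n m s \<B> \<longrightarrow> same_up_to_reordering n \<A> \<B>)"

end

theory Submission
  imports Defs Complex_Main
begin

text \<open>
  Two compressions, adding an element and moving a set \<open>B \<union> {v}\<close> to \<open>B \<union> U\<close> with \<open>|U| \<ge> 2\<close>, never
  decrease the number of intersecting subfamilies of size \<open>s\<close>, and the last one before an extremal family
  increases it strictly. Hence only stable families matter. In case (b) these miss the sets of
  size at most one and the \<open>n - 1\<close> edges of a graph. In case (a) they contain all sets of size at least
  four, and every two-element member avoids every missing triple.

  Both cases rest on quantitative statements that a family is unlikely to contain a further small
  set: if \<open>D\<close> lies in an intersecting family then many supersets \<open>W\<close> of \<open>D\<close> can be removed or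
  complemented freely once \<open>D\<close> is deleted, so families containing \<open>D\<close> are much rarer than families not
  containing \<open>D\<close>. In case (b) this makes the Bonferroni inequalities decisive: pairwise intersecting
  edges are hit together more often, so a star is the cheapest graph to remove. In case (a) without
  missing triples one compares the families according to their trace on the graph, and again a
  star is best. If \<open>t\<close> triples are missing, \<open>t\<close> edges can be exchanged for them: families using a triple
  \<open>{x, y, z}\<close> as a substitute for the edge \<open>{y, z}\<close> are as numerous as those containing this edge, and
  those that in addition have a member \<open>V - {y, z, c, d}\<close> make up for the families containing several edges.
\<close>

section \<open>Comparing intersecting families by moving and complementing members\<close>

text \<open>Since \<open>s\<close> is arbitrary, nothing is known about a typical intersecting
  family, and all estimates come from maps that keep the number of members. Their basic move is
  complementation: next to \<open>B\<close> the set \<open>V - B\<close> is absent, so it can take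
  the place of \<open>B\<close>, and only members inside \<open>B\<close> can object. Rarity then
  means conditional frequency, and it is bootstrapped: a triple is first made rare by the constant
  factor 8, which fed back into the same argument gives 47/2, and this makes larger supersets usable
  and the factor quadratic in \<open>n\<close>.

  The quadratic order is the obstacle. In case (b), about \<open>n^3/6\<close> triples of star edges
  compete with possibly only \<open>n - 6\<close> disjoint pairs of edges in another graph. In case
  (a), the number \<open>t\<close> of missing triples can itself be of order \<open>n^2\<close>, so
  two of them must occur together more rarely than one of them by such a factor. At first order a
  substitute triple only makes up for its edge; what decides is the surplus
  \<open>marked T Y\<close> of families with a marker, and both the overlaps of triples and the
  additional edges are measured against it.\<close>

text \<open>An empty \<open>P\<close> means no condition. \<open>K\<close> collects the members
  conditioned on; a nonempty \<open>P\<close> is later a set of markers, of which at least one must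
  occur.\<close>

definition fam :: "nat \<Rightarrow> 'a set set \<Rightarrow> 'a set set \<Rightarrow> 'a set set \<Rightarrow> 'a set set set" where
  "fam s A K P = {F. F \<subseteq> A \<and> card F = s \<and> intersecting F \<and> K \<subseteq> F \<and> (P = {} \<or> F \<inter> P \<noteq> {})}"

text \<open>A member disjoint from \<open>V - X\<close> lies inside \<open>X\<close>. Cleanness says
  that only supersets of \<open>D\<close> can obstruct the insertion of \<open>V - X\<close> in this
  way.\<close>

definition clean :: "'a set \<Rightarrow> 'a set set \<Rightarrow> 'a set \<Rightarrow> bool" where
  "clean D F X \<longleftrightarrow> (\<forall>B\<in>F. B \<subseteq> X \<longrightarrow> D \<subseteq> B)"

lemma finite_fam: "finite A \<Longrightarrow> finite (fam s A K P)"
  unfolding fam_def by (rule finite_subset[of _ "Pow A"]) auto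

lemma intersectingD: "intersecting F \<Longrightarrow> B \<in> F \<Longrightarrow> C \<in> F \<Longrightarrow> B \<inter> C \<noteq> {}"
  unfolding intersecting_def by blast

text \<open>By \<open>Suc b * (q choose Suc b) = (q - b) * (q choose b)\<close> and
  \<open>b + 1 \<le> 2 ^ b\<close>, the second summand supplies \<open>2 * (q - b)\<close> copies of
  \<open>q choose b\<close>; the first supplies the other \<open>2 * b\<close> because
  \<open>2 * b \<le> 2 ^ b\<close>. In the application \<open>q\<close> sites are available,
  \<open>b\<close> are used, and the powers of two count the choices of sites to complement.\<close>

lemma choose_power_ineq:
  fixes q b :: nat
  shows "2 * q * (q choose b) \<le> 2 ^ b * (q choose b) + 2 ^ Suc b * (q choose Suc b)"
proof (cases "b \<le> q")
  case False
  then show ?thesis by (simp add: binomial_eq_0)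
next
  case True
  define c where "c = real (q choose b)"
  have c0: "c \<ge> 0" by (simp add: c_def)
  have "Suc b * (q choose Suc b) = (q - b) * (q choose b)"
    using binomial_absorb_comp[of q b] binomial_absorption[of b q]
    by (metis Suc_diff_1 binomial_absorption binomial_fact_lemma choose_reduce_nat diff_is_0_eq
        mult.commute mult_0_right nat_less_le not_less_zero zero_less_iff_neq_zero binomial_absorb_comp)
  then have e: "(real b + 1) * real (q choose Suc b) = (real q - real b) * c"
    using True unfolding c_def by (metis (no_types, lifting) of_nat_Suc of_nat_diff of_nat_mult add.commute)
  have p: "real b + 1 \<le> 2 ^ b" by (metis less_exp of_nat_Suc of_nat_le_numeral_power_cancel_iff Suc_leI add.commute)
  have "(real b + 1) * real (q choose Suc b) \<le> 2 ^ b * real (q choose Suc b)"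
    using p by (intro mult_right_mono) auto
  then have 1: "2 ^ Suc b * real (q choose Suc b) \<ge> 2 * ((real q - real b) * c)" using e by simp
  have p2: "(2::real) * real b \<le> 2 ^ b"
    by (cases b) (use less_exp in \<open>auto simp: Suc_leI simp flip: of_nat_Suc\<close>)
  have "2 ^ b * c \<ge> 2 * real b * c" using p2 c0 by (intro mult_right_mono) auto
  with 1 have "real (2 * q * (q choose b)) \<le> real (2 ^ b * (q choose b) + 2 ^ Suc b * (q choose Suc b))"
    by (simp add: c_def algebra_simps)
  then show ?thesis by (simp only: of_nat_le_iff)
qed

section \<open>Trading a member for complements of its supersets\<close>

text \<open>\<open>D\<close> is the set to be shown rare, \<open>S\<close> holds the supersets
  (sites) that are used or complemented in its place, and \<open>J\<close> the sets strictly
  between. By \<open>betS\<close> and \<open>betJ\<close> nothing else of \<open>A\<close> lies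
  between, and \<open>un\<close> makes all complements meet. As \<open>D\<close>, \<open>S\<close>
  and \<open>J\<close> avoid \<open>K\<close> and \<open>P\<close>, the side conditions survive the
  exchange.\<close>

locale ratio_setup =
  fixes V :: "'a set" and s :: nat and A K P :: "'a set set" and D :: "'a set" and S J :: "'a set set"
  assumes finV: "finite V" and AV: "A \<subseteq> Pow V"
    and DA: "D \<in> A" "V - D \<in> A" "D \<notin> K"
    and X: "\<And>X. X \<in> S \<union> J \<Longrightarrow> X \<in> A \<and> V - X \<in> A \<and> X \<notin> K \<and> D \<subset> X"
    and XP: "\<And>X. X \<in> insert D (S \<union> J) \<Longrightarrow> X \<notin> P"
    and SJ: "S \<inter> J = {}"
    and betS: "\<And>X B. X \<in> S \<Longrightarrow> B \<in> A \<Longrightarrow> D \<subseteq> B \<Longrightarrow> B \<subseteq> X \<Longrightarrow> B \<in> insert D (insert X J)"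
    and betJ: "\<And>X B. X \<in> J \<Longrightarrow> B \<in> A \<Longrightarrow> D \<subseteq> B \<Longrightarrow> B \<subseteq> X \<Longrightarrow> B \<in> insert D J"
    and un: "\<And>X Y. X \<in> insert D (S \<union> J) \<Longrightarrow> Y \<in> insert D (S \<union> J) \<Longrightarrow> X \<union> Y \<noteq> V"
begin

definition sites :: "'a set set \<Rightarrow> 'a set set" where
  "sites F = {X \<in> S. clean D F X}"

definition rest :: "'a set set \<Rightarrow> 'a set set" where
  "rest F = F - insert D (sites F)"

definition blockers :: "'a set set \<Rightarrow> 'a set set" where
  "blockers R = {I \<in> J. I \<in> R \<and> clean D R I}"

text \<open>Families containing \<open>D\<close> with the same rest \<open>R\<close> differ only in the clean sites \<open>L\<close> they use. Once
  \<open>D\<close> is deleted or complemented, every used site may be kept or complemented (those in \<open>M\<close>), which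
  gives many more families. The blockers, which can be disjoint from these complements, are complemented too.\<close>

definition image_family :: "'a set set \<Rightarrow> 'a set set \<Rightarrow> 'a set set \<Rightarrow> 'a set set \<Rightarrow> 'a set set" where
  "image_family R E L M = (R - blockers R) \<union> (L - M) \<union> (\<lambda>X. V - X) ` (blockers R \<union> M \<union> E)"

text \<open>All former members meet \<open>D\<close> and all inserted complements avoid it. So the
  members meeting \<open>D\<close> are old ones, and the complemented blockers show up through their
  complements.\<close>

definition decode :: "'a set set \<Rightarrow> 'a set set" where
  "decode F = ({B \<in> F. B \<inter> D \<noteq> {}} - insert D (sites F)) \<union> {I \<in> J. V - I \<in> F}"

lemma finA: "finite A" and finS: "finite S"
proof -
  show "finite A" using AV finV by (meson finite_Pow_iff finite_subset)
  then show "finite S" using X by (meson UnI1 finite_subset subsetI)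
qed

lemma XV: "X \<in> insert D (S \<union> J) \<Longrightarrow> X \<subseteq> V"
  using X DA(1) AV by blast

lemma XD: "X \<in> insert D (S \<union> J) \<Longrightarrow> D \<subseteq> X"
  using X by blast

lemma inj_compl: "inj_on (\<lambda>X. V - X) (insert D (S \<union> J))"
  using XV by (intro inj_onI) blast

text \<open>Only members that do not contain \<open>D\<close> can spoil a site, and
  \<open>rest\<close> removes none of these.\<close>

lemma sites_rest: "sites (rest F) = sites F"
  unfolding sites_def rest_def clean_def using XD by blast

lemma rest_facts:
  assumes F: "F \<in> fam s A (insert D K) P"
  shows "D \<noteq> {}" "\<And>B. B \<in> rest F \<Longrightarrow> B \<inter> D \<noteq> {}" "rest F \<subseteq> A" "D \<notin> rest F"
    "rest F \<inter> sites F = {}" "K \<subseteq> rest F" "intersecting (rest F)" "finite (rest F)"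
    "P = {} \<or> rest F \<inter> P \<noteq> {}" "card (rest F) + card (F \<inter> sites F) + 1 = s"
    "F = insert D (rest F \<union> (F \<inter> sites F))"
proof -
  have FA: "F \<subseteq> A" and cF: "card F = s" and iF: "intersecting F" and KF: "insert D K \<subseteq> F"
    and PF: "P = {} \<or> F \<inter> P \<noteq> {}" using F by (auto simp: fam_def)
  have finF: "finite F" using FA finA by (rule finite_subset)
  show "D \<noteq> {}" using intersectingD[OF iF, of D D] KF by blast
  show "\<And>B. B \<in> rest F \<Longrightarrow> B \<inter> D \<noteq> {}" using intersectingD[OF iF, of _ D] KF by (auto simp: rest_def)
  show "rest F \<subseteq> A" "D \<notin> rest F" "rest F \<inter> sites F = {}" using FA by (auto simp: rest_def)
  show "K \<subseteq> rest F" using KF DA(3) X by (auto simp: rest_def sites_def)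
  show "intersecting (rest F)" using iF by (auto simp: intersecting_def rest_def)
  show "finite (rest F)" using finF by (auto simp: rest_def)
  have "B \<in> rest F" if "B \<in> F \<inter> P" for B
    using that XP[of B] unfolding rest_def sites_def by blast
  then show "P = {} \<or> rest F \<inter> P \<noteq> {}" using PF by blast
  show e: "F = insert D (rest F \<union> (F \<inter> sites F))" using KF by (auto simp: rest_def)
  have Dn: "D \<notin> sites F" using X by (auto simp: sites_def)
  have "card F = Suc (card (rest F \<union> (F \<inter> sites F)))"
    by (subst e, rule card_insert_disjoint) (use finF Dn in \<open>auto simp: rest_def\<close>)
  also have "card (rest F \<union> (F \<inter> sites F)) = card (rest F) + card (F \<inter> sites F)"
    by (rule card_Un_disjoint) (use finF in \<open>auto simp: rest_def\<close>)
  finally show "card (rest F) + card (F \<inter> sites F) + 1 = s" using cF by simp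
qed

text \<open>Kept members meet \<open>D\<close> and inserted complements avoid it, so the two kinds
  never collide and \<open>R\<close>, \<open>M\<close>, \<open>L - M\<close> and \<open>E\<close>
  can be read off the image. Assumption \<open>c\<close> is the balance of sizes: the place of
  \<open>D\<close> goes either to \<open>V - D\<close> or to one more site.\<close>

lemma image_family_props:
  assumes F: "F \<in> fam s A (insert D K) P" and R: "R = rest F" and ne: "sites R \<noteq> {}"
    and L: "L \<subseteq> sites R" "M \<subseteq> L" and E: "E \<subseteq> {D}"
    and c: "card L + card E = card (F \<inter> sites F) + 1"
  shows "image_family R E L M \<in> fam s A K P" "D \<notin> image_family R E L M"
    "decode (image_family R E L M) = R"
    "M = {X \<in> sites R. V - X \<in> image_family R E L M}"
    "L - M = image_family R E L M \<inter> sites R"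
    "E = {X \<in> {D}. V - X \<in> image_family R E L M}"
proof -
  note rf = rest_facts[OF F, folded R]
  have sR: "sites F = sites R" using sites_rest R by simp
  let ?B = "blockers R" and ?G = "image_family R E L M" and ?c = "\<lambda>X. V - X"
  have BJ: "?B \<subseteq> J" "?B \<subseteq> R" by (auto simp: blockers_def)
  have QS: "sites R \<subseteq> S" by (auto simp: sites_def)
  have MS: "M \<subseteq> S" "L \<subseteq> S" using L QS by auto
  have cd: "?c X \<inter> D = {}" if "X \<in> insert D (S \<union> J)" for X using XD[OF that] by blast
  have moved: "?B \<union> M \<union> E \<subseteq> insert D (S \<union> J)" using BJ MS E by auto
  have meet: "B \<inter> D \<noteq> {}" if "B \<in> (R - ?B) \<union> (L - M)" for B
    using that rf(1,2) XD MS by blast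
  have dis: "((R - ?B) \<union> (L - M)) \<inter> ?c ` (?B \<union> M \<union> E) = {}"
    using meet cd moved by blast
  have mem: "?c X \<in> ?G \<longleftrightarrow> X \<in> ?B \<union> M \<union> E" if "X \<in> insert D (S \<union> J)" for X
  proof -
    have "?c X \<notin> (R - ?B) \<union> (L - M)" using meet cd[OF that] by blast
    then have "?c X \<in> ?G \<longleftrightarrow> ?c X \<in> ?c ` (?B \<union> M \<union> E)" unfolding image_family_def by blast
    also have "\<dots> \<longleftrightarrow> X \<in> ?B \<union> M \<union> E"
      using inj_on_image_mem_iff[OF inj_compl that moved] .
    finally show ?thesis .
  qed
  have Gmeet: "{B \<in> ?G. B \<inter> D \<noteq> {}} = (R - ?B) \<union> (L - M)"
    using meet cd moved unfolding image_family_def by blast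
  have LR: "L \<inter> R = {}" using L rf(5) sR by blast
  have DL: "D \<notin> L" using MS X by blast
  have DB: "D \<notin> ?B" using BJ X by blast
  have BM: "?B \<inter> M = {}" using BJ MS SJ by blast
  have EM: "E \<inter> (?B \<union> M) = {}" using E DL DB L by blast
  have Gsites: "sites ?G = sites R"
  proof -
    have "clean D ?G X \<longleftrightarrow> clean D R X" if "X \<in> S" for X
    proof
      assume "clean D ?G X"
      show "clean D R X" unfolding clean_def
      proof (intro ballI impI)
        fix B assume "B \<in> R" "B \<subseteq> X"
        show "D \<subseteq> B"
        proof (cases "B \<in> ?B")
          case True
          then show ?thesis using BJ XD by blast
        next
          case False
          then have "B \<in> ?G" using \<open>B \<in> R\<close> by (simp add: image_family_def)
          then show ?thesis using \<open>clean D ?G X\<close> \<open>B \<subseteq> X\<close> by (simp add: clean_def)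
        qed
      qed
    next
      assume cl: "clean D R X"
      show "clean D ?G X" unfolding clean_def
      proof (intro ballI impI)
        fix B assume B: "B \<in> ?G" "B \<subseteq> X"
        \<comment> \<open>A complement lying inside a site would make two of the sets cover
          \<open>V\<close>, against \<open>un\<close>.\<close>
        have "B \<notin> ?c ` (?B \<union> M \<union> E)"
        proof
          assume "B \<in> ?c ` (?B \<union> M \<union> E)"
          then obtain Z where Z: "Z \<in> insert D (S \<union> J)" "B = V - Z" using moved by blast
          then have "Z \<union> X = V" using B(2) XV[OF Z(1)] XV[of X] that by blast
          then show False using un[OF Z(1), of X] that by simp
        qed
        then have "B \<in> R \<or> B \<in> L" using B unfolding image_family_def by blast
        then show "D \<subseteq> B"
        proof
          assume "B \<in> R" then show ?thesis using cl B(2) by (simp add: clean_def)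
        next
          assume "B \<in> L" then show ?thesis using XD MS by blast
        qed
      qed
    qed
    then show ?thesis by (auto simp: sites_def)
  qed
  show Dn: "D \<notin> ?G" using rf(1,4) DL cd moved unfolding image_family_def by blast
  show Mchar: "M = {X \<in> sites R. ?c X \<in> ?G}"
  proof -
    have "?c Z \<in> ?G \<longleftrightarrow> Z \<in> M" if "Z \<in> sites R" for Z
    proof -
      have "Z \<in> S" using that QS by blast
      then have "Z \<notin> ?B" "Z \<notin> E" using BJ SJ E X by blast+
      then show ?thesis using mem[of Z] \<open>Z \<in> S\<close> by simp
    qed
    then show ?thesis using L by auto
  qed
  have "L - M \<subseteq> ?G" by (auto simp: image_family_def)
  moreover have "?G \<inter> sites R \<subseteq> (R - ?B) \<union> (L - M)"
    using Gmeet XD QS rf(1) by blast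
  ultimately show "L - M = ?G \<inter> sites R" using rf(5) sR L by blast
  show "E = {X \<in> {D}. ?c X \<in> ?G}" 
  proof -
    have "?c D \<in> ?G \<longleftrightarrow> D \<in> E" using mem[of D] DB DL L by auto
    then show ?thesis using E by auto
  qed
  show "decode ?G = R"
  proof -
    have "{I \<in> J. ?c I \<in> ?G} = ?B"
    proof -
      have "?c Z \<in> ?G \<longleftrightarrow> Z \<in> ?B" if "Z \<in> J" for Z
      proof -
        have "Z \<notin> M" "Z \<notin> E" using that MS SJ E X by blast+
        then show ?thesis using mem[of Z] that by simp
      qed
      then show ?thesis using BJ by auto
    qed
    moreover have "{B \<in> ?G. B \<inter> D \<noteq> {}} - insert D (sites ?G) = R - ?B"
      unfolding Gmeet Gsites using rf(4,5) sR L by blast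
    ultimately show ?thesis unfolding decode_def using BJ by blast
  qed
  have finB: "finite (?B \<union> M \<union> E)"
    using rf(8) BJ MS E finS by (meson finite.emptyI finite_Un finite_insert finite_subset)
  have cG: "card ?G = s"
  proof -
    have "card ?G = card ((R - ?B) \<union> (L - M)) + card (?c ` (?B \<union> M \<union> E))"
      unfolding image_family_def
      by (rule card_Un_disjoint) (use rf(8) finS MS finB dis in \<open>auto intro: finite_subset\<close>)
    also have "card (?c ` (?B \<union> M \<union> E)) = card (?B \<union> M \<union> E)"
      by (rule card_image) (rule inj_on_subset[OF inj_compl moved])
    also have "\<dots> = card ?B + card M + card E"
      using finB BM EM by (subst card_Un_disjoint) (auto simp: card_Un_disjoint)
    also have "card ((R - ?B) \<union> (L - M)) = (card R - card ?B) + (card L - card M)"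
    proof -
      have fin: "finite R" "finite L" "finite M" using rf(8) finS MS by (auto intro: finite_subset)
      have "card ((R - ?B) \<union> (L - M)) = card (R - ?B) + card (L - M)"
        by (rule card_Un_disjoint) (use fin LR in auto)
      then show ?thesis using fin BJ L by (simp add: card_Diff_subset finite_subset)
    qed
    finally have "card ?G = card R - card ?B + (card L - card M) + (card ?B + card M + card E)" .
    moreover have "card ?B \<le> card R" "card M \<le> card L"
      using rf(8) BJ L finS MS by (auto intro!: card_mono intro: finite_subset)
    ultimately show ?thesis using c rf(10) by linarith
  qed
  have GA: "?G \<subseteq> A" using rf(3) MS X DA E BJ unfolding image_family_def by blast
  have clB: "clean D R Z" if "Z \<in> ?B \<union> M" for Z
    using that L by (auto simp: blockers_def sites_def)
  \<comment> \<open>A member inside \<open>D\<close> lies inside any clean site and so contains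
    \<open>D\<close>. This is what admits \<open>V - D\<close>, and it needs one clean site.\<close>
  have clD: "clean D R D"
    using ne XD unfolding sites_def clean_def by blast
  have iG: "intersecting ?G"
  proof -
    have 1: "B \<inter> C \<noteq> {}" if "B \<in> (R - ?B) \<union> (L - M)" "C \<in> (R - ?B) \<union> (L - M)" for B C
    proof (cases "B \<in> R \<and> C \<in> R")
      case True then show ?thesis using intersectingD[OF rf(7)] by blast
    next
      case False
      then have "D \<subseteq> B \<or> D \<subseteq> C" using that MS XD by blast
      then show ?thesis using meet[OF that(1)] meet[OF that(2)] by blast
    qed
    \<comment> \<open>A member disjoint from \<open>V - Z\<close> lies in \<open>Z\<close>, so it
      contains \<open>D\<close> by cleanness. Then it is \<open>D\<close>, which is gone, or
      \<open>Z\<close>, which has been complemented, or it belongs to \<open>J\<close>; in the last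
      case it is a blocker and has been complemented too.\<close>
    have 2: "B \<inter> ?c Z \<noteq> {}" if B: "B \<in> (R - ?B) \<union> (L - M)" and Z: "Z \<in> ?B \<union> M \<union> E" for B Z
    proof
      assume emp: "B \<inter> ?c Z = {}"
      have BA: "B \<in> A" using B rf(3) X MS by blast
      then have BZ: "B \<subseteq> Z" using emp AV by blast
      have clZ: "clean D R Z" using Z clB clD E by blast
      have DB': "D \<subseteq> B"
      proof (cases "B \<in> R")
        case True then show ?thesis using BZ clZ by (simp add: clean_def)
      next
        case False then show ?thesis using B MS XD by blast
      qed
      have Bn: "B \<noteq> D" using B rf(4) DL by blast
      show False
      proof (cases "Z = D")
        case True then show False using DB' BZ Bn by blast
      next
        case Zn: False
        show False
        proof (cases "B \<in> J")
          case True
          then have BR: "B \<in> R" using B MS SJ by blast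
          have "clean D R B" using clZ BZ by (auto simp: clean_def)
          then have "B \<in> ?B" using True BR by (auto simp: blockers_def)
          then show False using B MS SJ BJ by blast
        next
          case BJn: False
          have "Z \<in> M \<or> Z \<in> ?B" using Z E Zn by blast
          then have "B = Z \<and> Z \<in> M"
          proof
            assume "Z \<in> M"
            then show ?thesis using betS[of Z B] MS BA DB' BZ Bn BJn by blast
          next
            assume "Z \<in> ?B"
            then show ?thesis using betJ[of Z B] BJ BA DB' BZ Bn BJn by blast
          qed
          then show False using B LR L by blast
        qed
      qed
    qed
    have 3: "?c Z \<inter> ?c Z' \<noteq> {}" if "Z \<in> ?B \<union> M \<union> E" "Z' \<in> ?B \<union> M \<union> E" for Z Z'
    proof -
      have ZZ: "Z \<in> insert D (S \<union> J)" "Z' \<in> insert D (S \<union> J)" 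
        by (rule subsetD[OF moved that(1)], rule subsetD[OF moved that(2)])
      have "Z \<union> Z' \<noteq> V" using un[OF ZZ] .
      moreover have "Z \<subseteq> V" "Z' \<subseteq> V" using XV ZZ by auto
      ultimately have "\<exists>v\<in>V. v \<notin> Z \<and> v \<notin> Z'" by blast
      then show ?thesis by blast
    qed
    show ?thesis unfolding intersecting_def
    proof (intro ballI)
      fix B C assume "B \<in> ?G" "C \<in> ?G"
      then show "B \<inter> C \<noteq> {}" unfolding image_family_def 
        using 1[of B C] 2[of B] 2[of C] 3 by (auto simp: Int_commute)
    qed
  qed
  have KG: "K \<subseteq> ?G"
  proof -
    have "K \<inter> ?B = {}" using BJ X by blast
    then show ?thesis using rf(6) by (auto simp: image_family_def)
  qed
  have PG: "P = {} \<or> ?G \<inter> P \<noteq> {}"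
    using rf(9) XP BJ unfolding image_family_def by blast
  show "?G \<in> fam s A K P" using GA cG iG KG PG by (auto simp: fam_def)
qed

text \<open>Families containing \<open>D\<close> are grouped by \<open>rest\<close>. A class with
  \<open>q\<close> clean sites, \<open>b\<close> of them in use, has at most
  \<open>q choose b\<close> members and yields
  \<open>2 ^ b * (q choose b) + 2 ^ Suc b * (q choose Suc b)\<close> images without
  \<open>D\<close>, so \<open>choose_power_ineq\<close> applies. Images of different classes are
  disjoint because \<open>decode\<close> returns the rest.\<close>

lemma ratio:
  "2 * (\<Sum>F\<in>fam s A (insert D K) P. card (sites F)) \<le> card {F \<in> fam s A K P. D \<notin> F}"
proof -
  let ?PF = "fam s A (insert D K) P" and ?N = "{F \<in> fam s A K P. D \<notin> F}"
  define RR where "RR = rest ` ?PF"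
  define b where "b R = s - 1 - card R" for R :: "'a set set"
  define cls where "cls R = {F \<in> ?PF. rest F = R}" for R
  define Sig where "Sig R k = (SIGMA L:{L. L \<subseteq> sites R \<and> card L = k}. Pow L)" for R k
  define I where "I R = {{D}} \<times> Sig R (b R) \<union> {{}} \<times> Sig R (Suc (b R))" for R
  \<comment> \<open>A class without clean sites adds nothing to the left side, and its images might
    fail to be intersecting, so it gets none.\<close>
  define Img where "Img R = (if sites R = {} then {} else (\<lambda>(E, L, M). image_family R E L M) ` I R)" for R
  have finPF: "finite ?PF" "finite ?N" using finite_fam[OF finA] by auto
  have fsites: "finite (sites R)" for R using finS by (auto simp: sites_def)
  have bR: "card (F \<inter> sites F) = b (rest F)" if "F \<in> ?PF" for F
    using rest_facts(10)[OF that] by (simp add: b_def)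
  have fib: "2 * (\<Sum>F\<in>cls R. card (sites F)) \<le> card (Img R)" if RRR: "R \<in> RR" for R
  proof (cases "sites R = {}")
    case True
    then have "card (sites F) = 0" if "F \<in> cls R" for F
      using that sites_rest[of F] by (simp add: cls_def)
    then show ?thesis by simp
  next
    case False
    obtain F0 where F0: "F0 \<in> ?PF" "R = rest F0" using RRR by (auto simp: RR_def)
    let ?q = "card (sites R)" and ?b = "b R"
    have "(\<Sum>F\<in>cls R. card (sites F)) = (\<Sum>F\<in>cls R. ?q)"
      using sites_rest by (intro sum.cong) (auto simp: cls_def)
    then have 1: "(\<Sum>F\<in>cls R. card (sites F)) = card (cls R) * ?q" by simp
    have "card (cls R) \<le> card {L. L \<subseteq> sites R \<and> card L = ?b}"
    proof (rule card_inj_on_le[where f = "\<lambda>F. F \<inter> sites R"])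
      show "inj_on (\<lambda>F. F \<inter> sites R) (cls R)"
      proof (rule inj_onI)
        fix F G assume FG: "F \<in> cls R" "G \<in> cls R" "F \<inter> sites R = G \<inter> sites R"
        then show "F = G" using rest_facts(11)[of F] rest_facts(11)[of G] sites_rest[of F] sites_rest[of G]
          by (simp add: cls_def)
      qed
      show "(\<lambda>F. F \<inter> sites R) ` cls R \<subseteq> {L. L \<subseteq> sites R \<and> card L = ?b}"
        using bR sites_rest by (auto simp: cls_def)
      show "finite {L. L \<subseteq> sites R \<and> card L = ?b}" using fsites by simp
    qed
    then have 2: "card (cls R) \<le> ?q choose ?b" using n_subsets[OF fsites] by simp
    have cSig: "card (Sig R k) = (?q choose k) * 2 ^ k" for k
    proof -
      have "card (Sig R k) = (\<Sum>L\<in>{L. L \<subseteq> sites R \<and> card L = k}. card (Pow L))"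
        unfolding Sig_def using fsites by (intro card_SigmaI) (auto intro: finite_subset)
      also have "\<dots> = (\<Sum>L\<in>{L. L \<subseteq> sites R \<and> card L = k}. 2 ^ k)"
        by (intro sum.cong) (auto simp: card_Pow dest: finite_subset[OF _ fsites])
      also have "\<dots> = (?q choose k) * 2 ^ k" using n_subsets[OF fsites] by simp
      finally show ?thesis .
    qed
    have finSig: "finite (Sig R k)" for k unfolding Sig_def
      using fsites by (intro finite_SigmaI) (auto intro: finite_subset)
    have cI: "card (I R) = (?q choose ?b) * 2 ^ ?b + (?q choose Suc ?b) * 2 ^ Suc ?b"
      unfolding I_def using finSig cSig by (subst card_Un_disjoint) (auto simp: card_cartesian_product)
    have props: "E \<subseteq> {D} \<and> L \<subseteq> sites R \<and> M \<subseteq> L \<and> card L + card E = card (F0 \<inter> sites F0) + 1"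
      if "(E, L, M) \<in> I R" for E L M
      using that bR[OF F0(1)] F0(2) by (auto simp: I_def Sig_def)
    have "inj_on (\<lambda>(E, L, M). image_family R E L M) (I R)"
    proof (rule inj_onI)
      fix x x' assume x: "x \<in> I R" "x' \<in> I R"
        and eqx: "(\<lambda>(E, L, M). image_family R E L M) x = (\<lambda>(E, L, M). image_family R E L M) x'"
      obtain E L M E' L' M' where xx: "x = (E, L, M)" "x' = (E', L', M')" by (metis prod_cases3)
      have a: "(E, L, M) \<in> I R" "(E', L', M') \<in> I R" and eq: "image_family R E L M = image_family R E' L' M'"
        using x eqx xx by auto
      note p = props[OF a(1)] and p' = props[OF a(2)]
      have "M = M'" using image_family_props(4)[OF F0 False, of L M E] image_family_props(4)[OF F0 False, of L' M' E']
          p p' eq by simp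
      moreover have "L - M = L' - M'" using image_family_props(5)[OF F0 False, of L M E] image_family_props(5)[OF F0 False, of L' M' E']
          p p' eq by simp
      moreover have "E = E'" using image_family_props(6)[OF F0 False, of L M E] image_family_props(6)[OF F0 False, of L' M' E']
          p p' eq by simp
      ultimately show "x = x'" using p p' xx by blast
    qed
    then have "card (Img R) = (?q choose ?b) * 2 ^ ?b + (?q choose Suc ?b) * 2 ^ Suc ?b"
      using False cI by (simp add: Img_def card_image)
    then have 3: "card (Img R) = 2 ^ ?b * (?q choose ?b) + 2 ^ Suc ?b * (?q choose Suc ?b)"
      by (simp only: mult.commute)
    have "2 * (\<Sum>F\<in>cls R. card (sites F)) = 2 * ?q * card (cls R)" unfolding 1 by (simp only: mult_ac)
    also have "\<dots> \<le> 2 * ?q * (?q choose ?b)" using 2 by (rule mult_le_mono2)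
    also have "\<dots> \<le> card (Img R)" unfolding 3 by (rule choose_power_ineq)
    finally show ?thesis .
  qed
  have sub: "G \<in> ?N \<and> decode G = R" if RG: "R \<in> RR" "G \<in> Img R" for R G
  proof -
    have ne: "sites R \<noteq> {}" using RG by (auto simp: Img_def split: if_splits)
    obtain F0 where F0: "F0 \<in> ?PF" "R = rest F0" using RG by (auto simp: RR_def)
    obtain E L M where G: "G = image_family R E L M" and ELM: "(E, L, M) \<in> I R"
      using RG ne by (auto simp: Img_def)
    have "E \<subseteq> {D} \<and> L \<subseteq> sites R \<and> M \<subseteq> L \<and> card L + card E = card (F0 \<inter> sites F0) + 1"
      using ELM bR[OF F0(1)] F0(2) by (auto simp: I_def Sig_def)
    then show ?thesis using image_family_props(1-3)[OF F0 ne, of L M E] G by simp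
  qed
  have "2 * (\<Sum>F\<in>?PF. card (sites F)) = 2 * (\<Sum>R\<in>RR. \<Sum>F\<in>cls R. card (sites F))"
    unfolding RR_def cls_def by (subst sum.image_gen[OF finPF(1), of _ rest]) simp
  also have "\<dots> = (\<Sum>R\<in>RR. 2 * (\<Sum>F\<in>cls R. card (sites F)))" by (simp add: sum_distrib_left)
  also have "\<dots> \<le> (\<Sum>R\<in>RR. card (Img R))" by (intro sum_mono fib)
  also have "\<dots> = card (\<Union>R\<in>RR. Img R)"
  proof (rule card_UN_disjoint[symmetric])
    show "finite RR" using finPF by (simp add: RR_def)
    show "\<forall>R\<in>RR. finite (Img R)" using sub finPF(2) by (meson finite_subset subsetI)
    show "\<forall>R\<in>RR. \<forall>R'\<in>RR. R \<noteq> R' \<longrightarrow> Img R \<inter> Img R' = {}" using sub by blast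
  qed
  also have "\<dots> \<le> card ?N" using sub finPF(2) by (intro card_mono) auto
  finally show ?thesis .
qed

text \<open>Double counting pairs of a family and one of its clean sites. The parameter
  \<open>p\<close> is a lower bound for the conditional probability, given \<open>D\<close>, that a
  site is clean.\<close>

lemma ratio_bound:
  assumes p: "\<And>X. X \<in> S \<Longrightarrow>
      p * real (card (fam s A (insert D K) P)) \<le> real (card {F \<in> fam s A (insert D K) P. clean D F X})"
  shows "2 * p * real (card S) * real (card (fam s A (insert D K) P)) \<le> real (card {F \<in> fam s A K P. D \<notin> F})"
    and "(1 + 2 * p * real (card S)) * real (card (fam s A (insert D K) P)) \<le> real (card (fam s A K P))"
proof -
  let ?PF = "fam s A (insert D K) P"
  have fin: "finite ?PF" "finite (fam s A K P)" using finite_fam[OF finA] by auto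
  have "(\<Sum>F\<in>?PF. card (sites F)) = (\<Sum>F\<in>?PF. \<Sum>X\<in>S. if clean D F X then 1 else 0)"
    using finS by (intro sum.cong) (auto simp: sites_def sum.If_cases Int_def)
  also have "\<dots> = (\<Sum>X\<in>S. \<Sum>F\<in>?PF. if clean D F X then 1 else 0)" by (rule sum.swap)
  also have "\<dots> = (\<Sum>X\<in>S. card {F \<in> ?PF. clean D F X})"
    using fin by (intro sum.cong) (auto simp: sum.If_cases Int_def)
  finally have "real (\<Sum>F\<in>?PF. card (sites F)) = (\<Sum>X\<in>S. real (card {F \<in> ?PF. clean D F X}))" by simp
  moreover have "(\<Sum>X\<in>S. p * real (card ?PF)) \<le> (\<Sum>X\<in>S. real (card {F \<in> ?PF. clean D F X}))"
    by (intro sum_mono p)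
  ultimately have 1: "real (card S) * (p * real (card ?PF)) \<le> real (\<Sum>F\<in>?PF. card (sites F))" by simp
  have 2: "2 * real (\<Sum>F\<in>?PF. card (sites F)) \<le> real (card {F \<in> fam s A K P. D \<notin> F})"
    using of_nat_mono[OF ratio, where 'a = real] by simp
  show 3: "2 * p * real (card S) * real (card ?PF) \<le> real (card {F \<in> fam s A K P. D \<notin> F})"
    using 1 2 by (simp add: algebra_simps)
  have "card (fam s A K P) = card {F \<in> fam s A K P. D \<notin> F} + card ?PF"
  proof -
    have "fam s A K P = {F \<in> fam s A K P. D \<notin> F} \<union> ?PF" by (auto simp: fam_def)
    moreover have "{F \<in> fam s A K P. D \<notin> F} \<inter> ?PF = {}" by (auto simp: fam_def)
    ultimately show ?thesis using fin by (metis (no_types, lifting) card_Un_disjoint finite_Un)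
  qed
  then show "(1 + 2 * p * real (card S)) * real (card ?PF) \<le> real (card (fam s A K P))"
    using 3 by (simp add: algebra_simps)
qed

end

text \<open>A member \<open>B\<close> that is minimal among the sets that may occur can be complemented.\<close>

lemma flip_minimal:
  assumes V: "finite V" "A \<subseteq> Pow V" and B: "B \<in> A" "V - B \<in> A" "B \<notin> K" "B \<notin> P" "V - B \<notin> L"
    and min: "\<And>C. C \<in> A \<Longrightarrow> C \<subseteq> B \<Longrightarrow> C = B \<or> C \<in> L"
  shows "card {F \<in> fam s A K P. F \<inter> L = {}} \<le> 2 * card {F \<in> fam s A K P. F \<inter> insert B L = {}}"
proof -
  let ?X = "{F \<in> fam s A K P. F \<inter> L = {} \<and> B \<in> F}" and ?Y = "{F \<in> fam s A K P. F \<inter> insert B L = {}}"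
  have finA: "finite A" using V by (meson finite_Pow_iff finite_subset)
  note fin = finite_fam[OF finA]
  have "card ?X \<le> card ?Y"
  proof (rule card_inj_on_le[where f = "\<lambda>F. insert (V - B) (F - {B})"])
    have nin: "V - B \<notin> F" "B \<noteq> {}" if "F \<in> ?X" for F
      using that intersectingD[of F B "V - B"] intersectingD[of F B B] by (auto simp: fam_def)
    show "inj_on (\<lambda>F. insert (V - B) (F - {B})) ?X"
    proof (rule inj_onI)
      fix F G assume F: "F \<in> ?X" and G: "G \<in> ?X" and eq: "insert (V - B) (F - {B}) = insert (V - B) (G - {B})"
      have "V - B \<notin> F - {B}" "V - B \<notin> G - {B}" using nin(1)[OF F] nin(1)[OF G] by simp_all
      then have "F - {B} = G - {B}" using eq by (metis insert_ident)
      then show "F = G" using F G by blast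
    qed
    show "(\<lambda>F. insert (V - B) (F - {B})) ` ?X \<subseteq> ?Y"
    proof clarify
      fix F assume F: "F \<in> fam s A K P" "F \<inter> L = {}" "B \<in> F"
      then have FX: "F \<in> ?X" by simp
      have FA: "F \<subseteq> A" and cF: "card F = s" and iF: "intersecting F" and KF: "K \<subseteq> F"
        and PF: "P = {} \<or> F \<inter> P \<noteq> {}" using F by (auto simp: fam_def)
      have finF: "finite F" using FA finA by (rule finite_subset)
      have ne: "V - B \<noteq> {}"
      proof
        assume "V - B = {}"
        then have "B = V" using B(1) V by auto
        then have "F \<subseteq> {B} \<union> L" using min FA V(2) by blast
        then have "F = {B}" using F by blast
        then show False using min[of "V - B"] B(2,5) \<open>V - B = {}\<close> nin(2)[OF FX] by auto
      qed
      have int: "C \<inter> (V - B) \<noteq> {}" if "C \<in> F - {B}" for C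
      proof
        assume "C \<inter> (V - B) = {}"
        then have "C \<subseteq> B" using that FA V by blast
        then show False using min[of C] that FA F(2) by blast
      qed
      have "intersecting (insert (V - B) (F - {B}))"
        unfolding intersecting_def using iF int ne by (auto simp: intersecting_def Int_commute)
      moreover have "card (insert (V - B) (F - {B})) = s"
        using nin(1)[OF FX] finF F(3) cF
        by (metis (no_types, lifting) Diff_iff card.insert_remove card_Diff_singleton card_insert_disjoint finite_Diff
            card_Suc_Diff1)
      moreover have "B \<noteq> V - B" using nin(1)[OF FX] F(3) by auto
      ultimately show "insert (V - B) (F - {B}) \<in> fam s A K P \<and> insert (V - B) (F - {B}) \<inter> insert B L = {}"
        using FA KF PF B F(2) by (auto simp: fam_def)
    qed
    show "finite ?Y" using fin by simp
  qed
  moreover have "card {F \<in> fam s A K P. F \<inter> L = {}} = card ?X + card ?Y"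
  proof -
    have "{F \<in> fam s A K P. F \<inter> L = {}} = ?X \<union> ?Y" by blast
    moreover have "card (?X \<union> ?Y) = card ?X + card ?Y"
      by (rule card_Un_disjoint) (use fin in auto)
    ultimately show ?thesis by simp
  qed
  ultimately show ?thesis by simp
qed

lemma card_avoid:
  assumes "finite A" "finite L"
  shows "card (fam s A K P) \<le> card {F \<in> fam s A K P. F \<inter> L = {}} + (\<Sum>B\<in>L. card (fam s A (insert B K) P))"
proof -
  have "fam s A K P \<subseteq> {F \<in> fam s A K P. F \<inter> L = {}} \<union> (\<Union>B\<in>L. fam s A (insert B K) P)"
    by (auto simp: fam_def)
  then have "card (fam s A K P) \<le> card ({F \<in> fam s A K P. F \<inter> L = {}} \<union> (\<Union>B\<in>L. fam s A (insert B K) P))"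
    using finite_fam[OF assms(1)] assms(2) by (intro card_mono) auto
  also have "\<dots> \<le> card {F \<in> fam s A K P. F \<inter> L = {}} + card (\<Union>B\<in>L. fam s A (insert B K) P)"
    by (rule card_Un_le)
  also have "card (\<Union>B\<in>L. fam s A (insert B K) P) \<le> (\<Sum>B\<in>L. card (fam s A (insert B K) P))"
    using assms(2) by (rule card_UN_le)
  finally show ?thesis by simp
qed

section \<open>Small members are rare\<close>

locale ground =
  fixes V :: "'a set" and s :: nat
  assumes finV: "finite V" and V21: "21 \<le> card V"
begin

text \<open>Models the sets that can occur next to \<open>{y, z}\<close> in an intersecting family.\<close>

definition anchored :: "'a set set \<Rightarrow> 'a \<Rightarrow> 'a \<Rightarrow> nat \<Rightarrow> bool" where
  "anchored A y z m \<longleftrightarrow> A \<subseteq> Pow V \<and> y \<in> V \<and> z \<in> V \<and> y \<noteq> z \<and>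
     (\<forall>B. B \<subseteq> V \<and> y \<in> B \<and> z \<notin> B \<and> m \<le> card B \<and> card B \<le> 5 \<longrightarrow> B \<in> A \<and> V - B \<in> A) \<and>
     (\<forall>B\<in>A. card B \<le> 5 \<and> z \<notin> B \<longrightarrow> y \<in> B \<and> m \<le> card B)"

lemma anchoredD:
  assumes "anchored A y z m"
  shows "A \<subseteq> Pow V" "y \<in> V" "z \<in> V" "y \<noteq> z"
    "\<And>B. B \<subseteq> V \<Longrightarrow> y \<in> B \<Longrightarrow> z \<notin> B \<Longrightarrow> m \<le> card B \<Longrightarrow> card B \<le> 5 \<Longrightarrow> B \<in> A"
    "\<And>B. B \<subseteq> V \<Longrightarrow> y \<in> B \<Longrightarrow> z \<notin> B \<Longrightarrow> m \<le> card B \<Longrightarrow> card B \<le> 5 \<Longrightarrow> V - B \<in> A"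
    "\<And>B. B \<in> A \<Longrightarrow> card B \<le> 5 \<Longrightarrow> z \<notin> B \<Longrightarrow> y \<in> B"
    "\<And>B. B \<in> A \<Longrightarrow> card B \<le> 5 \<Longrightarrow> z \<notin> B \<Longrightarrow> m \<le> card B"
  using assms unfolding anchored_def by blast+

lemma fin_anch: "anchored A y z m \<Longrightarrow> finite A"
  using finV by (meson anchoredD(1) finite_Pow_iff finite_subset)

lemma union_small: "card X \<le> 5 \<Longrightarrow> card Y \<le> 5 \<Longrightarrow> X \<union> Y \<noteq> V"
  using V21 card_Un_le[of X Y] by auto

text \<open>Reduces a bound on \<open>p\<close> to an explicit list \<open>L\<close> of sets to
  avoid.\<close>

lemma clean_superset:
  assumes "\<And>B. B \<in> A \<Longrightarrow> B \<subseteq> X \<Longrightarrow> \<not> D \<subseteq> B \<Longrightarrow> B \<in> L" "finite A"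
  shows "card {F \<in> fam s A K P. F \<inter> L = {}} \<le> card {F \<in> fam s A K P. clean D F X}"
proof (rule card_mono)
  show "finite {F \<in> fam s A K P. clean D F X}" using finite_fam[OF assms(2)] by simp
  show "{F \<in> fam s A K P. F \<inter> L = {}} \<subseteq> {F \<in> fam s A K P. clean D F X}"
  proof clarify
    fix F assume F: "F \<in> fam s A K P" "F \<inter> L = {}"
    then have "F \<subseteq> A" by (simp add: fam_def)
    then show "clean D F X" using assms(1) F(2) unfolding clean_def by blast
  qed
qed

lemma flip_anchored:
  assumes a: "anchored A y z m" and B: "B \<subseteq> V" "y \<in> B" "z \<notin> B" "m \<le> card B" "card B \<le> 5" "B \<notin> K"
    and P: "\<forall>Q\<in>P. y \<notin> Q" and L: "\<forall>Q\<in>L. y \<in> Q"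
    and min: "\<And>C. C \<subseteq> B \<Longrightarrow> y \<in> C \<Longrightarrow> m \<le> card C \<Longrightarrow> C = B \<or> C \<in> L"
  shows "card {F \<in> fam s A K P. F \<inter> L = {}} \<le> 2 * card {F \<in> fam s A K P. F \<inter> insert B L = {}}"
proof (rule flip_minimal[OF finV anchoredD(1)[OF a]])
  show "B \<in> A" "V - B \<in> A" using anchoredD(5,6)[OF a] B by auto
  show "B \<notin> K" "B \<notin> P" "V - B \<notin> L" using B P L by auto
  fix C assume C: "C \<in> A" "C \<subseteq> B"
  have "finite B" using B(1) finV by (rule finite_subset)
  then have "card C \<le> 5" using card_mono[of B C] C(2) B(5) by simp
  moreover have "z \<notin> C" using C B by blast
  ultimately show "C = B \<or> C \<in> L" using min[OF C(2)] anchoredD(7,8)[OF a C(1)] by blast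
qed

section \<open>Conditional rarity of triples and pairs\<close>

text \<open>The sites add one element to \<open>D\<close>; nothing lies strictly between, so there
  are no intermediate sets.\<close>

lemma level_one:
  assumes a: "anchored A y z m" and D: "D \<subseteq> V" "y \<in> D" "z \<notin> D" "m \<le> card D" "card D \<le> 4" "D \<notin> K"
    and P: "\<forall>Q\<in>P. y \<notin> Q" and C: "C \<subseteq> V - D - {z}" "\<And>c. c \<in> C \<Longrightarrow> insert c D \<notin> K"
    and p: "\<And>c. c \<in> C \<Longrightarrow> p * real (card (fam s A (insert D K) P))
              \<le> real (card {F \<in> fam s A (insert D K) P. clean D F (insert c D)})"
  shows "(1 + 2 * p * real (card C)) * real (card (fam s A (insert D K) P)) \<le> real (card (fam s A K P))"
proof -
  have fD: "finite D" using D(1) finV by (rule finite_subset)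
  let ?S = "(\<lambda>c. insert c D) ` C"
  have cS: "card W \<le> 5 \<and> m \<le> card W \<and> W \<subseteq> V \<and> y \<in> W \<and> z \<notin> W \<and> D \<subset> W" if "W \<in> ?S" for W
    using that C(1) D fD a anchoredD(4)[OF a] by (auto simp: card_insert_if)
  interpret ratio_setup V s A K P D ?S "{}"
  proof
    show "finite V" by (rule finV)
    show "A \<subseteq> Pow V" by (rule anchoredD(1)[OF a])
    show "D \<in> A" "V - D \<in> A" using anchoredD(5,6)[OF a] D by auto
    show "D \<notin> K" by fact
    show "W \<in> A \<and> V - W \<in> A \<and> W \<notin> K \<and> D \<subset> W" if "W \<in> ?S \<union> {}" for W
    proof -
      have W: "W \<in> ?S" using that by simp
      then have "W \<notin> K" using C(2) by blast
      then show ?thesis using cS[OF W] anchoredD(5,6)[OF a, of W] by blast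
    qed
    show "W \<notin> P" if "W \<in> insert D (?S \<union> {})" for W using that D(2) P by auto
    show "?S \<inter> {} = {}" by simp
    show "B \<in> insert D (insert W {})" if "W \<in> ?S" "B \<in> A" "D \<subseteq> B" "B \<subseteq> W" for W B
      using that by blast
    show "B \<in> insert D {}" if "W \<in> {}" for W B :: "'a set" using that by simp
    show "W \<union> W' \<noteq> V" if "W \<in> insert D (?S \<union> {})" "W' \<in> insert D (?S \<union> {})" for W W'
    proof (rule union_small)
      show "card W \<le> 5" "card W' \<le> 5" using that cS D(5) by auto
    qed
  qed
  have "card ?S = card C" by (rule card_image, rule inj_onI) (use C(1) in blast)
  then show ?thesis using ratio_bound(2)[of p] p by auto
qed

lemma subset4: "B \<subseteq> {y, b, b', c} \<Longrightarrow> y \<in> B \<Longrightarrow> 3 \<le> card B \<Longrightarrow> \<not> {y, b, b'} \<subseteq> B \<Longrightarrow> B = {y, b, c} \<or> B = {y, b', c}"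
proof -
  assume B: "B \<subseteq> {y, b, b', c}" "y \<in> B" "3 \<le> card B" "\<not> {y, b, b'} \<subseteq> B"
  then have "B \<subseteq> {y, b, c} \<or> B \<subseteq> {y, b', c}" by blast
  moreover have c3: "card {y, b, c} \<le> card B" "card {y, b', c} \<le> card B"
    using B(3) by (auto simp: card_insert_if)
  ultimately show ?thesis using card_seteq[OF _ _ c3(1)] card_seteq[OF _ _ c3(2)] by auto
qed

text \<open>The site \<open>{y, b, b', c}\<close> is obstructed only by \<open>{y, b, c}\<close> and
  \<open>{y, b', c}\<close>. Both are minimal and can be complemented in turn, so it is clean with
  probability at least 1/4; at least \<open>21 - 4 - 3 = 14\<close> choices of \<open>c\<close> give
  \<open>1 + 2 * (1/4) * 14 = 8\<close>. The set \<open>X\<close> keeps the conditioned members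
  without \<open>z\<close> apart from all sets that are complemented: they meet \<open>X\<close>,
  the others do not.\<close>

lemma rare_triple_weak:
  assumes a: "anchored A y z 3" and b: "b \<in> V" "b' \<in> V" "b \<noteq> b'" "b \<notin> {y, z}" "b' \<notin> {y, z}"
    and P: "\<forall>Q\<in>P. y \<notin> Q" and X: "X \<inter> {y, b, b'} = {}" "finite X" "card X \<le> 3"
    and K: "\<forall>k\<in>K. z \<in> k \<or> k \<inter> X \<noteq> {}"
  shows "8 * real (card (fam s A (insert {y, b, b'} K) P)) \<le> real (card (fam s A K P))"
proof -
  note ad = anchoredD[OF a]
  let ?D = "{y, b, b'}" and ?C = "V - {y, z, b, b'} - X"
  have Kn: "W \<notin> K" if "z \<notin> W" "W \<inter> X = {}" for W using K that by blast
  have cD: "card ?D = 3" using b by (auto simp: card_insert_if)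
  let ?f = "real (card (fam s A (insert ?D K) P))"
  have cC: "14 \<le> card ?C"
  proof -
    have "card V - card ({y, z, b, b'} \<union> X) \<le> card (V - ({y, z, b, b'} \<union> X))"
      by (rule diff_card_le_card_Diff) (use X in simp)
    moreover have "card ({y, z, b, b'} \<union> X) \<le> 4 + 3"
      using card_Un_le[of "{y, z, b, b'}" X] X by (auto simp: card_insert_if)
    moreover have "V - ({y, z, b, b'} \<union> X) = ?C" by blast
    ultimately show ?thesis using V21 by simp
  qed
  have "(1 + 2 * (1/4) * real (card ?C)) * ?f \<le> real (card (fam s A K P))"
  proof (rule level_one[OF a])
    show "?D \<subseteq> V" "y \<in> ?D" "z \<notin> ?D" "3 \<le> card ?D" "card ?D \<le> 4" using b ad cD by auto
    show "?D \<notin> K" using Kn[of ?D] b ad(4) X(1) by auto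
    show "\<forall>Q\<in>P. y \<notin> Q" by fact
    show "?C \<subseteq> V - ?D - {z}" by blast
    fix c assume c: "c \<in> ?C"
    show "insert c ?D \<notin> K" using Kn[of "insert c ?D"] c b ad(4) X(1) by auto
    let ?B1 = "{y, b, c}" and ?B2 = "{y, b', c}"
    have d: "c \<in> V" "c \<notin> {y, z, b, b'}" "c \<notin> X" using c by auto
    have c3: "card ?B1 = 3" "card ?B2 = 3" using d b by (auto simp: card_insert_if)
    have "card {F \<in> fam s A (insert ?D K) P. F \<inter> {} = {}} \<le> 2 * card {F \<in> fam s A (insert ?D K) P. F \<inter> {?B1} = {}}"
    proof (rule flip_anchored[OF a])
      show "?B1 \<notin> insert ?D K" using Kn[of ?B1] b d X ad(4) by auto
      show "C = ?B1 \<or> C \<in> {}" if "C \<subseteq> ?B1" "3 \<le> card C" for C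
        using that c3 card_seteq[of ?B1 C] by auto
    qed (use b d ad c3 P in auto)
    moreover have "card {F \<in> fam s A (insert ?D K) P. F \<inter> {?B1} = {}} \<le> 2 * card {F \<in> fam s A (insert ?D K) P. F \<inter> {?B2, ?B1} = {}}"
    proof (rule flip_anchored[OF a])
      show "?B2 \<notin> insert ?D K" using Kn[of ?B2] b d X ad(4) by auto
      show "C = ?B2 \<or> C \<in> {?B1}" if "C \<subseteq> ?B2" "3 \<le> card C" for C
        using that c3 card_seteq[of ?B2 C] by auto
    qed (use b d ad c3 P in auto)
    moreover have "card {F \<in> fam s A (insert ?D K) P. F \<inter> {?B2, ?B1} = {}}
        \<le> card {F \<in> fam s A (insert ?D K) P. clean ?D F (insert c ?D)}"
    proof (rule clean_superset[OF _ fin_anch[OF a]])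
      fix B assume B: "B \<in> A" "B \<subseteq> insert c ?D" "\<not> ?D \<subseteq> B"
      have "card B \<le> card (insert c ?D)" by (rule card_mono) (use B in auto)
      then have "card B \<le> 5" using cD d by auto
      moreover have "z \<notin> B" using B(2) d b ad(4) by auto
      ultimately have "y \<in> B" "3 \<le> card B" using ad(7,8) B(1) by auto
      then show "B \<in> {?B2, ?B1}" using subset4[of B y b b' c] B by blast
    qed
    ultimately show "1/4 * ?f \<le> real (card {F \<in> fam s A (insert ?D K) P. clean ?D F (insert c ?D)})"
      by simp
  qed
  moreover have "8 * ?f \<le> (1 + 2 * (1/4) * real (card ?C)) * ?f"
    using cC by (intro mult_right_mono) auto
  ultimately show ?thesis by linarith
qed

text \<open>Second round: given the triple, each of the two obstructing triples is present with
  probability at most 1/8 by the weak bound, so 3/4 replaces 1/4. That appeal adds \<open>b\<close>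
  or \<open>b'\<close> to \<open>X\<close>, which is why \<open>X\<close> may have only two elements
  here; 15 choices of \<open>c\<close> give \<open>1 + 2 * (3/4) * 15 = 47/2\<close>.\<close>

lemma rare_triple:
  assumes a: "anchored A y z 3" and b: "b \<in> V" "b' \<in> V" "b \<noteq> b'" "b \<notin> {y, z}" "b' \<notin> {y, z}"
    and P: "\<forall>Q\<in>P. y \<notin> Q" and X: "X \<inter> {y, b, b'} = {}" "finite X" "card X \<le> 2"
    and K: "\<forall>k\<in>K. z \<in> k \<or> k \<inter> X \<noteq> {}"
  shows "47/2 * real (card (fam s A (insert {y, b, b'} K) P)) \<le> real (card (fam s A K P))"
proof -
  note ad = anchoredD[OF a]
  let ?D = "{y, b, b'}" and ?C = "V - {y, z, b, b'} - X"
  have Kn: "W \<notin> K" if "z \<notin> W" "W \<inter> X = {}" for W using K that by blast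
  have cD: "card ?D = 3" using b by (auto simp: card_insert_if)
  let ?f = "real (card (fam s A (insert ?D K) P))"
  have cC: "15 \<le> card ?C"
  proof -
    have "card V - card ({y, z, b, b'} \<union> X) \<le> card (V - ({y, z, b, b'} \<union> X))"
      by (rule diff_card_le_card_Diff) (use X in simp)
    moreover have "card ({y, z, b, b'} \<union> X) \<le> 4 + 2"
      using card_Un_le[of "{y, z, b, b'}" X] X by (auto simp: card_insert_if)
    moreover have "V - ({y, z, b, b'} \<union> X) = ?C" by blast
    ultimately show ?thesis using V21 by simp
  qed
  have "(1 + 2 * (3/4) * real (card ?C)) * ?f \<le> real (card (fam s A K P))"
  proof (rule level_one[OF a])
    show "?D \<subseteq> V" "y \<in> ?D" "z \<notin> ?D" "3 \<le> card ?D" "card ?D \<le> 4" using b ad cD by auto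
    show "?D \<notin> K" using Kn[of ?D] b ad(4) X(1) by auto
    show "\<forall>Q\<in>P. y \<notin> Q" by fact
    show "?C \<subseteq> V - ?D - {z}" by blast
    fix c assume c: "c \<in> ?C"
    show "insert c ?D \<notin> K" using Kn[of "insert c ?D"] c b ad(4) X(1) by auto
    let ?B1 = "{y, b, c}" and ?B2 = "{y, b', c}"
    have d: "c \<in> V" "c \<notin> {y, z, b, b'}" "c \<notin> X" using c by auto
    have "8 * real (card (fam s A (insert ?B1 (insert ?D K)) P)) \<le> ?f"
      by (rule rare_triple_weak[OF a, where X = "insert b' X"]) (use b d X K P in \<open>auto simp: card_insert_if\<close>)
    moreover have "8 * real (card (fam s A (insert ?B2 (insert ?D K)) P)) \<le> ?f"
      by (rule rare_triple_weak[OF a, where X = "insert b X"]) (use b d X K P in \<open>auto simp: card_insert_if\<close>)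
    moreover have "?f \<le> real (card {F \<in> fam s A (insert ?D K) P. F \<inter> {?B2, ?B1} = {}})
        + (\<Sum>B\<in>{?B2, ?B1}. real (card (fam s A (insert B (insert ?D K)) P)))"
      using of_nat_mono[OF card_avoid[OF fin_anch[OF a], of "{?B2, ?B1}" s "insert ?D K" P], where 'a = real] by simp
    moreover have "?B1 \<noteq> ?B2" using b d by auto
    moreover have "real (card {F \<in> fam s A (insert ?D K) P. F \<inter> {?B2, ?B1} = {}})
        \<le> real (card {F \<in> fam s A (insert ?D K) P. clean ?D F (insert c ?D)})"
    proof (rule of_nat_mono, rule clean_superset[OF _ fin_anch[OF a]])
      fix B assume B: "B \<in> A" "B \<subseteq> insert c ?D" "\<not> ?D \<subseteq> B"
      have "card B \<le> card (insert c ?D)" by (rule card_mono) (use B in auto)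
      then have "card B \<le> 5" using cD d by auto
      moreover have "z \<notin> B" using B(2) d b ad(4) by auto
      ultimately have "y \<in> B" "3 \<le> card B" using ad(7,8) B(1) by auto
      then show "B \<in> {?B2, ?B1}" using subset4[of B y b b' c] B by blast
    qed
    ultimately show "3/4 * ?f \<le> real (card {F \<in> fam s A (insert ?D K) P. clean ?D F (insert c ?D)})"
      by simp
  qed
  moreover have "47/2 * ?f \<le> (1 + 2 * (3/4) * real (card ?C)) * ?f"
    using cC by (intro mult_right_mono) auto
  ultimately show ?thesis by linarith
qed

text \<open>Sites with two added elements are quadratically many. The price is the sets with one
  added element in between, which form the intermediate class \<open>J\<close>.\<close>

lemma level_two:
  assumes a: "anchored A y z m" and D: "D \<subseteq> V" "y \<in> D" "z \<notin> D" "m \<le> card D" "card D \<le> 3" "D \<notin> K"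
    and P: "\<forall>Q\<in>P. y \<notin> Q" and C: "C \<subseteq> V - D - {z}" "\<And>W. D \<subset> W \<Longrightarrow> W \<subseteq> D \<union> C \<Longrightarrow> W \<notin> K"
    and p: "\<And>c d. c \<in> C \<Longrightarrow> d \<in> C \<Longrightarrow> c \<noteq> d \<Longrightarrow> p * real (card (fam s A (insert D K) P))
              \<le> real (card {F \<in> fam s A (insert D K) P. clean D F (insert c (insert d D))})"
  shows "(1 + 2 * p * real (card C choose 2)) * real (card (fam s A (insert D K) P)) \<le> real (card (fam s A K P))"
proof -
  have fD: "finite D" using D(1) finV by (rule finite_subset)
  have fC: "finite C" using C(1) finV by (meson Diff_subset finite_subset subset_trans)
  let ?E = "{e. e \<subseteq> C \<and> card e = 2}"
  let ?S = "(\<lambda>e. D \<union> e) ` ?E" and ?J = "(\<lambda>c. insert c D) ` C"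
  have DC: "D \<inter> C = {}" using C(1) by blast
  have cS: "card W = card D + 2 \<and> W \<subseteq> D \<union> C \<and> D \<subset> W" if W: "W \<in> ?S" for W
  proof -
    obtain e where e: "e \<subseteq> C" "card e = 2" "W = D \<union> e" using W by blast
    have "card W = card D + card e" unfolding e(3)
      using e(1) DC fD fC by (intro card_Un_disjoint) (auto intro: finite_subset)
    moreover have "D \<subset> W"
    proof
      show "D \<subseteq> W" using e(3) by blast
      have "e \<noteq> {}" using e(2) by auto
      then obtain x where "x \<in> e" by blast
      then have "x \<in> W" "x \<notin> D" using e(1,3) DC by auto
      then show "D \<noteq> W" by blast
    qed
    ultimately show ?thesis using e by auto
  qed
  have cJ: "card W = card D + 1 \<and> W \<subseteq> D \<union> C \<and> D \<subset> W" if W: "W \<in> ?J" for W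
  proof -
    obtain c where c: "c \<in> C" "W = insert c D" using W by blast
    then have "c \<notin> D" using DC by blast
    then show ?thesis using c fD by auto
  qed
  have cSJ: "card W \<le> 5 \<and> W \<subseteq> D \<union> C \<and> D \<subset> W \<and> card D \<le> card W" if "W \<in> ?S \<union> ?J" for W
    using that cS[of W] cJ[of W] D(5) by auto
  interpret ratio_setup V s A K P D ?S ?J
  proof
    show "finite V" by (rule finV)
    show "A \<subseteq> Pow V" by (rule anchoredD(1)[OF a])
    show "D \<in> A" "V - D \<in> A" using anchoredD(5,6)[OF a] D by auto
    show "D \<notin> K" by fact
    show "W \<in> A \<and> V - W \<in> A \<and> W \<notin> K \<and> D \<subset> W" if W: "W \<in> ?S \<union> ?J" for W
    proof -
      note c = cSJ[OF W]
      have "W \<subseteq> V" "z \<notin> W" "y \<in> W" "m \<le> card W" using c C(1) D anchoredD(4)[OF a] by auto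
      then show ?thesis using c C(2)[of W] anchoredD(5,6)[OF a, of W] by blast
    qed
    show "W \<notin> P" if "W \<in> insert D (?S \<union> ?J)" for W using that D(2) P by auto
    show "?S \<inter> ?J = {}"
    proof (rule ccontr)
      assume "?S \<inter> ?J \<noteq> {}"
      then obtain W where "W \<in> ?S" "W \<in> ?J" by blast
      then show False using cS[of W] cJ[of W] by simp
    qed
    have btw: "B = D \<or> B \<in> ?J \<or> card B \<ge> card D + 2" if "D \<subseteq> B" "B \<subseteq> D \<union> C" for B
    proof -
      have fB: "finite B" using that(2) fD fC by (meson finite_Un finite_subset)
      show ?thesis
      proof (cases "card B \<ge> card D + 2")
        case False
        have "card (B - D) = card B - card D" using that(1) fD by (rule card_Diff_subset[rotated])
        then have "card (B - D) \<le> 1" using False by simp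
        then consider "B - D = {}" | c where "B - D = {c}"
          by (metis One_nat_def card_0_eq card_1_singletonE finite_Diff fB le_Suc_eq le_zero_eq)
        then show ?thesis
        proof cases
          case 1 then show ?thesis using that(1) by blast
        next
          case 2 then have "B = insert c D" "c \<in> C" using that by blast+
          then show ?thesis by blast
        qed
      qed simp
    qed
    show "B \<in> insert D (insert W ?J)" if W: "W \<in> ?S" "B \<in> A" "D \<subseteq> B" "B \<subseteq> W" for W B
    proof -
      note c = cS[OF W(1)]
      have fW: "finite W" using c fD fC by (meson finite_Un finite_subset)
      have "B \<subseteq> D \<union> C" using W(4) c by blast
      then consider "B = D" | "B \<in> ?J" | "card B \<ge> card D + 2" using btw W(3) by blast
      then show ?thesis
      proof cases
        case 3 then have "B = W" using card_seteq[OF fW W(4)] c by simp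
        then show ?thesis by simp
      qed simp_all
    qed
    show "B \<in> insert D ?J" if W: "W \<in> ?J" "B \<in> A" "D \<subseteq> B" "B \<subseteq> W" for W B
    proof -
      note c = cJ[OF W(1)]
      have fW: "finite W" using c fD fC by (meson finite_Un finite_subset)
      have "B \<subseteq> D \<union> C" using W(4) c by blast
      moreover have "card B \<le> card W" using card_mono[OF fW W(4)] .
      ultimately show ?thesis using btw[of B] W(3) c by auto
    qed
    show "W \<union> W' \<noteq> V" if "W \<in> insert D (?S \<union> ?J)" "W' \<in> insert D (?S \<union> ?J)" for W W'
    proof (rule union_small)
      show "card W \<le> 5" "card W' \<le> 5" using that cSJ[of W] cSJ[of W'] D(5) by auto
    qed
  qed
  have "card ?S = card ?E" by (rule card_image, rule inj_onI) (use DC in blast)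
  also have "card ?E = card C choose 2" using n_subsets[OF fC] by simp
  finally have cS2: "card ?S = card C choose 2" .
  have "p * real (card (fam s A (insert D K) P)) \<le> real (card {F \<in> fam s A (insert D K) P. clean D F W})"
    if W: "W \<in> ?S" for W
  proof -
    obtain e where e: "e \<subseteq> C" "card e = 2" "W = D \<union> e" using W by blast
    then obtain c d where "e = {c, d}" "c \<noteq> d" by (meson card_2_iff)
    then have "c \<in> C" "d \<in> C" "c \<noteq> d" "W = insert c (insert d D)" using e by auto
    then show ?thesis using p[of c d] by simp
  qed
  then show ?thesis using ratio_bound(2)[of p] cS2 by simp
qed

lemma eq_triple: "B \<subseteq> {p, q, r} \<Longrightarrow> 3 \<le> card B \<Longrightarrow> B = {p, q, r}"
proof -
  assume B: "B \<subseteq> {p, q, r}" "3 \<le> card B"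
  have "card {p, q, r} \<le> 3" by (auto simp: card_insert_if)
  then have "card {p, q, r} \<le> card B" using B(2) by simp
  then show ?thesis using card_seteq[of "{p, q, r}" B] B(1) by simp
qed

lemma subset4':
  assumes B: "B \<subseteq> {y, x, c, d}" "y \<in> B" "3 \<le> card B"
  shows "B \<in> {{y, x, c, d}, {y, x, c}, {y, x, d}, {y, c, d}}"
proof -
  have drop: "B \<subseteq> S" if "u \<notin> B" "{y, x, c, d} = insert u S" for u S
    using that B(1) by (simp add: subset_insert)
  consider "x \<notin> B" | "c \<notin> B" | "d \<notin> B" | "{y, x, c, d} \<subseteq> B" using B(2) by auto
  then show ?thesis
  proof cases
    case 1 then have "B \<subseteq> {y, c, d}" by (rule drop) auto
    from eq_triple[OF this B(3)] show ?thesis by simp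
  next
    case 2 then have "B \<subseteq> {y, x, d}" by (rule drop) auto
    from eq_triple[OF this B(3)] show ?thesis by simp
  next
    case 3 then have "B \<subseteq> {y, x, c}" by (rule drop) auto
    from eq_triple[OF this B(3)] show ?thesis by simp
  next
    case 4 then have "B = {y, x, c, d}" using B(1) by (rule subset_antisym[rotated])
    then show ?thesis by simp
  qed
qed

lemma subset5:
  assumes B: "B \<subseteq> {y, b, b', c, d}" "y \<in> B" "3 \<le> card B" "\<not> {y, b, b'} \<subseteq> B"
  shows "B \<in> {{y, b, c}, {y, b', c}, {y, b, d}, {y, b', d}, {y, c, d}, {y, b, c, d}, {y, b', c, d}}"
proof -
  have drop: "B \<subseteq> S" if "u \<notin> B" "{y, b, b', c, d} = insert u S" for u S
    using that B(1) by (simp add: subset_insert)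
  have "b \<notin> B \<or> b' \<notin> B" using B(2,4) by simp
  then show ?thesis
  proof
    assume "b \<notin> B"
    then have "B \<subseteq> {y, b', c, d}" by (rule drop) auto
    from subset4'[OF this B(2,3)] show ?thesis by (elim insertE emptyE) simp_all
  next
    assume "b' \<notin> B"
    then have "B \<subseteq> {y, b, c, d}" by (rule drop) auto
    from subset4'[OF this B(2,3)] show ?thesis by (elim insertE emptyE) simp_all
  qed
qed

text \<open>Given the triple, the five other triples below a site are absent with probability at least
  \<open>1 - 5 * 2/47\<close>; the two sets of size four can then be complemented one after the other.\<close>

lemma rare_triple_strong:
  assumes a: "anchored A y z 3" and b: "b \<in> V" "b' \<in> V" "b \<noteq> b'" "b \<notin> {y, z}" "b' \<notin> {y, z}"
    and P: "\<forall>Q\<in>P. y \<notin> Q" and K: "\<forall>k\<in>K. z \<in> k"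
  shows "(1 + 37/94 * real ((card V - 4) choose 2)) * real (card (fam s A (insert {y, b, b'} K) P)) \<le> real (card (fam s A K P))"
proof -
  note ad = anchoredD[OF a]
  let ?D = "{y, b, b'}" and ?C = "V - {y, z, b, b'}"
  have cD: "card ?D = 3" using b by (auto simp: card_insert_if)
  let ?f = "real (card (fam s A (insert ?D K) P))"
  have "card {y, z, b, b'} = 4" using b ad(4) by (auto simp: card_insert_if)
  then have cC: "card ?C = card V - 4"
    using b ad(2,3) by (subst card_Diff_subset) auto
  have "(1 + 2 * (37/188) * real (card ?C choose 2)) * ?f \<le> real (card (fam s A K P))"
  proof (rule level_two[OF a])
    show "?D \<subseteq> V" "y \<in> ?D" "z \<notin> ?D" "3 \<le> card ?D" "card ?D \<le> 3" using b ad cD by auto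
    show "?D \<notin> K" using K b ad(4) by auto
    show "\<forall>Q\<in>P. y \<notin> Q" by fact
    show "?C \<subseteq> V - ?D - {z}" by blast
    show "W \<notin> K" if "W \<subseteq> ?D \<union> ?C" for W
    proof
      assume "W \<in> K"
      then have "z \<in> W" using K by blast
      then show False using that b ad(4) by auto
    qed
    fix c d assume cd: "c \<in> ?C" "d \<in> ?C" "c \<noteq> d"
    have e: "c \<in> V" "c \<notin> {y, z, b, b'}" "d \<in> V" "d \<notin> {y, z, b, b'}" using cd by auto
    let ?T = "{{y, b, c}, {y, b', c}, {y, b, d}, {y, b', d}, {y, c, d}}"
    let ?Q1 = "{y, b, c, d}" and ?Q2 = "{y, b', c, d}"
    have triple: "47/2 * real (card (fam s A (insert {y, p, q} (insert ?D K)) P)) \<le> ?f"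
      if "p \<in> {b, b', c, d}" "q \<in> {c, d}" "p \<noteq> q" for p q
    \<comment> \<open>The conditioned triple \<open>{y, b, b'}\<close> lacks \<open>z\<close>; it
      meets \<open>X\<close>, because the new triple contains at most one of \<open>b\<close> and
      \<open>b'\<close>.\<close>
    proof (rule rare_triple[OF a, where X = "{b, b'} - {p, q}"])
      show "\<forall>k\<in>insert ?D K. z \<in> k \<or> k \<inter> ({b, b'} - {p, q}) \<noteq> {}" using K that b e by auto
      show "card ({b, b'} - {p, q}) \<le> 2"
        by (rule order_trans[OF card_mono[of "{b, b'}"]]) (auto simp: card_insert_if)
    qed (use that b e P in auto)
    have sumT: "47/2 * (\<Sum>B\<in>?T. real (card (fam s A (insert B (insert ?D K)) P))) \<le> 5 * ?f"
    proof -
      have "47/2 * (\<Sum>B\<in>?T. real (card (fam s A (insert B (insert ?D K)) P)))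
          = (\<Sum>B\<in>?T. 47/2 * real (card (fam s A (insert B (insert ?D K)) P)))" by (rule sum_distrib_left)
      also have "\<dots> \<le> (\<Sum>B\<in>?T. ?f)"
        by (intro sum_mono) (use triple[of b c] triple[of b' c] triple[of b d] triple[of b' d] triple[of c d] cd e in auto)
      also have "\<dots> = real (card ?T) * ?f" by simp
      also have "\<dots> \<le> 5 * ?f" by (intro mult_right_mono) (auto simp: card_insert_if)
      finally show ?thesis .
    qed
    have "?f \<le> real (card {F \<in> fam s A (insert ?D K) P. F \<inter> ?T = {}})
        + (\<Sum>B\<in>?T. real (card (fam s A (insert B (insert ?D K)) P)))"
      using of_nat_mono[OF card_avoid[OF fin_anch[OF a], of ?T s "insert ?D K" P], where 'a = real] by simp
    moreover have "card {F \<in> fam s A (insert ?D K) P. F \<inter> ?T = {}} \<le> 2 * card {F \<in> fam s A (insert ?D K) P. F \<inter> insert ?Q1 ?T = {}}"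
    proof (rule flip_anchored[OF a])
      show "?Q1 \<notin> insert ?D K" using K b e cd ad(4) by auto
      show "3 \<le> card ?Q1" "card ?Q1 \<le> 5" using b e cd by (auto simp: card_insert_if)
      show "C = ?Q1 \<or> C \<in> ?T" if "C \<subseteq> ?Q1" "y \<in> C" "3 \<le> card C" for C
      proof -
        have "C \<subseteq> {y, b, b', c, d}" "\<not> {y, b, b'} \<subseteq> C" "C \<noteq> ?Q2" using that b e by auto
        from subset5[OF this(1) that(2,3) this(2)] this(3) show ?thesis by (elim insertE emptyE) simp_all
      qed
    qed (use b e ad P in auto)
    moreover have "card {F \<in> fam s A (insert ?D K) P. F \<inter> insert ?Q1 ?T = {}} \<le> 2 * card {F \<in> fam s A (insert ?D K) P. F \<inter> insert ?Q2 (insert ?Q1 ?T) = {}}"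
    proof (rule flip_anchored[OF a])
      show "?Q2 \<notin> insert ?D K" using K b e cd ad(4) by auto
      show "3 \<le> card ?Q2" "card ?Q2 \<le> 5" using b e cd by (auto simp: card_insert_if)
      show "C = ?Q2 \<or> C \<in> insert ?Q1 ?T" if "C \<subseteq> ?Q2" "y \<in> C" "3 \<le> card C" for C
      proof -
        have "C \<subseteq> {y, b, b', c, d}" "\<not> {y, b, b'} \<subseteq> C" using that b e by auto
        from subset5[OF this(1) that(2,3) this(2)] show ?thesis by (elim insertE emptyE) simp_all
      qed
    qed (use b e ad P in auto)
    moreover have "card {F \<in> fam s A (insert ?D K) P. F \<inter> insert ?Q2 (insert ?Q1 ?T) = {}}
        \<le> card {F \<in> fam s A (insert ?D K) P. clean ?D F (insert c (insert d ?D))}"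
    proof (rule clean_superset[OF _ fin_anch[OF a]])
      fix B assume B: "B \<in> A" "B \<subseteq> insert c (insert d ?D)" "\<not> ?D \<subseteq> B"
      have "card B \<le> card (insert c (insert d ?D))" by (rule card_mono) (use B in auto)
      then have "card B \<le> 5" using cD e cd by auto
      moreover have "z \<notin> B" using B(2) e b ad(4) by auto
      ultimately have yB: "y \<in> B" "3 \<le> card B" using ad(7,8) B(1) by auto
      have "B \<subseteq> {y, b, b', c, d}" using B(2) by (simp add: insert_commute)
      from subset5[OF this yB B(3)] show "B \<in> insert ?Q2 (insert ?Q1 ?T)"
        by (elim insertE emptyE) simp_all
    qed
    ultimately show "37/188 * ?f \<le> real (card {F \<in> fam s A (insert ?D K) P. clean ?D F (insert c (insert d ?D))})"
      using sumT by simp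
  qed
  then show ?thesis by (simp add: cC)
qed

lemma subset3:
  assumes C: "C \<subseteq> {y, d, e}" "y \<in> C" "2 \<le> card C"
  shows "C \<in> {{y, d, e}, {y, d}, {y, e}}"
proof -
  have "C \<noteq> {y}" using C(3) by auto
  then show ?thesis using C(1,2) by (cases "d \<in> C"; cases "e \<in> C") blast+
qed

text \<open>Only \<open>{y, c}\<close> obstructs the site \<open>{y, b, c}\<close>, and it can be
  complemented: probability 1/2 for each of at least \<open>card V - 5\<close> sites.\<close>

lemma rare_pair_weak:
  assumes a: "anchored A y z 2" and b: "b \<in> V" "b \<notin> {y, z}"
    and X: "X \<inter> {y, b} = {}" "finite X" "card X \<le> 2"
    and K: "\<forall>k\<in>K. z \<in> k \<or> k \<inter> X \<noteq> {}"
  shows "real (card V - 4) * real (card (fam s A (insert {y, b} K) {})) \<le> real (card (fam s A K {}))"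
proof -
  note ad = anchoredD[OF a]
  let ?D = "{y, b}" and ?C = "V - {y, z, b} - X"
  have Kn: "W \<notin> K" if "z \<notin> W" "W \<inter> X = {}" for W using K that by blast
  have cD: "card ?D = 2" using b by (auto simp: card_insert_if)
  let ?f = "real (card (fam s A (insert ?D K) {}))"
  have cC: "card V - 5 \<le> card ?C"
  proof -
    have "card V - card ({y, z, b} \<union> X) \<le> card (V - ({y, z, b} \<union> X))"
      by (rule diff_card_le_card_Diff) (use X in simp)
    moreover have "card ({y, z, b} \<union> X) \<le> 3 + 2"
      using card_Un_le[of "{y, z, b}" X] X by (auto simp: card_insert_if)
    moreover have "V - ({y, z, b} \<union> X) = ?C" by blast
    ultimately show ?thesis using V21 by simp
  qed
  have "(1 + 2 * (1/2) * real (card ?C)) * ?f \<le> real (card (fam s A K {}))"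
  proof (rule level_one[OF a])
    show "?D \<subseteq> V" "y \<in> ?D" "z \<notin> ?D" "2 \<le> card ?D" "card ?D \<le> 4" using b ad cD by auto
    show "?D \<notin> K" using Kn[of ?D] b ad(4) X(1) by auto
    show "\<forall>Q\<in>{}. y \<notin> Q" by simp
    show "?C \<subseteq> V - ?D - {z}" by blast
    fix c assume c: "c \<in> ?C"
    show "insert c ?D \<notin> K" using Kn[of "insert c ?D"] c b ad(4) X(1) by auto
    let ?B = "{y, c}"
    have d: "c \<in> V" "c \<notin> {y, z, b}" "c \<notin> X" using c by auto
    have c2: "card ?B = 2" using d by (auto simp: card_insert_if)
    have "card {F \<in> fam s A (insert ?D K) {}. F \<inter> {} = {}} \<le> 2 * card {F \<in> fam s A (insert ?D K) {}. F \<inter> {?B} = {}}"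
    proof (rule flip_anchored[OF a])
      show "?B \<notin> insert ?D K" using Kn[of ?B] b d X ad(4) by auto
      show "C = ?B \<or> C \<in> {}" if "C \<subseteq> ?B" "2 \<le> card C" for C
        using that c2 card_seteq[of ?B C] by auto
    qed (use b d ad c2 in auto)
    moreover have "card {F \<in> fam s A (insert ?D K) {}. F \<inter> {?B} = {}}
        \<le> card {F \<in> fam s A (insert ?D K) {}. clean ?D F (insert c ?D)}"
    proof (rule clean_superset[OF _ fin_anch[OF a]])
      fix B assume B: "B \<in> A" "B \<subseteq> insert c ?D" "\<not> ?D \<subseteq> B"
      have "card B \<le> card (insert c ?D)" by (rule card_mono) (use B in auto)
      then have "card B \<le> 5" using cD d by auto
      moreover have "z \<notin> B" using B(2) d b ad(4) by auto
      ultimately have *: "y \<in> B" "2 \<le> card B" using ad(7,8) B(1) by auto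
      then have "B \<subseteq> ?B" using B(2,3) by blast
      then show "B \<in> {?B}" using card_seteq[of ?B B] c2 * by simp
    qed
    ultimately show "1/2 * ?f \<le> real (card {F \<in> fam s A (insert ?D K) {}. clean ?D F (insert c ?D)})"
      by simp
  qed
  moreover have "real (card V - 4) * ?f \<le> (1 + 2 * (1/2) * real (card ?C)) * ?f"
    using cC V21 by (intro mult_right_mono) auto
  ultimately show ?thesis by linarith
qed

text \<open>For a site \<open>{y, c, d, e}\<close> the edges \<open>{y, d}\<close> and
  \<open>{y, e}\<close> are each present with probability at most \<open>1/(n - 4)\<close>; without
  them \<open>{y, d, e}\<close> is minimal and can be complemented. Hence
  \<open>p = (1 - 2/(n - 4))/2\<close>, and \<open>n - 4\<close> choose 2 sites turn
  \<open>2 * p\<close> into \<open>(n - 5) * (n - 6) / 2\<close>. The elements \<open>z\<close> and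
  \<open>b\<close> stay outside the sites to protect the two conditioned edges.\<close>

lemma rare_third_edge:
  assumes a: "anchored A y z 2" and b: "b \<in> V" "b \<notin> {y, z}" and c: "c \<in> V" "c \<notin> {y, z, b}"
  shows "real ((card V - 5) * (card V - 6)) / 2 * real (card (fam s A {{y, c}, {y, z}, {y, b}} {}))
    \<le> real (card (fam s A {{y, z}, {y, b}} {}))"
proof -
  note ad = anchoredD[OF a]
  let ?D = "{y, c}" and ?C = "V - {y, z, b, c}" and ?K = "{{y, z}, {y, b}}"
  have cD: "card ?D = 2" using c by (auto simp: card_insert_if)
  let ?f = "real (card (fam s A (insert ?D ?K) {}))"
  define n where "n = real (card V)"
  have n: "n \<ge> 21" using V21 by (simp add: n_def)
  have "card {y, z, b, c} = 4" using b c ad(4) by (auto simp: card_insert_if)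
  then have cC: "card ?C = card V - 4"
    using b c ad(2,3) by (subst card_Diff_subset) auto
  define p where "p = (1 - 2 / (n - 4)) / 2"
  have "(1 + 2 * p * real (card ?C choose 2)) * ?f \<le> real (card (fam s A ?K {}))"
  proof (rule level_two[OF a])
    show "?D \<subseteq> V" "y \<in> ?D" "z \<notin> ?D" "2 \<le> card ?D" "card ?D \<le> 3" using c ad cD by auto
    show "?D \<notin> ?K" using b c ad(4) by (auto simp: doubleton_eq_iff)
    show "\<forall>Q\<in>{}. y \<notin> Q" by simp
    show "?C \<subseteq> V - ?D - {z}" by blast
    show "W \<notin> ?K" if "?D \<subset> W" "W \<subseteq> ?D \<union> ?C" for W
    proof
      assume "W \<in> ?K"
      then have "z \<in> W \<or> b \<in> W" by auto
      then show False using that b c ad(4) by auto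
    qed
    fix d e assume de: "d \<in> ?C" "e \<in> ?C" "d \<noteq> e"
    have f: "d \<in> V" "d \<notin> {y, z, b, c}" "e \<in> V" "e \<notin> {y, z, b, c}" using de by auto
    let ?T = "{{y, d}, {y, e}}" and ?Q = "{y, d, e}"
    have pair: "(n - 4) * real (card (fam s A (insert {y, q} (insert ?D ?K)) {})) \<le> ?f" if "q \<in> {d, e}" for q
    proof -
      have "real (card V - 4) * real (card (fam s A (insert {y, q} (insert ?D ?K)) {})) \<le> ?f"
        by (rule rare_pair_weak[OF a, where X = "{b, c}"]) (use that b c f in \<open>auto simp: card_insert_if\<close>)
      then show ?thesis using V21 by (simp add: n_def)
    qed
    have "?f \<le> real (card {F \<in> fam s A (insert ?D ?K) {}. F \<inter> ?T = {}})
        + (\<Sum>B\<in>?T. real (card (fam s A (insert B (insert ?D ?K)) {})))"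
      using of_nat_mono[OF card_avoid[OF fin_anch[OF a], of ?T s "insert ?D ?K" "{}"], where 'a = real] by simp
    moreover have "(\<Sum>B\<in>?T. real (card (fam s A (insert B (insert ?D ?K)) {}))) \<le> 2 / (n - 4) * ?f"
    proof -
      have q: "real (card (fam s A (insert {y, q} (insert ?D ?K)) {})) \<le> ?f / (n - 4)" if "q \<in> {d, e}" for q
        using pair[OF that] n by (simp add: pos_le_divide_eq mult.commute)
      have "{y, d} \<noteq> {y, e}" using de by (auto simp: doubleton_eq_iff)
      then show ?thesis using q[of d] q[of e] by simp
    qed
    moreover have "real (card {F \<in> fam s A (insert ?D ?K) {}. F \<inter> ?T = {}}) \<le> real (2 * card {F \<in> fam s A (insert ?D ?K) {}. F \<inter> insert ?Q ?T = {}})"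
    proof (rule of_nat_mono, rule flip_anchored[OF a])
      show "?Q \<notin> insert ?D ?K" using b c f de ad(4) by (auto simp: doubleton_eq_iff)
      show "2 \<le> card ?Q" "card ?Q \<le> 5" using b f de by (auto simp: card_insert_if)
      show "C = ?Q \<or> C \<in> ?T" if "C \<subseteq> ?Q" "y \<in> C" "2 \<le> card C" for C
        using subset3[OF that] by (elim insertE emptyE) simp_all
    qed (use b f ad in auto)
    moreover have "real (card {F \<in> fam s A (insert ?D ?K) {}. F \<inter> insert ?Q ?T = {}})
        \<le> real (card {F \<in> fam s A (insert ?D ?K) {}. clean ?D F (insert d (insert e ?D))})"
    proof (rule of_nat_mono, rule clean_superset[OF _ fin_anch[OF a]])
      fix B assume B: "B \<in> A" "B \<subseteq> insert d (insert e ?D)" "\<not> ?D \<subseteq> B"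
      have "card B \<le> card (insert d (insert e ?D))" by (rule card_mono) (use B in auto)
      then have "card B \<le> 5" using cD f de by auto
      moreover have "z \<notin> B" using B(2) f c ad(4) by auto
      ultimately have *: "y \<in> B" "2 \<le> card B" using ad(7,8) B(1) by auto
      have "c \<notin> B" using B(3) *(1) by simp
      moreover have "B \<subseteq> insert c {y, d, e}" using B(2) by (simp add: insert_commute)
      ultimately have "B \<subseteq> {y, d, e}" by (simp add: subset_insert)
      from subset3[OF this *] show "B \<in> insert ?Q ?T" by (elim insertE emptyE) simp_all
    qed
    ultimately have "?f \<le> 2 / (n - 4) * ?f + 2 * real (card {F \<in> fam s A (insert ?D ?K) {}. clean ?D F (insert d (insert e ?D))})"
      by simp
    then show "p * ?f \<le> real (card {F \<in> fam s A (insert ?D ?K) {}. clean ?D F (insert d (insert e ?D))})"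
      by (simp add: p_def algebra_simps)
  qed
  moreover have "real ((card V - 5) * (card V - 6)) / 2 \<le> 1 + 2 * p * real (card ?C choose 2)"
  proof -
    have "even ((card V - 4) * (card V - 4 - 1))" by (cases "card V - 4") auto
    then have "real (card ?C choose 2) = (n - 4) * (n - 5) / 2"
      unfolding cC choose_two using V21 by (simp add: n_def real_of_nat_div)
    then have "2 * p * real (card ?C choose 2) = (2 * p * (n - 4)) * (n - 5) / 2" by simp
    also have "2 * p * (n - 4) = n - 6" using n by (simp add: p_def field_simps)
    finally have "2 * p * real (card ?C choose 2) = (n - 6) * (n - 5) / 2" .
    moreover have "real ((card V - 5) * (card V - 6)) = (n - 5) * (n - 6)" using V21 by (simp add: n_def)
    ultimately show ?thesis by (simp add: mult.commute)
  qed
  then have "real ((card V - 5) * (card V - 6)) / 2 * ?f \<le> (1 + 2 * p * real (card ?C choose 2)) * ?f"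
    by (intro mult_right_mono) auto
  ultimately show ?thesis by linarith
qed

end

section \<open>Compressions\<close>

lemma num_intersecting_fam: "finite A \<Longrightarrow> num_intersecting s A = card (fam s A {} {})"
  unfolding num_intersecting_def fam_def nsets_def
  by (rule arg_cong[where f = card]) (auto intro: finite_subset)

section \<open>Adding an element\<close>

definition raise :: "'a \<Rightarrow> 'a set set \<Rightarrow> 'a set \<Rightarrow> 'a set" where
  "raise u A B = (if u \<notin> B \<and> insert u B \<notin> A then insert u B else B)"

lemma inj_raise: "inj_on (raise u A) A"
proof (rule inj_onI)
  fix B C assume "B \<in> A" "C \<in> A" "raise u A B = raise u A C"
  then show "B = C" by (auto simp: raise_def insert_ident split: if_splits)
qed

lemma raise_superset: "B \<subseteq> raise u A B" by (auto simp: raise_def)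

lemma raise_fam:
  assumes "F \<in> fam s A {} {}"
  shows "raise u A ` F \<in> fam s (raise u A ` A) {} {}"
proof -
  have F: "F \<subseteq> A" "card F = s" "intersecting F" using assms by (auto simp: fam_def)
  have "card (raise u A ` F) = s" using card_image[OF inj_on_subset[OF inj_raise F(1)]] F(2) by simp
  moreover have "intersecting (raise u A ` F)"
    unfolding intersecting_def
  proof (intro ballI)
    fix X Y assume "X \<in> raise u A ` F" "Y \<in> raise u A ` F"
    then obtain B C where BC: "B \<in> F" "C \<in> F" "X = raise u A B" "Y = raise u A C" by blast
    have "B \<inter> C \<noteq> {}" using intersectingD[OF F(3) BC(1,2)] .
    then show "X \<inter> Y \<noteq> {}" using raise_superset[of B u A] raise_superset[of C u A] BC(3,4) by blast
  qed
  ultimately show ?thesis using F(1) by (auto simp: fam_def)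
qed

lemma raise_inj_image: "inj_on ((`) (raise u A)) (fam s A {} {})"
proof (rule inj_onI)
  fix F G assume "F \<in> fam s A {} {}" "G \<in> fam s A {} {}" and eq: "raise u A ` F = raise u A ` G"
  then have "F \<subseteq> A" "G \<subseteq> A" by (auto simp: fam_def)
  then show "F = G" using inj_on_image_eq_iff[OF inj_raise[of u A], of F G] eq by simp
qed

lemma raise_mono:
  assumes "finite A"
  shows "num_intersecting s A \<le> num_intersecting s (raise u A ` A)"
proof -
  have "card (fam s A {} {}) \<le> card (fam s (raise u A ` A) {} {})"
    by (rule card_inj_on_le[OF raise_inj_image[of u A s]])
      (use finite_fam[OF finite_imageI[OF assms]] in \<open>auto intro: raise_fam\<close>)
  then show ?thesis using assms by (simp add: num_intersecting_fam)
qed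

text \<open>In a preimage of \<open>G\<close>, only \<open>B\<close> can give rise to
  \<open>insert u B\<close>, and the set giving rise to \<open>R\<close> is a subset of
  \<open>R\<close>, hence disjoint from \<open>B\<close>.\<close>

lemma raise_strict:
  assumes fin: "finite A" and B: "B \<in> A" "u \<notin> B" "insert u B \<notin> A"
    and G: "G \<in> fam s (raise u A ` A) {} {}" "insert u B \<in> G" "R \<in> G" "R \<inter> B = {}"
  shows "num_intersecting s A < num_intersecting s (raise u A ` A)"
proof -
  let ?f = "(`) (raise u A)"
  have "G \<notin> ?f ` fam s A {} {}"
  proof
    assume "G \<in> ?f ` fam s A {} {}"
    then obtain F where F: "F \<in> fam s A {} {}" "G = raise u A ` F" by blast
    have FA: "F \<subseteq> A" "intersecting F" using F(1) by (auto simp: fam_def)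
    obtain B1 where B1: "B1 \<in> F" "insert u B = raise u A B1" using F(2) G(2) by blast
    have "raise u A B = insert u B" using B by (simp add: raise_def)
    then have "B1 = B" using inj_onD[OF inj_raise, of u A B1 B] B1 B(1) FA by auto
    moreover obtain R1 where R1: "R1 \<in> F" "R = raise u A R1" using F(2) G(3) by blast
    ultimately have "R1 \<inter> B \<noteq> {}" using intersectingD[OF FA(2)] B1(1) by blast
    then show False using raise_superset[of R1 u A] R1(2) G(4) by blast
  qed
  moreover have "?f ` fam s A {} {} \<subseteq> fam s (raise u A ` A) {} {}"
    by (rule image_subsetI) (rule raise_fam)
  ultimately have "?f ` fam s A {} {} \<subset> fam s (raise u A ` A) {} {}" using G(1) by (metis psubsetI)
  then have "card (?f ` fam s A {} {}) < card (fam s (raise u A ` A) {} {})"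
    by (rule psubset_card_mono[OF finite_fam[OF finite_imageI[OF fin]]])
  then show ?thesis using card_image[OF raise_inj_image, of u A s] fin by (simp add: num_intersecting_fam)
qed

text \<open>Replacing a member \<open>B\<close> with \<open>v \<in> B\<close> and \<open>B \<inter> U = {}\<close> by \<open>B - {v} \<union> U\<close> may destroy
  intersections that consist of \<open>v\<close> alone. They are repaired by replacing at the same time all
  members of this kind that are linked to \<open>B\<close> by a chain of such intersections.\<close>

locale compression =
  fixes v :: 'a and U :: "'a set" and A :: "'a set set"
  assumes vU: "v \<notin> U" and Une: "U \<noteq> {}" and finA: "finite A"
begin

definition low :: "'a set \<Rightarrow> bool" where "low B \<longleftrightarrow> v \<in> B \<and> B \<inter> U = {}"
definition swap :: "'a set \<Rightarrow> 'a set" where "swap B = (B - {v}) \<union> U"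
definition unswap :: "'a set \<Rightarrow> 'a set" where "unswap B = insert v (B - U)"
definition moved :: "'a set set" where "moved = {B \<in> A. low B \<and> swap B \<notin> A}"
definition compress :: "'a set set" where "compress = (A - moved) \<union> swap ` moved"

definition link :: "'a set set \<Rightarrow> ('a set \<times> 'a set) set" where
  "link F = {(B, C). B \<in> F \<and> C \<in> F \<and> low B \<and> low C \<and> B \<inter> C \<subseteq> {v}}"
definition cluster :: "'a set set \<Rightarrow> 'a set set" where
  "cluster F = (link F)\<^sup>* `` (F \<inter> moved)"
definition flip :: "'a set set \<Rightarrow> 'a set set" where
  "flip F = (F - cluster F) \<union> swap ` cluster F"

text \<open>Mirror images of \<open>link\<close> and \<open>cluster\<close> that refer to the
  flipped family alone, so that the swapped members can be recognised in it.\<close>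

definition link' :: "'a set set \<Rightarrow> ('a set \<times> 'a set) set" where
  "link' G = {(B, C). B \<in> G \<and> C \<in> G \<and> v \<notin> B \<and> v \<notin> C \<and> U \<subseteq> B \<and> U \<subseteq> C \<and> B \<inter> C \<subseteq> U}"
definition cluster' :: "'a set set \<Rightarrow> 'a set set" where
  "cluster' G = (link' G)\<^sup>* `` (G \<inter> swap ` moved)"

lemma unswap_swap: "low B \<Longrightarrow> unswap (swap B) = B"
  using vU by (auto simp: low_def swap_def unswap_def)

lemma inj_swap: "inj_on swap {B. low B}"
  by (rule inj_on_inverseI[where g = unswap]) (simp add: unswap_swap)

lemma link_swap: "low B \<Longrightarrow> low C \<Longrightarrow> B \<inter> C \<subseteq> {v} \<longleftrightarrow> swap B \<inter> swap C \<subseteq> U"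
  using vU by (auto simp: low_def swap_def)

lemma cluster_sub: "cluster F \<subseteq> F" "B \<in> cluster F \<Longrightarrow> low B"
proof -
  have "B \<in> F \<and> low B" if B: "B \<in> cluster F" for B
  proof -
    obtain C where C: "C \<in> F" "C \<in> moved" "(C, B) \<in> (link F)\<^sup>*" using B by (auto simp: cluster_def)
    from C(3) show ?thesis by (cases) (use C(1,2) in \<open>auto simp: moved_def link_def\<close>)
  qed
  then show "cluster F \<subseteq> F" "B \<in> cluster F \<Longrightarrow> low B" by auto
qed

lemma moved_cluster: "F \<inter> moved \<subseteq> cluster F" by (auto simp: cluster_def)

lemma cluster_step: "B \<in> cluster F \<Longrightarrow> (B, C) \<in> link F \<Longrightarrow> C \<in> cluster F"
  by (auto simp: cluster_def intro: rtrancl_into_rtrancl)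

text \<open>A cluster member is either moved, so its swap is not even in \<open>A\<close>, or it
  shares at most \<open>v\<close> with a linked low member, which is then disjoint from its
  swap.\<close>

lemma swap_notin:
  assumes F: "F \<subseteq> A" "intersecting F" and B: "B \<in> cluster F"
  shows "swap B \<notin> F"
proof
  assume s: "swap B \<in> F"
  obtain C where C: "C \<in> F" "C \<in> moved" "(C, B) \<in> (link F)\<^sup>*" using B by (auto simp: cluster_def)
  from C(3) show False
  proof (cases)
    case base
    then show False using C(2) s F(1) by (auto simp: moved_def)
  next
    case (step D)
    then have D: "D \<in> F" "low D" "D \<inter> B \<subseteq> {v}" by (auto simp: link_def)
    then have "D \<inter> swap B = {}" by (auto simp: low_def swap_def)
    then show False using intersectingD[OF F(2) D(1) s] by blast
  qed
qed

text \<open>A low member outside the cluster is not linked to any \<open>B\<close> inside it, so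
  both share an element other than \<open>v\<close>. A member that is not low misses
  \<open>v\<close> or meets \<open>U\<close>, and its intersection with \<open>B\<close> survives
  the swap. Swapped members share \<open>U\<close>.\<close>

lemma flip_fam:
  assumes F: "F \<in> fam s A {} {}"
  shows "flip F \<in> fam s compress {} {}"
proof -
  have FA: "F \<subseteq> A" "card F = s" "intersecting F" using F by (auto simp: fam_def)
  have finF: "finite F" using FA(1) finA by (rule finite_subset)
  have fc: "finite (cluster F)" using cluster_sub(1) finF by (rule finite_subset)
  have "flip F \<subseteq> compress"
  proof
    fix X assume "X \<in> flip F"
    then consider "X \<in> F - cluster F" | B where "B \<in> cluster F" "X = swap B" by (auto simp: flip_def)
    then show "X \<in> compress"
    proof cases
      case 1 then show ?thesis using moved_cluster FA(1) by (auto simp: compress_def)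
    next
      case 2
      have "v \<notin> X" using vU 2(2) by (auto simp: swap_def)
      then have "X \<notin> moved" by (auto simp: moved_def low_def)
      \<comment> \<open>A low set of \<open>A\<close> that is not moved has its swap in
        \<open>A\<close> already.\<close>
      then show ?thesis using cluster_sub(2)[OF 2(1)] 2 FA(1) cluster_sub(1)[of F] by (auto simp: compress_def moved_def)
    qed
  qed
  moreover have "card (flip F) = s"
  proof -
    have "card (flip F) = card (F - cluster F) + card (swap ` cluster F)"
      unfolding flip_def using finF fc swap_notin[OF FA(1,3)] by (intro card_Un_disjoint) auto
    also have "card (swap ` cluster F) = card (cluster F)"
      by (rule card_image) (rule inj_on_subset[OF inj_swap], use cluster_sub(2) in auto)
    also have "card (F - cluster F) = card F - card (cluster F)"
      using fc cluster_sub(1) by (rule card_Diff_subset)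
    finally show ?thesis using card_mono[OF finF cluster_sub(1)] FA(2) by simp
  qed
  moreover have "intersecting (flip F)"
  proof -
    have 1: "swap B \<inter> R \<noteq> {}" if B: "B \<in> cluster F" and R: "R \<in> F - cluster F" for B R
    proof -
      have BF: "B \<in> F" "low B" using B cluster_sub by auto
      show ?thesis
      proof (cases "low R")
        case True
        then have "\<not> B \<inter> R \<subseteq> {v}" using cluster_step[OF B, of R] R BF by (auto simp: link_def)
        then show ?thesis by (auto simp: swap_def)
      next
        case False
        have "B \<inter> R \<noteq> {}" using intersectingD[OF FA(3) BF(1)] R by blast
        then show ?thesis using False by (auto simp: swap_def low_def)
      qed
    qed
    have 2: "swap B \<inter> swap C \<noteq> {}" for B C using Une by (auto simp: swap_def)
    show ?thesis unfolding intersecting_def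
    proof (intro ballI)
      fix X Y assume XY: "X \<in> flip F" "Y \<in> flip F"
      consider "X \<in> F - cluster F" "Y \<in> F - cluster F" | B where "B \<in> cluster F" "X = swap B" "Y \<in> F - cluster F"
        | B where "B \<in> cluster F" "Y = swap B" "X \<in> F - cluster F" | B C where "X = swap B" "Y = swap C"
        using XY unfolding flip_def by blast
      then show "X \<inter> Y \<noteq> {}"
      proof cases
        case 1 then show ?thesis using intersectingD[OF FA(3)] by blast
      qed (use 1 2 in \<open>auto simp: Int_commute\<close>)
    qed
  qed
  ultimately show ?thesis by (simp add: fam_def)
qed

text \<open>Links in the flipped family never lead back to an unswapped member: if \<open>Y\<close>
  contains \<open>U\<close>, misses \<open>v\<close> and meets \<open>swap B\<close> only in
  \<open>U\<close>, then \<open>Y\<close> is disjoint from \<open>B\<close>, so it cannot have been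
  a member beside \<open>B\<close>.\<close>

lemma cluster'_flip:
  assumes F: "F \<in> fam s A {} {}"
  shows "cluster' (flip F) = swap ` cluster F"
proof
  have FA: "F \<subseteq> A" "intersecting F" using F by (auto simp: fam_def)
  let ?G = "flip F"
  show "swap ` cluster F \<subseteq> cluster' ?G"
  proof clarify
    fix B assume "B \<in> cluster F"
    then obtain C where C: "C \<in> F" "C \<in> moved" "(C, B) \<in> (link F)\<^sup>*" by (auto simp: cluster_def)
    from C(3) show "swap B \<in> cluster' ?G"
    proof (induction rule: rtrancl_induct)
      case base
      then show ?case using C(1,2) moved_cluster[of F] by (auto simp: cluster'_def flip_def)
    next
      case (step B D)
      have "(C, D) \<in> (link F)\<^sup>*" using step.hyps by (rule rtrancl_into_rtrancl)
      then have cl: "B \<in> cluster F" "D \<in> cluster F" using C(1,2) step.hyps(1) by (auto simp: cluster_def)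
      then have "swap B \<in> ?G" "swap D \<in> ?G" by (auto simp: flip_def)
      moreover have "swap B \<inter> swap D \<subseteq> U" using step.hyps(2) link_swap by (auto simp: link_def)
      ultimately have "(swap B, swap D) \<in> link' ?G" using vU by (auto simp: link'_def swap_def)
      then show ?case using step.IH by (auto simp: cluster'_def intro: rtrancl_into_rtrancl)
    qed
  qed
  show "cluster' ?G \<subseteq> swap ` cluster F"
  proof
    fix X assume "X \<in> cluster' ?G"
    then obtain C where C: "C \<in> moved" "swap C \<in> ?G" "(swap C, X) \<in> (link' ?G)\<^sup>*" by (auto simp: cluster'_def)
    from C(3) show "X \<in> swap ` cluster F"
    proof (induction rule: rtrancl_induct)
      case base
      have "swap C \<notin> F" using C(1) FA(1) by (auto simp: moved_def)
      then show ?case using C(2) by (auto simp: flip_def)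
    next
      case (step X Y)
      then obtain B where B: "B \<in> cluster F" "X = swap B" by blast
      have Y: "Y \<in> ?G" "v \<notin> Y" "U \<subseteq> Y" "X \<inter> Y \<subseteq> U" using step.hyps(2) by (auto simp: link'_def)
      have BF: "B \<in> F" "low B" using B(1) cluster_sub by auto
      have "Y \<inter> B = {}" using Y B(2) BF(2) by (auto simp: swap_def low_def)
      then have "Y \<notin> F" using intersectingD[OF FA(2) _ BF(1)] by blast
      then show ?case using Y(1) by (auto simp: flip_def)
    qed
  qed
qed

lemma flip_decode:
  assumes F: "F \<in> fam s A {} {}"
  shows "F = (flip F - cluster' (flip F)) \<union> unswap ` cluster' (flip F)"
proof -
  have FA: "F \<subseteq> A" "intersecting F" using F by (auto simp: fam_def)
  have "unswap ` swap ` cluster F = cluster F"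
  proof -
    have "unswap ` swap ` cluster F = (\<lambda>B. B) ` cluster F"
      unfolding image_image by (rule image_cong) (auto simp: unswap_swap cluster_sub(2))
    then show ?thesis by simp
  qed
  moreover have "flip F - swap ` cluster F = F - cluster F"
    using swap_notin[OF FA] by (auto simp: flip_def)
  ultimately show ?thesis using cluster'_flip[OF F] cluster_sub(1)[of F] by auto
qed

lemma inj_flip: "inj_on flip (fam s A {} {})"
proof (rule inj_onI)
  fix F G assume "F \<in> fam s A {} {}" "G \<in> fam s A {} {}" "flip F = flip G"
  then show "F = G" using flip_decode[of F s] flip_decode[of G s] by simp
qed

lemma finite_compress: "finite compress" using finA by (simp add: compress_def moved_def)

lemma compress_mono: "num_intersecting s A \<le> num_intersecting s compress"
proof -
  have "card (fam s A {} {}) \<le> card (fam s compress {} {})"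
    by (rule card_inj_on_le[OF inj_flip[of s]])
      (use finite_fam[OF finite_compress] in \<open>auto intro: flip_fam\<close>)
  then show ?thesis using finA finite_compress by (simp add: num_intersecting_fam)
qed

text \<open>As \<open>U\<close> is not contained in \<open>R\<close>, this member is not a swapped
  one and was already present; so was \<open>B\<close>, the only low set with this swap.\<close>

lemma compress_strict:
  assumes B: "B \<in> moved" and G: "G \<in> fam s compress {} {}" "swap B \<in> G" "R \<in> G" "R \<inter> B = {}" "\<not> U \<subseteq> R"
  shows "num_intersecting s A < num_intersecting s compress"
proof -
  have "G \<notin> flip ` fam s A {} {}"
  proof
    assume "G \<in> flip ` fam s A {} {}"
    then obtain F where F: "F \<in> fam s A {} {}" "G = flip F" by blast
    have FA: "F \<subseteq> A" "intersecting F" using F(1) by (auto simp: fam_def)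
    have "swap B \<notin> F" using B FA(1) by (auto simp: moved_def)
    then obtain C where C: "C \<in> cluster F" "swap C = swap B" using G(2) F(2) by (auto simp: flip_def)
    have "low B" "low C" using B cluster_sub(2)[OF C(1)] by (auto simp: moved_def)
    then have "C = B" using C(2) unswap_swap by metis
    then have "B \<in> F" using C(1) cluster_sub(1) by blast
    moreover have "R \<in> F" using G(3,5) F(2) by (auto simp: flip_def swap_def)
    ultimately show False using intersectingD[OF FA(2)] G(4) by blast
  qed
  moreover have "flip ` fam s A {} {} \<subseteq> fam s compress {} {}"
    by (rule image_subsetI) (rule flip_fam)
  ultimately have "flip ` fam s A {} {} \<subset> fam s compress {} {}" using G(1) by (metis psubsetI)
  then have "card (flip ` fam s A {} {}) < card (fam s compress {} {})"
    by (rule psubset_card_mono[OF finite_fam[OF finite_compress]])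
  then show ?thesis using card_image[OF inj_flip, of s] finA finite_compress by (simp add: num_intersecting_fam)
qed

lemma swap_moved: "swap ` moved \<inter> A = {}" "inj_on swap moved" "moved \<subseteq> A"
  by (auto simp: moved_def intro: inj_on_subset[OF inj_swap])

lemma card_compress: "card compress = card A"
proof -
  have fm: "finite moved" using finA by (simp add: moved_def)
  have "card compress = card (A - moved) + card (swap ` moved)"
    unfolding compress_def using finA fm swap_moved(1) by (intro card_Un_disjoint) auto
  then show ?thesis using card_image[OF swap_moved(2)] card_Diff_subset[OF fm swap_moved(3)]
      card_mono[OF finA swap_moved(3)] by simp
qed

text \<open>At least two elements come in for one that leaves, so total size is a termination
  measure. Replacement by a single element would leave it unchanged.\<close>

lemma sum_compress:
  assumes "2 \<le> card U" "moved \<noteq> {}" "\<forall>B\<in>A. finite B"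
  shows "(\<Sum>B\<in>A. card B) < (\<Sum>B\<in>compress. card B)"
proof -
  have fm: "finite moved" using finA by (simp add: moved_def)
  have fU: "finite U" using assms(1) by (metis card.infinite not_numeral_le_zero)
  have "card B < card (swap B)" if B: "B \<in> moved" for B
  proof -
    have lB: "low B" "finite B" using B assms(3) by (auto simp: moved_def)
    have "card (swap B) = card (B - {v}) + card U"
      unfolding swap_def using lB fU by (intro card_Un_disjoint) (auto simp: low_def)
    moreover have "card B = Suc (card (B - {v}))" using card_Suc_Diff1[of B v] lB by (simp add: low_def)
    ultimately show ?thesis using assms(1) by simp
  qed
  then have "(\<Sum>B\<in>moved. card B) < (\<Sum>B\<in>moved. card (swap B))"
    using fm assms(2) by (intro sum_strict_mono) auto
  moreover have "(\<Sum>B\<in>A. card B) = (\<Sum>B\<in>A - moved. card B) + (\<Sum>B\<in>moved. card B)"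
    using finA swap_moved(3) by (simp add: sum.subset_diff)
  moreover have "(\<Sum>B\<in>compress. card B) = (\<Sum>B\<in>A - moved. card B) + (\<Sum>B\<in>swap ` moved. card B)"
    unfolding compress_def using finA fm swap_moved(1) by (intro sum.union_disjoint) auto
  moreover have "(\<Sum>B\<in>swap ` moved. card B) = (\<Sum>B\<in>moved. card (swap B))"
    using sum.reindex[OF swap_moved(2), of card] by simp
  ultimately show ?thesis by simp
qed

end

section \<open>Termination at stable families\<close>

text \<open>Trivial compressions are excluded, so every step strictly increases the total size of
  the members.\<close>

definition cstep :: "'a set \<Rightarrow> 'a set set \<Rightarrow> 'a set set \<Rightarrow> bool" where
  "cstep V A A' \<longleftrightarrow> (\<exists>u\<in>V. A' = raise u A ` A \<and> A' \<noteq> A) \<or>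
     (\<exists>v\<in>V. \<exists>U\<subseteq>V. v \<notin> U \<and> 2 \<le> card U \<and> A' = compression.compress v U A \<and> compression.moved v U A \<noteq> {})"

definition stable :: "'a set \<Rightarrow> 'a set set \<Rightarrow> bool" where
  "stable V A \<longleftrightarrow> (\<forall>A'. \<not> cstep V A A')"

lemma compressionI: "v \<notin> U \<Longrightarrow> 2 \<le> card U \<Longrightarrow> finite A \<Longrightarrow> compression v U A"
  by unfold_locales auto

lemma raise_props:
  assumes V: "finite V" "A \<subseteq> Pow V" "u \<in> V" and ne: "raise u A ` A \<noteq> A"
  shows "raise u A ` A \<subseteq> Pow V" "card (raise u A ` A) = card A"
    "(\<Sum>B\<in>A. card B) < (\<Sum>B\<in>raise u A ` A. card B)"
    "\<exists>B\<in>A. u \<notin> B \<and> insert u B \<notin> A \<and> insert u B \<in> raise u A ` A \<and> B \<notin> raise u A ` A"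
proof -
  have fA: "finite A" using V(1,2) by (meson finite_Pow_iff finite_subset)
  have fB: "finite B" if "B \<in> A" for B using that V by (meson PowD finite_subset subsetD)
  show "raise u A ` A \<subseteq> Pow V" using V by (auto simp: raise_def)
  show "card (raise u A ` A) = card A" by (rule card_image[OF inj_raise])
  have ex: "\<exists>B\<in>A. u \<notin> B \<and> insert u B \<notin> A"
  proof (rule ccontr)
    assume "\<not> ?thesis"
    then have "raise u A ` A = (\<lambda>B. B) ` A" by (intro image_cong) (auto simp: raise_def)
    then show False using ne by simp
  qed
  then obtain B where B: "B \<in> A" "u \<notin> B" "insert u B \<notin> A" by blast
  have rB: "raise u A B = insert u B" using B by (simp add: raise_def)
  have "B \<notin> raise u A ` A"
  proof
    assume "B \<in> raise u A ` A"
    then obtain C where C: "C \<in> A" "B = raise u A C" by blast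
    then show False using B rB by (auto simp: raise_def split: if_splits)
  qed
  then show "\<exists>B\<in>A. u \<notin> B \<and> insert u B \<notin> A \<and> insert u B \<in> raise u A ` A \<and> B \<notin> raise u A ` A"
    using B rB by (metis image_eqI)
  have "(\<Sum>B\<in>A. card B) < (\<Sum>B\<in>A. card (raise u A B))"
  proof (rule sum_strict_mono_ex1[OF fA])
    show "\<forall>B\<in>A. card B \<le> card (raise u A B)"
      using fB by (auto simp: raise_def intro: card_insert_le)
    show "\<exists>B\<in>A. card B < card (raise u A B)"
      by (rule bexI[OF _ B(1)]) (use rB B fB in simp)
  qed
  then show "(\<Sum>B\<in>A. card B) < (\<Sum>B\<in>raise u A ` A. card B)"
    using sum.reindex[OF inj_raise, of card u A] by simp
qed

lemma cstep_props:
  assumes V: "finite V" "A \<subseteq> Pow V" and st: "cstep V A A'"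
  shows "A' \<subseteq> Pow V" "card A' = card A" "(\<Sum>B\<in>A. card B) < (\<Sum>B\<in>A'. card B)"
    "num_intersecting s A \<le> num_intersecting s A'"
proof -
  have fA: "finite A" using V(1,2) by (meson finite_Pow_iff finite_subset)
  have fB: "\<forall>B\<in>A. finite B" using V by (meson PowD finite_subset subsetD)
  have "A' \<subseteq> Pow V \<and> card A' = card A \<and> (\<Sum>B\<in>A. card B) < (\<Sum>B\<in>A'. card B) \<and>
    num_intersecting s A \<le> num_intersecting s A'"
    using st unfolding cstep_def
  proof
    assume "\<exists>u\<in>V. A' = raise u A ` A \<and> A' \<noteq> A"
    then show ?thesis using raise_props[OF V] raise_mono[OF fA, of s] by metis
  next
    assume "\<exists>v\<in>V. \<exists>U\<subseteq>V. v \<notin> U \<and> 2 \<le> card U \<and> A' = compression.compress v U A \<and> compression.moved v U A \<noteq> {}"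
    then obtain v U where vu: "v \<in> V" "U \<subseteq> V" "v \<notin> U" "2 \<le> card U" "A' = compression.compress v U A"
        "compression.moved v U A \<noteq> {}" by blast
    interpret compression v U A using compressionI[OF vu(3,4) fA] .
    have "compress \<subseteq> Pow V" using V(2) vu(2) by (auto simp: compress_def moved_def swap_def)
    then show ?thesis using vu(5) card_compress sum_compress[OF vu(4,6) fB] compress_mono[of s] by simp
  qed
  then show "A' \<subseteq> Pow V" "card A' = card A" "(\<Sum>B\<in>A. card B) < (\<Sum>B\<in>A'. card B)"
    "num_intersecting s A \<le> num_intersecting s A'" by auto
qed

text \<open>Induction on the room left for the total size. Uniqueness passes backwards through
  \<open>last\<close>: an unstable family attaining \<open>N\<close> would step into a family that
  attains \<open>N\<close> too and hence is good, but such a step is strict.\<close>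

lemma reduce_to_stable:
  assumes V: "finite V" and A: "A \<subseteq> Pow V" "card A = m"
    and st: "\<And>A. A \<subseteq> Pow V \<Longrightarrow> card A = m \<Longrightarrow> stable V A \<Longrightarrow>
      num_intersecting s A \<le> N \<and> (num_intersecting s A = N \<longrightarrow> good A)"
    and last: "\<And>A A'. A \<subseteq> Pow V \<Longrightarrow> cstep V A A' \<Longrightarrow> good A' \<Longrightarrow> num_intersecting s A < num_intersecting s A'"
  shows "num_intersecting s A \<le> N \<and> (num_intersecting s A = N \<longrightarrow> good A)"
  using A
proof (induction "m * card V - (\<Sum>B\<in>A. card B)" arbitrary: A rule: less_induct)
  case less
  show ?case
  proof (cases "stable V A")
    case True
    then show ?thesis using st less.prems by blast
  next
    case False
    then obtain A' where A': "cstep V A A'" by (auto simp: stable_def)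
    note p = cstep_props[OF V less.prems(1) A']
    have "(\<Sum>B\<in>A'. card B) \<le> (\<Sum>B\<in>A'. card V)"
      using p(1) V by (intro sum_mono card_mono) auto
    also have "\<dots> = m * card V" using p(2) less.prems(2) by simp
    finally have "m * card V - (\<Sum>B\<in>A'. card B) < m * card V - (\<Sum>B\<in>A. card B)" using p(3) by simp
    then have IH: "num_intersecting s A' \<le> N \<and> (num_intersecting s A' = N \<longrightarrow> good A')"
      by (rule less.hyps) (use p(1,2) less.prems(2) in auto)
    show ?thesis
    proof (intro conjI impI)
      show "num_intersecting s A \<le> N" using IH p(4)[of s] by simp
      assume "num_intersecting s A = N"
      then have "good A'" "num_intersecting s A = num_intersecting s A'" using IH p(4)[of s] by auto
      then show "good A" using last[OF less.prems(1) A'] by simp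
    qed
  qed
qed

context ground begin

section \<open>Strictness of the last compression\<close>

text \<open>\<open>M\<close> takes one set from each complementary pair: the one containing
  \<open>p\<close> if it satisfies \<open>Psi\<close>, otherwise the other. Monotonicity of
  \<open>Psi\<close> settles intersections when exactly one set contains \<open>p\<close>, and two
  sets without \<open>p\<close> have at least \<open>card V - 3\<close> elements each. Every size
  \<open>s\<close> up to \<open>2 ^ (card V - 1)\<close> is thus realised inside
  \<open>M\<close>.\<close>

lemma maximal_family:
  fixes p :: 'a and Psi :: "'a set \<Rightarrow> bool"
  assumes p: "p \<in> V" and up: "\<And>X Y. Psi X \<Longrightarrow> X \<subseteq> Y \<Longrightarrow> Y \<subseteq> V \<Longrightarrow> Psi Y"
    and big: "\<And>X. X \<subseteq> V \<Longrightarrow> p \<in> X \<Longrightarrow> 4 \<le> card X \<Longrightarrow> Psi X"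
  defines "M \<equiv> {X. X \<subseteq> V \<and> (if p \<in> X then Psi X else \<not> Psi (V - X))}"
  shows "card M = 2 ^ (card V - 1)" "intersecting M" "\<And>X. X \<in> M \<Longrightarrow> p \<notin> X \<Longrightarrow> card V - 3 \<le> card X"
proof -
  have large: "card V - 3 \<le> card X" if "X \<in> M" "p \<notin> X" for X
  proof -
    have X: "X \<subseteq> V" "\<not> Psi (V - X)" using that by (auto simp: M_def)
    have "card (V - X) \<le> 3" using big[of "V - X"] X p that(2) by force
    moreover have "card (V - X) = card V - card X" using X(1) finV by (meson card_Diff_subset finite_subset)
    ultimately show ?thesis by simp
  qed
  then show "\<And>X. X \<in> M \<Longrightarrow> p \<notin> X \<Longrightarrow> card V - 3 \<le> card X" .
  let ?h = "\<lambda>X. if Psi (insert p X) then insert p X else V - insert p X"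
  have "bij_betw ?h (Pow (V - {p})) M"
    unfolding bij_betw_def
  proof
    show "inj_on ?h (Pow (V - {p}))"
    proof (rule inj_onI)
      fix X Y assume XY: "X \<in> Pow (V - {p})" "Y \<in> Pow (V - {p})" "?h X = ?h Y"
      have "?h Z = insert p Z \<or> ?h Z = V - insert p Z" for Z by simp
      then have "insert p X = insert p Y \<or> V - insert p X = V - insert p Y"
        using XY(3) by (metis DiffE insertI1)
      then show "X = Y" using XY(1,2) p by blast
    qed
    show "?h ` Pow (V - {p}) = M"
    proof
      show "?h ` Pow (V - {p}) \<subseteq> M"
      proof clarify
        fix X assume X: "X \<subseteq> V - {p}"
        then have "V - (V - insert p X) = insert p X" using p by blast
        then show "?h X \<in> M" using X p by (auto simp: M_def)
      qed
      show "M \<subseteq> ?h ` Pow (V - {p})"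
      proof
        fix X assume X: "X \<in> M"
        show "X \<in> ?h ` Pow (V - {p})"
        proof (cases "p \<in> X")
          case True
          then have e: "insert p (X - {p}) = X" by blast
          have "Psi X" "X - {p} \<in> Pow (V - {p})" using X True by (auto simp: M_def)
          then have "X = ?h (X - {p})" unfolding e by simp
          then show ?thesis using \<open>X - {p} \<in> Pow (V - {p})\<close> by (rule image_eqI)
        next
          case False
          have e: "insert p (V - X - {p}) = V - X" using False p by blast
          have "V - (V - X) = X" using X by (auto simp: M_def)
          then have "X = ?h (V - X - {p})" using X False unfolding e by (simp add: M_def)
          moreover have "V - X - {p} \<in> Pow (V - {p})" by blast
          ultimately show ?thesis by blast
        qed
      qed
    qed
  qed
  then have "card M = card (Pow (V - {p}))" by (simp add: bij_betw_same_card)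
  then show "card M = 2 ^ (card V - 1)" using finV p by (simp add: card_Pow)
  show "intersecting M"
    unfolding intersecting_def
  proof (intro ballI)
    fix X Y assume XY: "X \<in> M" "Y \<in> M"
    have mix: "X \<inter> Y \<noteq> {}" if "X \<in> M" "Y \<in> M" "p \<in> X" "p \<notin> Y" for X Y
    proof
      assume "X \<inter> Y = {}"
      then have "X \<subseteq> V - Y" "Psi X" "\<not> Psi (V - Y)" using that by (auto simp: M_def)
      then show False using up[of X "V - Y"] by blast
    qed
    show "X \<inter> Y \<noteq> {}"
    proof (cases "p \<in> X \<or> p \<in> Y")
      case True
      then show ?thesis using mix[of X Y] mix[of Y X] XY by blast
    next
      case False
      show ?thesis
      proof
        assume "X \<inter> Y = {}"
        moreover have "finite X" "finite Y" "X \<union> Y \<subseteq> V" using XY finV by (auto simp: M_def intro: finite_subset)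
        ultimately have "card X + card Y \<le> card V"
          using card_mono[OF finV, of "X \<union> Y"] by (simp add: card_Un_disjoint)
        then show False using large[OF XY(1)] large[OF XY(2)] False V21 by simp
      qed
    qed
  qed
qed

text \<open>With \<open>Psi X\<close> meaning that \<open>X\<close> has at least four elements or
  contains \<open>Q\<close>, the maximal family contains \<open>Q\<close> and \<open>R\<close>, and
  \<open>Q\<close> is the only possible member with fewer than three elements. Any \<open>s\<close>
  of its sets including both will do.\<close>

lemma member_family:
  assumes s: "2 \<le> s" "s \<le> 2 ^ (card V - 1)" and A: "A \<subseteq> Pow V" "\<And>B. B \<subseteq> V \<Longrightarrow> 3 \<le> card B \<Longrightarrow> B \<in> A"
    and Q: "Q \<in> A" "p \<in> Q" "2 \<le> card Q" and R: "R \<subseteq> V" "p \<in> R" "4 \<le> card R"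
  shows "\<exists>G\<in>fam s A {} {}. Q \<in> G \<and> R \<in> G"
proof -
  have p: "p \<in> V" using R by blast
  have QV: "Q \<subseteq> V" using Q(1) A(1) by blast
  have fQ: "finite Q" using QV finV by (rule finite_subset)
  define Psi where "Psi X \<longleftrightarrow> (4 \<le> card X \<or> Q \<subseteq> X)" for X
  define M where "M = {X. X \<subseteq> V \<and> (if p \<in> X then Psi X else \<not> Psi (V - X))}"
  have up: "Psi Y" if "Psi X" "X \<subseteq> Y" "Y \<subseteq> V" for X Y
    using that card_mono[of Y X] finite_subset[OF that(3) finV] by (auto simp: Psi_def)
  have big: "Psi X" if "4 \<le> card X" for X using that by (simp add: Psi_def)
  note mf = maximal_family[OF p, of Psi, folded M_def]
  have cM: "card M = 2 ^ (card V - 1)" and iM: "intersecting M"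
    and lM: "\<And>X. X \<in> M \<Longrightarrow> p \<notin> X \<Longrightarrow> card V - 3 \<le> card X"
    using mf up big by blast+
  have "finite M" using finV by (auto simp: M_def intro: finite_subset[of _ "Pow V"])
  have MA: "M \<subseteq> A"
  proof
    fix X assume X: "X \<in> M"
    then have XV: "X \<subseteq> V" by (simp add: M_def)
    show "X \<in> A"
    proof (cases "p \<in> X \<and> \<not> 4 \<le> card X")
      case True
      then have QX: "Q \<subseteq> X" using X by (auto simp: M_def Psi_def)
      show ?thesis
      proof (cases "X = Q")
        case False
        then have "Q \<subset> X" using QX by blast
        then have "card Q < card X" using psubset_card_mono[OF finite_subset[OF XV finV]] by blast
        then show ?thesis using A(2)[OF XV] Q(3) by simp
      qed (use Q(1) in simp)
    next
      case False
      then show ?thesis using A(2)[OF XV] lM[OF X] V21 by fastforce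
    qed
  qed
  have "Q \<in> M" "R \<in> M" using Q(2) QV R by (auto simp: M_def Psi_def)
  then have "{Q, R} \<subseteq> M" by simp
  moreover have "card {Q, R} \<le> s" using s(1) by (auto simp: card_insert_if)
  ultimately obtain G where G: "{Q, R} \<subseteq> G" "G \<subseteq> M" "card G = s"
    using exists_subset_between[of "{Q, R}" s M] s(2) cM \<open>finite M\<close> by auto
  have "intersecting G" using iM G(2) unfolding intersecting_def by blast
  then have "G \<in> fam s A {} {}" using G MA by (auto simp: fam_def)
  then show ?thesis using G(1) by blast
qed

text \<open>The replaced set \<open>B\<close> is absent from \<open>A'\<close>, so it has at most
  two elements and its complement is large. A family with the new set and a large set disjoint from
  \<open>B\<close> cannot come from \<open>A\<close>.\<close>

lemma strict_last_step:
  assumes s: "2 \<le> s" "s \<le> 2 ^ (card V - 1)" and A: "A \<subseteq> Pow V" and st: "cstep V A A'"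
    and big: "\<And>B. B \<subseteq> V \<Longrightarrow> 3 \<le> card B \<Longrightarrow> B \<in> A'" and small: "\<And>B. B \<in> A' \<Longrightarrow> 2 \<le> card B"
  shows "num_intersecting s A < num_intersecting s A'"
proof -
  have fA: "finite A" using finV A by (meson finite_Pow_iff finite_subset)
  have A'V: "A' \<subseteq> Pow V" using cstep_props(1)[OF finV A st] .
  have cB: "card B \<le> 2" if "B \<in> A" "B \<notin> A'" for B
    using big[of B] that A by fastforce
  have cV: "card V - card X \<le> card (V - X)" if "finite X" for X
    using diff_card_le_card_Diff[OF that] .
  show ?thesis using st unfolding cstep_def
  proof
    assume "\<exists>u\<in>V. A' = raise u A ` A \<and> A' \<noteq> A"
    then obtain u where u: "u \<in> V" "A' = raise u A ` A" "A' \<noteq> A" by blast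
    then obtain B where B: "B \<in> A" "u \<notin> B" "insert u B \<notin> A" "insert u B \<in> A'" "B \<notin> A'"
      using raise_props(4)[OF finV A u(1)] by metis
    have fB: "finite B" using B(1) A finV by (meson PowD finite_subset subsetD)
    have "4 \<le> card (V - B)" using cV[OF fB] cB[OF B(1,5)] V21 by simp
    then obtain G where G: "G \<in> fam s A' {} {}" "insert u B \<in> G" "V - B \<in> G"
      using member_family[OF s A'V big B(4) insertI1 small[OF B(4)], of "V - B"] u(1) B(2) by blast
    show ?thesis unfolding u(2)
      by (rule raise_strict[OF fA B(1-3) G(1)[unfolded u(2)] G(2,3)]) blast
  next
    assume "\<exists>v\<in>V. \<exists>U\<subseteq>V. v \<notin> U \<and> 2 \<le> card U \<and> A' = compression.compress v U A \<and> compression.moved v U A \<noteq> {}"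
    then obtain v U where vu: "v \<in> V" "U \<subseteq> V" "v \<notin> U" "2 \<le> card U" "A' = compression.compress v U A"
        "compression.moved v U A \<noteq> {}" by blast
    interpret compression v U A using compressionI[OF vu(3,4) fA] .
    obtain B where B: "B \<in> moved" using vu(6) by blast
    have BA: "B \<in> A" "v \<in> B" "B \<inter> U = {}" using B by (auto simp: moved_def low_def)
    have fB: "finite B" using BA(1) A finV by (meson PowD finite_subset subsetD)
    have "B \<notin> swap ` moved" using BA(2) vu(3) by (auto simp: swap_def)
    then have BA': "B \<notin> A'" using B vu(5) by (auto simp: compress_def)
    have sB: "swap B \<in> A'" using B vu(5) by (auto simp: compress_def)
    obtain p q where pq: "p \<in> U" "q \<in> U" "p \<noteq> q" using vu(4)
      by (metis card_2_iff' numeral_2_eq_2 obtain_subset_with_card_n subsetD)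
    \<comment> \<open>Omitting \<open>q\<close> keeps \<open>U\<close> from being contained in this
      set, and \<open>p\<close> is an element it shares with \<open>swap B\<close>.\<close>
    let ?R = "V - insert q B"
    have "4 \<le> card ?R" using cV[of "insert q B"] fB cB[OF BA(1) BA'] V21 by (auto simp: card_insert_if split: if_splits)
    moreover have "p \<in> ?R" using pq BA(3) vu(2) by blast
    moreover have "p \<in> swap B" using pq by (simp add: swap_def)
    ultimately obtain G where G: "G \<in> fam s A' {} {}" "swap B \<in> G" "?R \<in> G"
      using member_family[OF s A'V big sB _ small[OF sB], of p ?R] by blast
    show ?thesis unfolding vu(5)
      by (rule compress_strict[OF B G(1)[unfolded vu(5)] G(2,3)]) (use pq in auto)
  qed
qed

section \<open>What a stable family can miss\<close>

lemma stable_up: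
  assumes st: "stable V A" and A: "A \<subseteq> Pow V" "B \<in> A" "B \<subseteq> C" "C \<subseteq> V"
  shows "C \<in> A"
proof -
  have one: "insert u B \<in> A" if "B \<in> A" "u \<in> V" for B u
  proof (rule ccontr)
    assume n: "insert u B \<notin> A"
    then have "u \<notin> B" using that by (metis insert_absorb)
    then have "raise u A B = insert u B" using n by (simp add: raise_def)
    then have "insert u B \<in> raise u A ` A" using that(1) by (metis image_eqI)
    moreover have "raise u A ` A = A" using st that(2) unfolding stable_def cstep_def by metis
    ultimately show False using n by simp
  qed
  have "B \<union> X \<in> A" if "finite X" "X \<subseteq> V" for X
    using that by (induction X rule: finite_induct) (use A(2) one in auto)
  then have "B \<union> C \<in> A" using A(4) finV finite_subset by blast
  then show ?thesis using A(3) by (simp add: Un_absorb1)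
qed

lemma stable_compress:
  assumes st: "stable V A" and A: "A \<subseteq> Pow V" and E: "E \<union> U \<notin> A" "v \<in> V" "U \<subseteq> V" "2 \<le> card U" "E \<inter> U = {}" "v \<notin> E \<union> U"
  shows "insert v E \<notin> A"
proof
  assume i: "insert v E \<in> A"
  have fA: "finite A" using finV A by (meson finite_Pow_iff finite_subset)
  have vU: "v \<notin> U" using E by blast
  interpret compression v U A using compressionI[OF vU E(4) fA] .
  have "swap (insert v E) = E \<union> U" using E by (auto simp: swap_def)
  then have "insert v E \<in> moved" using i E by (auto simp: moved_def low_def)
  then have "cstep V A compress" unfolding cstep_def using E vU by blast
  then show False using st by (auto simp: stable_def)
qed

lemma card_subsets: "card {B. B \<subseteq> V \<and> card B = k} = card V choose k"
  using n_subsets[OF finV] .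

text \<open>More sets are missing than the empty set and the singletons, so some \<open>X\<close>
  with at least two elements is. A singleton \<open>{w}\<close> lies inside \<open>X\<close> or
  could be compressed to \<open>X\<close>.\<close>

lemma stable_pair:
  assumes st: "stable V A" and A: "A \<subseteq> Pow V" and c: "card V + 1 < card (Pow V - A)"
    and B: "B \<subseteq> V" "card B \<le> 1"
  shows "B \<notin> A"
proof
  assume BA: "B \<in> A"
  have sub: "C \<notin> A" if "X \<notin> A" "C \<subseteq> X" "X \<subseteq> V" for C X using stable_up[OF st A _ that(2,3)] that(1) by blast
  have "\<exists>X\<in>Pow V - A. 2 \<le> card X"
  proof (rule ccontr)
    assume "\<not> ?thesis"
    then have "card X < 2" if "X \<in> Pow V - A" for X using that by (meson not_less)
    then have "Pow V - A \<subseteq> {B. B \<subseteq> V \<and> card B = 0} \<union> {B. B \<subseteq> V \<and> card B = 1}"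
      by (auto simp: less_2_cases_iff)
    then have "card (Pow V - A) \<le> card ({B. B \<subseteq> V \<and> card B = 0} \<union> {B. B \<subseteq> V \<and> card B = 1})"
      using finV by (intro card_mono) (auto intro: finite_subset[of _ "Pow V"])
    also have "\<dots> \<le> 1 + card V" using card_Un_le[of "{B. B \<subseteq> V \<and> card B = 0}" "{B. B \<subseteq> V \<and> card B = 1}"]
      by (simp only: card_subsets) simp
    finally show False using c by simp
  qed
  then obtain X where X: "X \<subseteq> V" "X \<notin> A" "2 \<le> card X" by blast
  obtain w where w: "w \<in> V" "B \<subseteq> {w}"
  proof (cases "B = {}")
    case True
    have "V \<noteq> {}" using V21 by auto
    then show ?thesis using True that by blast
  next
    case False
    then show ?thesis using B that
      by (metis card_0_eq card_1_singletonE finV finite_subset insert_subset le_Suc_eq le_zero_eq One_nat_def order_refl)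
  qed
  have "{w} \<notin> A"
  proof (cases "w \<in> X")
    case True
    then show ?thesis using sub[OF X(2) _ X(1)] by blast
  next
    case False
    then show ?thesis using stable_compress[OF st A, of "{}" X w] X w by simp
  qed
  then show False using sub[of "{w}" B] BA w by blast
qed

text \<open>If \<open>w\<close> is outside \<open>T\<close>, replacing it by \<open>T - {x}\<close>
  would move \<open>{x, w}\<close> to the missing set \<open>T\<close>.\<close>

lemma stable_triple:
  assumes st: "stable V A" and A: "A \<subseteq> Pow V" and T: "T \<subseteq> V" "card T = 3" "T \<notin> A" and x: "x \<in> T" "w \<in> V" "w \<noteq> x"
  shows "{x, w} \<notin> A"
proof (cases "w \<in> T")
  case True
  then show ?thesis using stable_up[OF st A _ _ T(1)] T(3) x by blast
next
  case False
  have fT: "finite T" using T(1) finV by (rule finite_subset)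
  have "{x} \<union> (T - {x}) \<notin> A" using x T(3) by (simp add: insert_absorb)
  moreover have "2 \<le> card (T - {x})" using T(2) x fT by simp
  ultimately have "insert w {x} \<notin> A" using stable_compress[OF st A, of "{x}" "T - {x}" w] x False T(1) by auto
  then show ?thesis by (simp add: insert_commute)
qed

lemma pairs_at: "finite W \<Longrightarrow> x \<notin> W \<Longrightarrow> card ((\<lambda>w. {x, w}) ` W) = card W"
  by (rule card_image) (auto intro!: inj_onI simp: doubleton_eq_iff)

text \<open>A missing triple forces all pairs at two of its elements to be missing; with the
  singletons these are \<open>3 * card V - 3\<close> sets, more than the \<open>2 * card V\<close>
  available.\<close>

lemma stable_small_defect:
  assumes st: "stable V A" and A: "A \<subseteq> Pow V" and c: "card (Pow V - A) = 2 * card V"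
    and B: "B \<subseteq> V" "3 \<le> card B"
  shows "B \<in> A"
proof (rule ccontr)
  assume BA: "B \<notin> A"
  obtain T where T: "T \<subseteq> B" "card T = 3" by (rule obtain_subset_with_card_n[OF B(2)]) (rule that)
  have TV: "T \<subseteq> V" "T \<notin> A" using T B stable_up[OF st A _ T(1) B(1)] BA by auto
  have "T \<noteq> {}" using T(2) by auto
  then obtain x where x: "x \<in> T" by blast
  have "card (T - {x}) = 2" using T(2) x by (simp add: card_Diff_singleton)
  then have "T - {x} \<noteq> {}" by (metis card.empty zero_neq_numeral)
  then obtain y where xy: "x \<in> T" "y \<in> T" "x \<noteq> y" using x by blast
  have cc: "card V + 1 < card (Pow V - A)" using c V21 by simp
  let ?X1 = "(\<lambda>w. {x, w}) ` (V - {x})" and ?X2 = "(\<lambda>w. {y, w}) ` (V - {y, x})" and ?X3 = "(\<lambda>w. {w}) ` V"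
  have sub: "?X1 \<union> ?X2 \<union> ?X3 \<subseteq> Pow V - A"
  proof -
    have "{x, w} \<in> Pow V - A" if "w \<in> V - {x}" for w
      using stable_triple[OF st A TV(1) T(2) TV(2) xy(1), of w] that TV(1) xy by auto
    moreover have "{y, w} \<in> Pow V - A" if "w \<in> V - {y, x}" for w
      using stable_triple[OF st A TV(1) T(2) TV(2) xy(2), of w] that TV(1) xy by auto
    moreover have "{w} \<in> Pow V - A" if "w \<in> V" for w
      using stable_pair[OF st A cc, of "{w}"] that by auto
    ultimately show ?thesis by blast
  qed
  have fin: "finite ?X1" "finite ?X2" "finite ?X3" using finV by auto
  have "card (?X1 \<union> ?X2 \<union> ?X3) = card ?X1 + card ?X2 + card ?X3"
  proof -
    have "?X1 \<inter> ?X2 = {}" using xy(3) by (auto simp: doubleton_eq_iff)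
    moreover have "(?X1 \<union> ?X2) \<inter> ?X3 = {}" by auto
    ultimately show ?thesis using fin by (simp add: card_Un_disjoint)
  qed
  also have "\<dots> = (card V - 1) + (card V - 2) + card V"
  proof -
    have "{y, x} \<subseteq> V" "card {y, x} = 2" using xy TV(1) by auto
    then have "card (V - {y, x}) = card V - 2" by (simp only: card_Diff_subset[OF _ \<open>{y, x} \<subseteq> V\<close>] finite.intros)
    moreover have "card (V - {x}) = card V - 1" using xy(1) TV(1) by (simp add: card_Diff_singleton subsetD)
    moreover have "card ?X3 = card V" by (rule card_image) simp
    ultimately show ?thesis using finV by (simp add: pairs_at)
  qed
  finally have "card (?X1 \<union> ?X2 \<union> ?X3) > 2 * card V" using V21 by simp
  moreover have "card (?X1 \<union> ?X2 \<union> ?X3) \<le> card (Pow V - A)" using sub finV by (intro card_mono) auto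
  ultimately show False using c by simp
qed

text \<open>A missing four-element set would force every pair to be missing, hence all sets of size
  at most two, which exceeds the given number by \<open>card V - 1\<close>.\<close>

lemma stable_large_defect:
  assumes st: "stable V A" and A: "A \<subseteq> Pow V" and c: "card (Pow V - A) = 1 + card V + ((card V - 1) choose 2)"
    and B: "B \<subseteq> V" "4 \<le> card B"
  shows "B \<in> A"
proof (rule ccontr)
  assume BA: "B \<notin> A"
  obtain X where X: "X \<subseteq> B" "card X = 4" by (rule obtain_subset_with_card_n[OF B(2)]) (rule that)
  have XV: "X \<subseteq> V" "X \<notin> A" using X B stable_up[OF st A _ X(1) B(1)] BA by auto
  have fX: "finite X" using XV(1) finV by (rule finite_subset)
  have sub: "C \<notin> A" if "Y \<notin> A" "C \<subseteq> Y" "Y \<subseteq> V" for C Y using stable_up[OF st A _ that(2,3)] that(1) by blast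
  have tri: "{x, y, w} \<notin> A" if "x \<in> X" "y \<in> X" "x \<noteq> y" "w \<in> V" "w \<notin> X" for x y w
  proof -
    have "{x, y} \<union> (X - {x, y}) \<notin> A" using that XV(2) by (simp add: insert_absorb)
    moreover have "card (X - {x, y}) = 2" using that X(2) fX by (simp add: card_Diff_subset)
    ultimately have "insert w {x, y} \<notin> A"
      using stable_compress[OF st A, of "{x, y}" "X - {x, y}" w] that XV(1) by auto
    then show ?thesis by (simp add: insert_commute)
  qed
  \<comment> \<open>If \<open>w'\<close> is in \<open>X\<close>, the choice \<open>x = w'\<close>
    puts the pair inside a missing triple. Otherwise replacing \<open>w'\<close> by
    \<open>{x, y}\<close> would lead to one.\<close>
  have out: "{w, w'} \<notin> A" if w: "w \<in> V" "w' \<in> V" "w \<noteq> w'" "w \<notin> X" for w w'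
  proof -
    have "X \<noteq> {}" using X(2) by auto
    then obtain x where x: "x \<in> X" "w' \<in> X \<longrightarrow> x = w'" by blast
    have "card (X - {x}) = 3" using X(2) x(1) fX by simp
    then have "X - {x} \<noteq> {}" by (metis card.empty zero_neq_numeral)
    then obtain y where y: "y \<in> X" "x \<noteq> y" by blast
    have t: "{x, y, w} \<notin> A" by (rule tri) (use x y w in auto)
    show ?thesis
    proof (cases "w' \<in> X")
      case True
      then show ?thesis using sub[OF t, of "{w, w'}"] x y w XV(1) by auto
    next
      case False
      have "{w} \<union> {x, y} \<notin> A" using t by (simp add: insert_commute)
      then have "insert w' {w} \<notin> A"
        using stable_compress[OF st A, of "{w}" "{x, y}" w'] x y w False XV(1) by auto
      then show ?thesis by (simp add: insert_commute)
    qed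
  qed
  have pair: "{w, w'} \<notin> A" if "w \<in> V" "w' \<in> V" "w \<noteq> w'" for w w'
  proof (cases "w \<in> X \<and> w' \<in> X")
    case True
    show ?thesis by (rule sub[OF XV(2) _ XV(1)]) (use True in simp)
  next
    case False
    then show ?thesis using out[of w w'] out[of w' w] that by (auto simp: insert_commute)
  qed
  have cc: "card V + 1 < card (Pow V - A)"
    using c V21 zero_less_binomial[of 2 "card V - 1"] by simp
  let ?L = "\<lambda>k. {B. B \<subseteq> V \<and> card B = k}"
  have "?L 0 \<union> ?L 1 \<union> ?L 2 \<subseteq> Pow V - A"
  proof -
    have "Y \<notin> A" if Y: "Y \<subseteq> V" "card Y = 2" for Y
    proof -
      obtain w w' where "Y = {w, w'}" "w \<noteq> w'" using Y(2) by (meson card_2_iff)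
      then show ?thesis using pair Y(1) by auto
    qed
    moreover have "Y \<notin> A" if "Y \<subseteq> V" "card Y \<le> 1" for Y using stable_pair[OF st A cc that] .
    ultimately show ?thesis by auto
  qed
  then have "card (?L 0 \<union> ?L 1 \<union> ?L 2) \<le> card (Pow V - A)" using finV by (intro card_mono) auto
  moreover have "card (?L 0 \<union> ?L 1 \<union> ?L 2) = card (?L 0) + card (?L 1) + card (?L 2)"
  proof -
    have "finite (?L k)" for k using finV by (auto intro: finite_subset[of _ "Pow V"])
    moreover have "?L 0 \<inter> ?L 1 = {}" "(?L 0 \<union> ?L 1) \<inter> ?L 2 = {}" by auto
    ultimately show ?thesis by (simp only: card_Un_disjoint finite_Un simp_thms)
  qed
  moreover have "card V choose 2 = ((card V - 1) choose 2) + (card V - 1)"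
    using V21 by (cases "card V") (auto simp: numeral_2_eq_2)
  ultimately show False using c V21 by (simp only: card_subsets) simp
qed

end

section \<open>Counting families by their edges\<close>

lemma fam_image:
  assumes inj: "inj f"
  shows "card (fam s ((`) f ` A) ((`) f ` K) ((`) f ` P)) = card (fam s A K P)"
proof -
  have i1: "inj ((`) f)" using inj by (simp add: inj_def inj_image_eq_iff)
  have i2: "inj ((`) ((`) f))" using i1 by (simp add: inj_def inj_image_eq_iff)
  have int: "intersecting ((`) f ` F) \<longleftrightarrow> intersecting F" for F
    unfolding intersecting_def ball_simps by (simp add: image_Int[OF inj, symmetric])
  have "fam s ((`) f ` A) ((`) f ` K) ((`) f ` P) = (`) ((`) f) ` fam s A K P"
  proof
    show "(`) ((`) f) ` fam s A K P \<subseteq> fam s ((`) f ` A) ((`) f ` K) ((`) f ` P)"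
      using card_image[OF inj_on_subset[OF i1 subset_UNIV]] int by (auto simp: fam_def)
    show "fam s ((`) f ` A) ((`) f ` K) ((`) f ` P) \<subseteq> (`) ((`) f) ` fam s A K P"
    proof
      fix G assume G: "G \<in> fam s ((`) f ` A) ((`) f ` K) ((`) f ` P)"
      then obtain F where F: "F \<subseteq> A" "G = (`) f ` F" by (auto simp: fam_def subset_image_iff)
      have "card F = s" "intersecting F" "(`) f ` K \<subseteq> (`) f ` F" "P = {} \<or> (`) f ` F \<inter> (`) f ` P \<noteq> {}"
        using G int card_image[OF inj_on_subset[OF i1 subset_UNIV], of F] unfolding F(2) by (auto simp: fam_def)
      moreover have "K \<subseteq> F" using calculation(3) by (simp only: inj_image_subset_iff[OF i1])
      moreover have "P = {} \<or> F \<inter> P \<noteq> {}"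
        using calculation(4) by (simp only: image_Int[OF i1, symmetric] image_is_empty)
      ultimately have "F \<in> fam s A K P" using F(1) by (simp add: fam_def)
      then show "G \<in> (`) ((`) f) ` fam s A K P" using F(2) by blast
    qed
  qed
  then show ?thesis using card_image[OF inj_on_subset[OF i2 subset_UNIV]] by simp
qed

lemma extend_to_permutation:
  assumes V: "finite V" and f: "inj_on f S" "S \<subseteq> V" "f ` S \<subseteq> V"
  shows "\<exists>p. p permutes V \<and> (\<forall>x\<in>S. p x = f x)"
proof -
  have fS: "finite S" using f(2) V by (rule finite_subset)
  have "card (V - S) = card (V - f ` S)"
    using f V fS by (simp add: card_Diff_subset card_image)
  then obtain h where h: "bij_betw h (V - S) (V - f ` S)"
    using finite_same_card_bij[of "V - S" "V - f ` S"] V by blast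
  define p where "p x = (if x \<in> S then f x else if x \<in> V then h x else x)" for x
  have "bij_betw p S (f ` S)"
    using bij_betw_imageI[OF f(1) refl] by (rule bij_betw_cong[THEN iffD1, rotated]) (simp add: p_def)
  moreover have "bij_betw p (V - S) (V - f ` S)"
    using h by (rule bij_betw_cong[THEN iffD1, rotated]) (simp add: p_def)
  ultimately have "bij_betw p (S \<union> (V - S)) (f ` S \<union> (V - f ` S))"
    by (rule bij_betw_combine) blast
  moreover have "S \<union> (V - S) = V" "f ` S \<union> (V - f ` S) = V" using f by auto
  ultimately have "p permutes V"
    by (intro bij_imp_permutes) (use f in \<open>auto simp: p_def\<close>)
  then show ?thesis by (auto simp: p_def)
qed

lemma intersecting_graph:
  assumes E: "\<And>e. e \<in> E \<Longrightarrow> card e = 2" and i: "intersecting E"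
  shows "(\<exists>x. \<forall>e\<in>E. x \<in> e) \<or> (\<exists>x a b. x \<noteq> a \<and> x \<noteq> b \<and> a \<noteq> b \<and> E = {{x, a}, {x, b}, {a, b}})"
proof (cases "\<exists>e\<in>E. \<exists>f\<in>E. e \<noteq> f")
  case False
  show ?thesis
  proof (cases "E = {}")
    case False
    then obtain e where e: "e \<in> E" by blast
    then have "E = {e}" using \<open>\<not> (\<exists>e\<in>E. \<exists>f\<in>E. e \<noteq> f)\<close> by blast
    moreover have "e \<noteq> {}" using intersectingD[OF i e e] by blast
    ultimately show ?thesis by blast
  qed simp
next
  case True
  then obtain e f where ef: "e \<in> E" "f \<in> E" "e \<noteq> f" by blast
  obtain x where x: "x \<in> e" "x \<in> f" using intersectingD[OF i ef(1,2)] by blast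
  have other: "\<exists>a. e = {x, a} \<and> x \<noteq> a" if e: "e \<in> E" "x \<in> e" for e
  proof -
    obtain p q where "e = {p, q}" "p \<noteq> q" using E[OF e(1)] by (meson card_2_iff)
    then show ?thesis using e(2) by (auto simp: insert_commute)
  qed
  obtain a b where ab: "e = {x, a}" "f = {x, b}" "x \<noteq> a" "x \<noteq> b" using other ef x by meson
  then have "a \<noteq> b" using ef(3) by blast
  have third: "g = {a, b}" if g: "g \<in> E" "x \<notin> g" for g
  proof -
    have "a \<in> g" "b \<in> g" using intersectingD[OF i g(1) ef(1)] intersectingD[OF i g(1) ef(2)] ab g(2) by auto
    then have "{a, b} \<subseteq> g" by blast
    moreover have "card g \<le> card {a, b}" using E[OF g(1)] \<open>a \<noteq> b\<close> by simp
    moreover have "finite g" using E[OF g(1)] by (metis card.infinite zero_neq_numeral)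
    ultimately show ?thesis using card_seteq[of g "{a, b}"] by simp
  qed
  show ?thesis
  proof (cases "\<exists>g\<in>E. x \<notin> g")
    case True
    then have g: "{a, b} \<in> E" using third by blast
    have "h \<in> {{x, a}, {x, b}}" if h: "h \<in> E" "x \<in> h" for h
    proof -
      obtain c where c: "h = {x, c}" using other[OF h] by blast
      then show ?thesis using intersectingD[OF i h(1) g] ab by auto
    qed
    then have "h \<in> {{x, a}, {x, b}, {a, b}}" if "h \<in> E" for h
      using that third[OF that] by (cases "x \<in> h") auto
    then have "E = {{x, a}, {x, b}, {a, b}}" using g ef(1,2) ab(1,2) by (intro subset_antisym subsetI) auto
    then show ?thesis using ab(3,4) \<open>a \<noteq> b\<close> by blast
  qed blast
qed

text \<open>Fix disjoint edges \<open>e\<close> and \<open>f\<close>. Every other edge is disjoint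
  from one of them, and so gives a pair with it, unless it is one of the four edges joining
  \<open>e\<close> to \<open>f\<close>. These four are lost, and \<open>f\<close> is lost because
  \<open>e\<close> already stands for the pair \<open>{e, f}\<close>.\<close>

lemma many_disjoint_pairs:
  assumes H: "finite H" "\<And>e. e \<in> H \<Longrightarrow> card e = 2" and n: "\<not> intersecting H"
  shows "card H \<le> card {K. K \<subseteq> H \<and> card K = 2 \<and> \<not> intersecting K} + 5"
proof -
  obtain e f where ef: "e \<in> H" "f \<in> H" "e \<inter> f = {}" using n by (auto simp: intersecting_def)
  have ne: "e \<noteq> f" using ef H(2)[OF ef(1)] by auto
  obtain a b where ab: "e = {a, b}" using H(2)[OF ef(1)] by (meson card_2_iff)
  obtain c d where cd: "f = {c, d}" using H(2)[OF ef(2)] by (meson card_2_iff)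
  let ?X = "{{a, c}, {a, d}, {b, c}, {b, d}}"
  let ?h = "\<lambda>g. if g = e then {e, f} else if g \<inter> e = {} then {g, e} else {g, f}"
  let ?R = "H - ({f} \<union> ?X)" and ?D = "{K. K \<subseteq> H \<and> card K = 2 \<and> \<not> intersecting K}"
  have meets: "g \<in> ?X" if g: "g \<in> H" "g \<inter> e \<noteq> {}" "g \<inter> f \<noteq> {}" for g
  proof -
    obtain p q where pq: "p \<in> g" "p \<in> e" "q \<in> g" "q \<in> f" using g by blast
    then have "p \<noteq> q" using ef(3) by blast
    then have "{p, q} \<subseteq> g" "card g \<le> card {p, q}" using pq H(2)[OF g(1)] by auto
    moreover have "finite g" using H(2)[OF g(1)] by (metis card.infinite zero_neq_numeral)
    ultimately have "g = {p, q}" using card_seteq[of g "{p, q}"] by simp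
    then show ?thesis using pq ab cd by auto
  qed
  have "card ?R \<le> card ?D"
  proof (rule card_inj_on_le)
    show "finite ?D" using H(1) by simp
    show "inj_on ?h ?R"
    proof (rule inj_onI)
      fix g g' assume "g \<in> ?R" "g' \<in> ?R" "?h g = ?h g'"
      then show "g = g'" using ne by (auto simp: doubleton_eq_iff split: if_splits)
    qed
    have "{g, k} \<in> ?D" if "g \<in> H" "k \<in> H" "g \<inter> k = {}" for g k
    proof -
      have "g \<noteq> k" using that H(2)[OF that(1)] by auto
      then have "card {g, k} = 2" by simp
      moreover have "\<not> intersecting {g, k}" using that(3) unfolding intersecting_def by blast
      ultimately show ?thesis using that(1,2) by simp
    qed
    note D = this
    show "?h ` ?R \<subseteq> ?D"
    proof (rule image_subsetI)
      fix g assume g: "g \<in> ?R"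
      have "g \<in> H" "g \<notin> ?X" using g by (simp_all only: Diff_iff Un_iff, simp_all)
      then have "g \<inter> e = {} \<or> g \<inter> f = {}" using meets[of g] by argo
      then consider "g = e" | "g \<noteq> e" "g \<inter> e = {}" | "g \<noteq> e" "g \<inter> e \<noteq> {}" "g \<inter> f = {}" by argo
      then show "?h g \<in> ?D"
      proof cases
        case 1 then show ?thesis using D[OF ef] by simp
      next
        case 2 then show ?thesis using D[of g e] g ef by simp
      next
        case 3 then show ?thesis using D[of g f] g ef by simp
      qed
    qed
  qed
  moreover have "card H \<le> card ?R + 5"
  proof -
    have "card H - card ({f} \<union> ?X) \<le> card ?R" by (rule diff_card_le_card_Diff) simp
    moreover have "card ({f} \<union> ?X) \<le> 1 + 4"
      by (rule order_trans[OF card_Un_le]) (auto simp: card_insert_if)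
    ultimately show ?thesis by simp
  qed
  ultimately show ?thesis by simp
qed

lemma card_filter_sum:
  "finite A \<Longrightarrow> card {x \<in> A. Q x} = (\<Sum>x\<in>A. if Q x then 1 else 0)"
  by (simp only: card_eq_sum sum.inter_filter)

text \<open>Double counting, which turns Bonferroni sums over sets of edges into inequalities for
  each single family.\<close>

lemma sum_fam_subsets:
  assumes A: "finite A" and H: "finite H"
  shows "(\<Sum>K\<in>{K. K \<subseteq> H \<and> card K = j}. card (fam s A K {})) = (\<Sum>F\<in>fam s A {} {}. card (F \<inter> H) choose j)"
proof -
  let ?KK = "{K. K \<subseteq> H \<and> card K = j}" and ?F = "fam s A {} {}"
  have fin: "finite ?KK" "finite ?F" using H finite_fam[OF A] by auto
  have f: "fam s A K {} = {F \<in> ?F. K \<subseteq> F}" for K by (auto simp: fam_def)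
  have "(\<Sum>K\<in>?KK. card (fam s A K {})) = (\<Sum>K\<in>?KK. \<Sum>F\<in>?F. if K \<subseteq> F then 1 else 0)"
    by (rule sum.cong[OF refl], subst f) (rule card_filter_sum[OF fin(2)])
  also have "\<dots> = (\<Sum>F\<in>?F. \<Sum>K\<in>?KK. if K \<subseteq> F then 1 else 0)" by (rule sum.swap)
  also have "\<dots> = (\<Sum>F\<in>?F. card {K \<in> ?KK. K \<subseteq> F})"
    by (rule sum.cong[OF refl]) (rule card_filter_sum[OF fin(1), symmetric])
  also have "\<dots> = (\<Sum>F\<in>?F. card (F \<inter> H) choose j)"
  proof (rule sum.cong[OF refl])
    fix F
    have e: "{K \<in> ?KK. K \<subseteq> F} = {K. K \<subseteq> F \<inter> H \<and> card K = j}" by auto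
    show "card {K \<in> ?KK. K \<subseteq> F} = card (F \<inter> H) choose j"
      unfolding e by (rule n_subsets) (use H in simp)
  qed
  finally show ?thesis .
qed

lemma bonferroni_lower: "q \<le> (if q = 0 then 0 else 1) + (q choose 2)"
proof (induction q)
  case (Suc q)
  have "(Suc q choose 2) = q + (q choose 2)" by (simp add: numeral_2_eq_2)
  then show ?case by simp
qed (simp add: binomial_eq_0)

lemma bonferroni_upper: "(if q = 0 then 0 else 1) + (q choose 2) \<le> q + (q choose 3)"
proof (induction q)
  case (Suc q)
  have "(Suc q choose 2) = q + (q choose 2)" "(Suc q choose 3) = (q choose 2) + (q choose 3)"
    by (simp_all add: numeral_2_eq_2 numeral_3_eq_3)
  then show ?case by simp
qed (simp add: binomial_eq_0)

section \<open>The two-element members as a graph\<close>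

locale bounded_ground = ground +
  assumes s2: "2 \<le> s" and sle: "s \<le> 2 ^ (card V - 1)"
begin

definition big :: "nat \<Rightarrow> 'a set set" where "big k = {B. B \<subseteq> V \<and> k \<le> card B}"
definition edges :: "'a set set" where "edges = {e. e \<subseteq> V \<and> card e = 2}"
definition star :: "'a \<Rightarrow> 'a set set" where "star x = {e \<in> edges. x \<in> e}"

lemma finite_big: "finite (big k)" using finV by (auto simp: big_def intro: finite_subset[of _ "Pow V"])
lemma finite_edges: "finite edges" using finV by (auto simp: edges_def intro: finite_subset[of _ "Pow V"])

lemma star_eq: "x \<in> V \<Longrightarrow> star x = (\<lambda>w. {x, w}) ` (V - {x})"
proof
  assume x: "x \<in> V"
  show "star x \<subseteq> (\<lambda>w. {x, w}) ` (V - {x})"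
  proof
    fix e assume e: "e \<in> star x"
    then obtain p q where pq: "e = {p, q}" "p \<noteq> q" by (auto simp: star_def edges_def card_2_iff)
    then have "e = {x, if p = x then q else p}" "(if p = x then q else p) \<in> V - {x}"
      using e by (auto simp: star_def edges_def)
    then show "e \<in> (\<lambda>w. {x, w}) ` (V - {x})" by blast
  qed
  show "(\<lambda>w. {x, w}) ` (V - {x}) \<subseteq> star x" using x by (auto simp: star_def edges_def)
qed

lemma card_star: "x \<in> V \<Longrightarrow> card (star x) = card V - 1"
  using finV by (simp add: star_eq pairs_at)

lemma perm_big: "p permutes V \<Longrightarrow> (`) p ` big k = big k"
proof -
  assume p: "p permutes V"
  have sub: "(`) q ` big k \<subseteq> big k" if q: "q permutes V" for q
    using permutes_image[OF q] card_image[OF inj_on_subset[OF permutes_inj[OF q] subset_UNIV]]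
    by (auto simp: big_def)
  have "big k \<subseteq> (`) p ` big k"
  proof
    fix B assume B: "B \<in> big k"
    have "inv p ` B \<in> big k" using sub[OF permutes_inv[OF p]] B by blast
    moreover have "p ` inv p ` B = B" using permutes_surj[OF p] by (simp add: image_f_inv_f)
    ultimately show "B \<in> (`) p ` big k" by (metis image_eqI)
  qed
  then show ?thesis using sub[OF p] by blast
qed

lemma perm_star: "p permutes V \<Longrightarrow> x \<in> V \<Longrightarrow> (`) p ` star x = star (p x)"
proof -
  assume p: "p permutes V" and x: "x \<in> V"
  have "p ` (V - {x}) = V - {p x}" using permutes_image[OF p] permutes_inj[OF p] by (simp add: image_set_diff)
  moreover have "p x \<in> V" using p x by (simp add: permutes_in_image)
  ultimately have "star (p x) = (\<lambda>w. {p x, w}) ` p ` (V - {x})" using star_eq[of "p x"] by simp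
  then show ?thesis unfolding star_eq[OF x] by (simp add: image_image)
qed

lemma star_perm:
  assumes "x \<in> V" "y \<in> V"
  obtains p where "p permutes V" "p x = y"
  using extend_to_permutation[OF finV, of "\<lambda>_. y" "{x}"] assms by auto

text \<open>Here \<open>Psi X\<close> means at least four elements or \<open>a\<close> or
  \<open>b\<close> in \<open>X\<close>; the only pairs in the resulting maximal family are the two
  edges. This supplies the positive counts behind the strict inequalities.\<close>

lemma exact_two_edges:
  assumes x: "x \<in> V" "a \<in> V" "b \<in> V" "x \<noteq> a" "x \<noteq> b" "a \<noteq> b"
  shows "fam s (big 3 \<union> {{x, a}, {x, b}}) {{x, a}, {x, b}} {} \<noteq> {}"
proof -
  define Psi where "Psi X \<longleftrightarrow> (4 \<le> card X \<or> a \<in> X \<or> b \<in> X)" for X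
  define M where "M = {X. X \<subseteq> V \<and> (if x \<in> X then Psi X else \<not> Psi (V - X))}"
  have up: "Psi Y" if "Psi X" "X \<subseteq> Y" "Y \<subseteq> V" for X Y
    using that card_mono[of Y X] finite_subset[OF that(3) finV] by (auto simp: Psi_def)
  have bg: "Psi X" if "4 \<le> card X" for X using that by (simp add: Psi_def)
  note mf = maximal_family[OF x(1), of Psi, folded M_def]
  have cM: "card M = 2 ^ (card V - 1)" and iM: "intersecting M"
    and lM: "\<And>X. X \<in> M \<Longrightarrow> x \<notin> X \<Longrightarrow> card V - 3 \<le> card X"
    using mf up bg by blast+
  have fM: "finite M" using finV by (auto simp: M_def intro: finite_subset[of _ "Pow V"])
  have sub: "M \<subseteq> big 3 \<union> {{x, a}, {x, b}}"
  proof
    fix X assume X: "X \<in> M"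
    then have XV: "X \<subseteq> V" by (simp add: M_def)
    then have fX: "finite X" using finV by (rule finite_subset)
    show "X \<in> big 3 \<union> {{x, a}, {x, b}}"
    proof (cases "3 \<le> card X")
      case True then show ?thesis using XV by (simp add: big_def)
    next
      case False
      then have xX: "x \<in> X" using lM[OF X] V21 by fastforce
      then have "a \<in> X \<or> b \<in> X" using X False by (auto simp: M_def Psi_def)
      then obtain c where c: "c \<in> {a, b}" "c \<in> X" by blast
      then have "{x, c} \<subseteq> X" "card {x, c} = 2" using xX x by auto
      then have "X = {x, c}" using card_seteq[OF fX, of "{x, c}"] False by simp
      then show ?thesis using c by auto
    qed
  qed
  have "{{x, a}, {x, b}} \<subseteq> M" using x by (auto simp: M_def Psi_def)
  moreover have "card {{x, a}, {x, b}} \<le> s" using s2 by (auto simp: card_insert_if)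
  ultimately obtain G where G: "{{x, a}, {x, b}} \<subseteq> G" "G \<subseteq> M" "card G = s"
    using exists_subset_between[of "{{x, a}, {x, b}}" s M] sle cM fM by auto
  have "intersecting G" using iM G(2) unfolding intersecting_def by blast
  then have "G \<in> fam s (big 3 \<union> {{x, a}, {x, b}}) {{x, a}, {x, b}} {}" using G sub by (auto simp: fam_def)
  then show ?thesis by blast
qed

lemma fam_perm_big:
  assumes p: "p permutes V"
  shows "card (fam s (big k \<union> (`) p ` X) ((`) p ` K) {}) = card (fam s (big k \<union> X) K {})"
  using fam_image[OF permutes_inj[OF p], of s "big k \<union> X" K "{}"] perm_big[OF p, of k] by (simp add: image_Un)

lemma leaves:
  assumes K: "K \<subseteq> star x" "x \<in> V"
  shows "K = (\<lambda>w. {x, w}) ` {w \<in> V - {x}. {x, w} \<in> K}" "card {w \<in> V - {x}. {x, w} \<in> K} = card K"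
proof -
  show e: "K = (\<lambda>w. {x, w}) ` {w \<in> V - {x}. {x, w} \<in> K}" using K star_eq[OF K(2)] by auto
  have "card ((\<lambda>w. {x, w}) ` {w \<in> V - {x}. {x, w} \<in> K}) = card {w \<in> V - {x}. {x, w} \<in> K}"
    by (rule pairs_at) (use finV in auto)
  then show "card {w \<in> V - {x}. {x, w} \<in> K} = card K" using e by simp
qed

lemma star_transport:
  assumes K: "K \<subseteq> star x" "K' \<subseteq> star x'" "card K = card K'" and x: "x \<in> V" "x' \<in> V"
  obtains p where "p permutes V" "(`) p ` K = K'"
proof -
  let ?L = "{w \<in> V - {x}. {x, w} \<in> K}" and ?L' = "{w \<in> V - {x'}. {x', w} \<in> K'}"
  note l = leaves[OF K(1) x(1)] and l' = leaves[OF K(2) x(2)]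
  obtain h where h: "bij_betw h ?L ?L'"
    using finite_same_card_bij[of ?L ?L'] finV l(2) l'(2) K(3) by auto
  define f where "f w = (if w = x then x' else h w)" for w
  have hL: "h ` ?L = ?L'" "inj_on h ?L" using h by (auto simp: bij_betw_def)
  have fL: "f ` ?L = ?L'" using hL(1) by (auto simp: f_def)
  have "inj_on f (insert x ?L)"
  proof (rule inj_onI)
    fix u w assume uw: "u \<in> insert x ?L" "w \<in> insert x ?L" "f u = f w"
    have "h v \<noteq> x'" if "v \<in> ?L" for v using hL(1) that by blast
    then show "u = w" using uw inj_onD[OF hL(2), of u w] by (auto simp: f_def split: if_splits)
  qed
  moreover have "insert x ?L \<subseteq> V" "f ` insert x ?L \<subseteq> V" using fL x by (auto simp: f_def)
  ultimately obtain p where p: "p permutes V" "\<forall>w\<in>insert x ?L. p w = f w"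
    using extend_to_permutation[OF finV, of f "insert x ?L"] by blast
  have "(`) p ` K = (\<lambda>w. {p x, p w}) ` ?L" by (subst l(1)) (simp add: image_image)
  also have "\<dots> = (\<lambda>w. {x', f w}) ` ?L" using p(2) by (intro image_cong) (auto simp: f_def)
  also have "\<dots> = (\<lambda>w. {x', w}) ` ?L'" unfolding fL[symmetric] by (simp only: image_image)
  also have "\<dots> = K'" using l'(1) by simp
  finally show ?thesis using that p(1) by blast
qed

section \<open>Families by their trace on the graph\<close>

text \<open>For every graph \<open>G\<close> of edges containing \<open>K\<close>, this is the
  number of families over \<open>big 3 \<union> G\<close> whose set of edges is exactly
  \<open>K\<close>; it does not depend on \<open>G\<close>.\<close>

definition trace_count :: "'a set set \<Rightarrow> nat" where
  "trace_count K = card (fam s (big 3 \<union> K) K {})"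

lemma trace_count_star:
  assumes "K \<subseteq> star x" "K' \<subseteq> star x'" "card K = card K'" "x \<in> V" "x' \<in> V"
  shows "trace_count K = trace_count K'"
proof -
  obtain p where p: "p permutes V" "(`) p ` K = K'" using star_transport[OF assms] .
  then show ?thesis using fam_perm_big[OF p(1), of 3 K K] by (simp add: trace_count_def)
qed

lemma fam_eq_0: "\<not> intersecting K \<Longrightarrow> fam s A K P = {}"
  unfolding fam_def intersecting_def by blast

lemma finite_fam_big: "finite X \<Longrightarrow> finite (fam s (big k \<union> X) K P)"
  by (rule finite_fam) (simp add: finite_big)

text \<open>Next to the triangle, every member contains two of \<open>x\<close>, \<open>a\<close>,
  \<open>b\<close>. If it contains exactly two of them and not \<open>y\<close>, it is complemented
  inside \<open>{x, a, b, y}\<close>: the size stays, and the pair becomes \<open>y\<close> with the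
  third vertex. Each image contains \<open>y\<close> and one of the vertices or all three vertices,
  so any two images meet.\<close>

lemma trace_count_triangle:
  assumes x: "x \<in> V" "a \<in> V" "b \<in> V" "x \<noteq> a" "x \<noteq> b" "a \<noteq> b" and y: "y \<in> V" "y \<notin> {x, a, b}"
  shows "trace_count {{x, a}, {x, b}, {a, b}} \<le> trace_count {{y, x}, {y, a}, {y, b}}"
proof -
  let ?T = "{{x, a}, {x, b}, {a, b}}" and ?S = "{{y, x}, {y, a}, {y, b}}" and ?W = "{x, a, b, y}"
  define tog where "tog B \<longleftrightarrow> y \<notin> B \<and> \<not> (x \<in> B \<and> a \<in> B \<and> b \<in> B)" for B
  define h where "h B = (if tog B then (B - ?W) \<union> (?W - B) else B)" for B
  define dom where "dom = {B. (x \<in> B \<and> a \<in> B) \<or> (x \<in> B \<and> b \<in> B) \<or> (a \<in> B \<and> b \<in> B)}"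
  define ran where "ran = {B. (y \<in> B \<and> (x \<in> B \<or> a \<in> B \<or> b \<in> B)) \<or> (x \<in> B \<and> a \<in> B \<and> b \<in> B)}"
  have mem: "u \<in> h B \<longleftrightarrow> (if tog B \<and> u \<in> ?W then u \<notin> B else u \<in> B)" for u B
    by (auto simp: h_def)
  have hran: "h B \<in> ran" if "B \<in> dom" for B
    using that unfolding ran_def dom_def mem_Collect_eq mem by (simp add: tog_def) argo
  \<comment> \<open>The image shows whether the complementation took place, since it then contains
    only one of \<open>x\<close>, \<open>a\<close>, \<open>b\<close>.\<close>
  have hdom: "h B \<in> dom \<longleftrightarrow> \<not> tog B" if "B \<in> dom" for B
    using that unfolding dom_def mem_Collect_eq mem by (simp add: tog_def) argo
  have inj: "inj_on h dom"
  proof (rule inj_onI)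
    fix B C assume BC: "B \<in> dom" "C \<in> dom" "h B = h C"
    then have t: "tog B = tog C" using hdom by metis
    have flip: "(h D - ?W) \<union> (?W - h D) = D" if "tog D" for D
      using that unfolding h_def by auto
    show "B = C"
    proof (cases "tog B")
      case True
      have "B = (h B - ?W) \<union> (?W - h B)" using flip[OF True] by (rule sym)
      also have "\<dots> = C" unfolding BC(3) using flip[of C] t True by blast
      finally show ?thesis .
    next
      case False then show ?thesis using t BC(3) by (simp add: h_def)
    qed
  qed
  have hcard: "card (h B) = card B" if "B \<in> dom" "finite B" for B
  proof (cases "tog B")
    case True
    have "B \<inter> ?W = {x, a} \<or> B \<inter> ?W = {x, b} \<or> B \<inter> ?W = {a, b}"
      using that(1) True y by (auto simp: dom_def tog_def)
    then have c2: "card (B \<inter> ?W) = 2" by (elim disjE) (use x(4-6) in simp_all)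
    have "card ?W = 4" using x y by (auto simp: card_insert_if)
    then have "card (?W - B) = 2" using c2 card_Diff_subset_Int[of ?W B] by (simp add: Int_commute)
    moreover have "card (B - ?W) = card B - 2" using c2 card_Diff_subset_Int[of B ?W] by simp
    moreover have "2 \<le> card B" using c2 card_mono[OF that(2), of "B \<inter> ?W"] by simp
    moreover have "card (h B) = card (B - ?W) + card (?W - B)"
      using True that(2) unfolding h_def if_P[OF True] by (intro card_Un_disjoint) auto
    ultimately show ?thesis by simp
  qed (simp add: h_def)
  have hV: "h B \<subseteq> V" if "B \<subseteq> V" for B using that x y by (auto simp: h_def)
  have hT: "h ` ?T = ?S"
  proof -
    have "tog {x, a}" "tog {x, b}" "tog {a, b}" using x y by (auto simp: tog_def)
    then have "h {x, a} = {y, b}" "h {x, b} = {y, a}" "h {a, b} = {y, x}" using x y by (auto simp: h_def)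
    then show ?thesis by auto
  qed
  have ranint: "B \<inter> C \<noteq> {}" if "B \<in> ran" "C \<in> ran" for B C using that by (auto simp: ran_def)
  have Tdom: "?T \<subseteq> dom" using x by (auto simp: dom_def)
  have "card (fam s (big 3 \<union> ?T) ?T {}) \<le> card (fam s (big 3 \<union> ?S) ?S {})"
  proof (rule card_inj_on_le)
    have Fdom: "F \<subseteq> dom" if "F \<in> fam s (big 3 \<union> ?T) ?T {}" for F
    proof
      fix B assume "B \<in> F"
      moreover have "intersecting F" "?T \<subseteq> F" using that by (simp_all add: fam_def)
      ultimately have "B \<inter> {x, a} \<noteq> {}" "B \<inter> {x, b} \<noteq> {}" "B \<inter> {a, b} \<noteq> {}"
        using intersectingD[of F B "{x, a}"] intersectingD[of F B "{x, b}"] intersectingD[of F B "{a, b}"] by simp_all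
      then show "B \<in> dom" by (auto simp: dom_def)
    qed
    show "inj_on ((`) h) (fam s (big 3 \<union> ?T) ?T {})"
    proof (rule inj_onI)
      fix F G assume FG: "F \<in> fam s (big 3 \<union> ?T) ?T {}" "G \<in> fam s (big 3 \<union> ?T) ?T {}" "h ` F = h ` G"
      then show "F = G" using inj_on_image_eq_iff[OF inj Fdom[OF FG(1)] Fdom[OF FG(2)]] by simp
    qed
    show "(`) h ` fam s (big 3 \<union> ?T) ?T {} \<subseteq> fam s (big 3 \<union> ?S) ?S {}"
    proof (rule image_subsetI)
      fix F assume F: "F \<in> fam s (big 3 \<union> ?T) ?T {}"
      note Fd = Fdom[OF F]
      have FA: "F \<subseteq> big 3 \<union> ?T" "card F = s" "?T \<subseteq> F" using F by (auto simp: fam_def)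
      have "h B \<in> big 3 \<union> ?S" if "B \<in> F" for B
      proof (cases "B \<in> ?T")
        case True
        then have "h B \<in> h ` ?T" by (rule imageI)
        then show ?thesis unfolding hT by (rule UnI2)
      next
        case False
        then have "B \<in> big 3" using FA(1) that by blast
        then have "B \<subseteq> V" "3 \<le> card B" by (auto simp: big_def)
        then have "h B \<in> big 3" using hV[of B] hcard[of B] Fd that finite_subset[OF _ finV, of B]
          by (auto simp: big_def)
        then show ?thesis by blast
      qed
      moreover have "card (h ` F) = s" using card_image[OF inj_on_subset[OF inj Fd]] FA(2) by simp
      moreover have "intersecting (h ` F)" unfolding intersecting_def using ranint hran Fd by blast
      moreover have "?S \<subseteq> h ` F" unfolding hT[symmetric] by (rule image_mono[OF FA(3)])
      ultimately show "h ` F \<in> fam s (big 3 \<union> ?S) ?S {}" unfolding fam_def by blast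
    qed
    show "finite (fam s (big 3 \<union> ?S) ?S {})" by (rule finite_fam_big) simp
  qed
  then show ?thesis by (simp add: trace_count_def)
qed

text \<open>An intersecting graph lies in a star or is a triangle, and a triangle loses to a star
  with three edges.\<close>

lemma trace_count_le_star:
  assumes K: "K \<subseteq> edges" and K': "K' \<subseteq> star c" "card K = card K'" "c \<in> V"
  shows "trace_count K \<le> trace_count K'"
proof (cases "intersecting K")
  case False
  then show ?thesis by (simp add: trace_count_def fam_eq_0)
next
  case True
  have "(\<exists>x. \<forall>e\<in>K. x \<in> e) \<or> (\<exists>x a b. x \<noteq> a \<and> x \<noteq> b \<and> a \<noteq> b \<and> K = {{x, a}, {x, b}, {a, b}})"
    by (rule intersecting_graph[OF _ True]) (use K in \<open>auto simp: edges_def\<close>)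
  then show ?thesis
  proof
    assume "\<exists>x. \<forall>e\<in>K. x \<in> e"
    then obtain x where x: "\<forall>e\<in>K. x \<in> e" by blast
    have "\<exists>z. z \<in> V \<and> K \<subseteq> star z"
    proof (cases "K = {}")
      case False
      then have "x \<in> V" using x K by (auto simp: edges_def)
      then show ?thesis using x K by (auto simp: star_def)
    qed (use K' in auto)
    then show ?thesis using trace_count_star[OF _ K'(1,2) _ K'(3)] by force
  next
    assume "\<exists>x a b. x \<noteq> a \<and> x \<noteq> b \<and> a \<noteq> b \<and> K = {{x, a}, {x, b}, {a, b}}"
    then obtain x a b where t: "x \<noteq> a" "x \<noteq> b" "a \<noteq> b" "K = {{x, a}, {x, b}, {a, b}}" by blast
    then have V: "x \<in> V" "a \<in> V" "b \<in> V" using K by (auto simp: edges_def)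
    have "card {x, a, b} < card V" using V21 by (auto simp: card_insert_if)
    then have "V - {x, a, b} \<noteq> {}" by (metis Diff_eq_empty_iff card_mono finite.emptyI finite_insert not_le)
    then obtain y where y: "y \<in> V" "y \<notin> {x, a, b}" by blast
    let ?S = "{{y, x}, {y, a}, {y, b}}"
    have "?S \<subseteq> star y" using y V by (auto simp: star_def edges_def)
    moreover have "card ?S = card K" using t y by (auto simp: card_insert_if doubleton_eq_iff)
    ultimately have "trace_count ?S = trace_count K'" using trace_count_star[OF _ K'(1) _ y(1) K'(3)] K'(2) by simp
    then show ?thesis using trace_count_triangle[OF V t(1-3) y] t(4) by simp
  qed
qed

lemma num_by_traces:
  assumes G: "G \<subseteq> edges"
  shows "card (fam s (big 3 \<union> G) {} {}) = (\<Sum>K\<in>Pow G. trace_count K)"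
proof -
  let ?F = "fam s (big 3 \<union> G) {} {}"
  have fG: "finite G" using G finite_edges by (rule finite_subset)
  have disj: "big 3 \<inter> G = {}" using G by (auto simp: big_def edges_def)
  have "card ?F = (\<Sum>K\<in>Pow G. card {F \<in> ?F. F \<inter> G = K})"
  proof -
    have "?F = (\<Union>K\<in>Pow G. {F \<in> ?F. F \<inter> G = K})" (is "_ = ?U")
    proof
      show "?F \<subseteq> ?U"
      proof
        fix F assume "F \<in> ?F"
        then show "F \<in> ?U" by (intro UN_I[of "F \<inter> G"]) auto
      qed
    qed blast
    then have "card ?F = card (\<Union>K\<in>Pow G. {F \<in> ?F. F \<inter> G = K})" by simp
    also have "\<dots> = (\<Sum>K\<in>Pow G. card {F \<in> ?F. F \<inter> G = K})"
      by (rule card_UN_disjoint) (use fG finite_fam_big[OF fG] in auto)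
    finally show ?thesis .
  qed
  also have "\<dots> = (\<Sum>K\<in>Pow G. trace_count K)"
  proof (rule sum.cong[OF refl])
    fix K assume "K \<in> Pow G"
    then have "{F \<in> ?F. F \<inter> G = K} = fam s (big 3 \<union> K) K {}" using disj by (auto simp: fam_def)
    then show "card {F \<in> ?F. F \<inter> G = K} = trace_count K" by (simp add: trace_count_def)
  qed
  finally show ?thesis .
qed

lemma trace_count_pair_pos:
  assumes "K \<subseteq> star c" "c \<in> V" "card K = 2"
  shows "0 < trace_count K"
proof -
  obtain e f where ef: "K = {e, f}" "e \<noteq> f" using assms(3) by (meson card_2_iff)
  obtain a b where ab: "e = {c, a}" "a \<in> V - {c}" "f = {c, b}" "b \<in> V - {c}"
    using assms(1) ef(1) star_eq[OF assms(2)] by auto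
  have "fam s (big 3 \<union> K) K {} \<noteq> {}" unfolding ef(1) ab(1,3)
    by (rule exact_two_edges) (use ab ef assms(2) in auto)
  moreover have "finite (fam s (big 3 \<union> K) K {})" by (rule finite_fam_big) (simp add: ef(1))
  ultimately show ?thesis by (simp add: trace_count_def card_gt_0_iff)
qed

lemma star_graph_unique:
  assumes G: "G \<subseteq> edges" "card G = card V - 1" "intersecting G"
  shows "\<exists>x\<in>V. G = star x"
proof -
  have "(\<exists>x. \<forall>e\<in>G. x \<in> e) \<or> (\<exists>x a b. x \<noteq> a \<and> x \<noteq> b \<and> a \<noteq> b \<and> G = {{x, a}, {x, b}, {a, b}})"
    by (rule intersecting_graph[OF _ G(3)]) (use G(1) in \<open>auto simp: edges_def\<close>)
  then show ?thesis
  proof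
    assume "\<exists>x. \<forall>e\<in>G. x \<in> e"
    then obtain x where x: "\<forall>e\<in>G. x \<in> e" by blast
    have "G \<noteq> {}" using G(2) V21 by auto
    then have xV: "x \<in> V" using x G(1) by (auto simp: edges_def)
    have "G \<subseteq> star x" using x G(1) by (auto simp: star_def)
    then have "G = star x" using card_seteq[of "star x" G] G(2) card_star[OF xV] finite_edges
      by (simp add: star_def)
    then show ?thesis using xV by blast
  next
    assume "\<exists>x a b. x \<noteq> a \<and> x \<noteq> b \<and> a \<noteq> b \<and> G = {{x, a}, {x, b}, {a, b}}"
    then obtain x a b where "G = {{x, a}, {x, b}, {a, b}}" by blast
    then have "card G \<le> 3" by (auto simp: card_insert_if)
    then show ?thesis using G(2) V21 by simp
  qed
qed

text \<open>A bijection of edges compares the trace counts of \<open>K\<close> and of its image in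
  the star, set by set. Two disjoint edges have trace count 0, while their image has a positive
  one.\<close>

lemma star_graph_best:
  assumes G: "G \<subseteq> edges" "card G = card V - 1" and n: "\<not> (\<exists>x\<in>V. G = star x)" and c: "c \<in> V"
  shows "card (fam s (big 3 \<union> G) {} {}) < card (fam s (big 3 \<union> star c) {} {})"
proof -
  have fG: "finite G" using G finite_edges by (auto intro: finite_subset)
  have fS: "finite (star c)" using finite_edges by (simp add: star_def)
  obtain h where h: "bij_betw h G (star c)"
    using finite_same_card_bij[OF fG fS] G(2) card_star[OF c] by auto
  have hinj: "inj_on h G" and him: "h ` G = star c" using h by (auto simp: bij_betw_def)
  have hK: "h ` K \<subseteq> star c" "card K = card (h ` K)" if "K \<subseteq> G" for K
    using that him card_image[OF inj_on_subset[OF hinj that]] by auto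
  obtain e f where ef: "e \<in> G" "f \<in> G" "e \<inter> f = {}"
    using n star_graph_unique[OF G] by (auto simp: intersecting_def)
  have "e \<noteq> f" using ef G(1) by (auto simp: edges_def)
  have "card (fam s (big 3 \<union> G) {} {}) = (\<Sum>K\<in>Pow G. trace_count K)" by (rule num_by_traces[OF G(1)])
  also have "\<dots> < (\<Sum>K\<in>Pow G. trace_count (h ` K))"
  proof (rule sum_strict_mono_ex1)
    show "finite (Pow G)" using fG by simp
    show "\<forall>K\<in>Pow G. trace_count K \<le> trace_count (h ` K)"
    proof
      fix K assume "K \<in> Pow G"
      then have "K \<subseteq> G" by simp
      then show "trace_count K \<le> trace_count (h ` K)"
        using trace_count_le_star[OF _ hK[OF \<open>K \<subseteq> G\<close>] c] G(1) by blast
    qed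
    have "{e, f} \<subseteq> G" using ef by simp
    note hef = hK[OF this]
    have "\<not> intersecting {e, f}" using ef(3) unfolding intersecting_def by blast
    then have "trace_count {e, f} = 0" by (simp add: trace_count_def fam_eq_0)
    moreover have "0 < trace_count (h ` {e, f})"
      by (rule trace_count_pair_pos[OF hef(1) c]) (use hef(2) \<open>e \<noteq> f\<close> in simp)
    ultimately show "\<exists>K\<in>Pow G. trace_count K < trace_count (h ` K)"
      by (intro bexI[of _ "{e, f}"]) (use ef in auto)
  qed
  also have "\<dots> = (\<Sum>K\<in>Pow (star c). trace_count K)"
    using sum.reindex_bij_betw[OF bij_betw_Pow[OF h], of trace_count] by simp
  also have "\<dots> = card (fam s (big 3 \<union> star c) {} {})"
    by (rule num_by_traces[symmetric]) (auto simp: star_def)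
  finally show ?thesis .
qed

end

section \<open>Families missing few pairs\<close>

lemma six_choose3: "6 * (N choose 3) = N * (N - 1) * (N - 2)"
proof (cases "N < 3")
  case True
  then have "N = 0 \<or> N = 1 \<or> N = 2" by auto
  then show ?thesis by (auto simp: binomial_eq_0)
next
  case False
  then obtain m where m: "N = Suc (Suc (Suc m))" by (metis add.commute le_Suc_ex not_less numeral_3_eq_3 plus_nat.simps)
  have "3 * (N choose 3) = N * ((N - 1) choose 2)" "2 * ((N - 1) choose 2) = (N - 1) * (N - 2)"
    using binomial_absorption[of 2 "N"] binomial_absorption[of 1 "N - 1"] unfolding m
    by (simp_all add: numeral_2_eq_2 numeral_3_eq_3)
  then have "6 * (N choose 3) = N * ((N - 1) * (N - 2))" by (metis mult.assoc mult.left_commute mult_2 numeral_Bit0 num_double numeral_times_numeral)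
  then show ?thesis by simp
qed

context bounded_ground begin

lemma core_count_star:
  assumes "K \<subseteq> star x" "K' \<subseteq> star x'" "card K = card K'" "x \<in> V" "x' \<in> V"
  shows "card (fam s (big 2) K {}) = card (fam s (big 2) K' {})"
proof -
  obtain p where p: "p permutes V" "(`) p ` K = K'" using star_transport[OF assms] .
  then show ?thesis using fam_perm_big[OF p(1), of 2 "{}" K] by simp
qed

text \<open>The edge \<open>{y, z}\<close> is itself a member, so restricting to sets that meet it
  loses nothing and makes the collection anchored.\<close>

lemma third_edge:
  assumes x: "y \<in> V" "z \<in> V" "b \<in> V" "c \<in> V" "y \<noteq> z" "b \<notin> {y, z}" "c \<notin> {y, z, b}"
  shows "real ((card V - 5) * (card V - 6)) / 2 * real (card (fam s (big 2) {{y, c}, {y, z}, {y, b}} {}))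
    \<le> real (card (fam s (big 2) {{y, z}, {y, b}} {}))"
proof -
  let ?A = "{B \<in> big 2. B \<inter> {y, z} \<noteq> {}}"
  have "anchored ?A y z 2"
    unfolding anchored_def
  proof (intro conjI allI ballI impI)
    fix B assume B: "B \<subseteq> V \<and> y \<in> B \<and> z \<notin> B \<and> 2 \<le> card B \<and> card B \<le> 5"
    then show "B \<in> ?A" by (auto simp: big_def)
    have "card (V - B) = card V - card B" using B finV by (meson card_Diff_subset finite_subset)
    moreover have "card B \<le> 5" using B by blast
    ultimately have "2 \<le> card (V - B)" using V21 by linarith
    then show "V - B \<in> ?A" using B x(2) by (auto simp: big_def)
  next
    fix B assume B: "B \<in> ?A" "card B \<le> 5 \<and> z \<notin> B"
    then show "y \<in> B" "2 \<le> card B" by (auto simp: big_def)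
  qed (use x in \<open>auto simp: big_def\<close>)
  moreover have "fam s ?A K {} = fam s (big 2) K {}" if K: "{y, z} \<in> K" for K
  proof
    show "fam s (big 2) K {} \<subseteq> fam s ?A K {}"
    proof
      fix F assume F: "F \<in> fam s (big 2) K {}"
      then have "intersecting F" "{y, z} \<in> F" using K by (auto simp: fam_def)
      then have "B \<inter> {y, z} \<noteq> {}" if "B \<in> F" for B using intersectingD[of F B "{y, z}"] that by blast
      then show "F \<in> fam s ?A K {}" using F by (auto simp: fam_def)
    qed
  qed (auto simp: fam_def)
  ultimately show ?thesis using rare_third_edge[of ?A y z b c] x by simp
qed

lemma avoid_plus_hits:
  assumes "finite A"
  shows "card (fam s (A - H) {} {}) + card {F \<in> fam s A {} {}. F \<inter> H \<noteq> {}} = card (fam s A {} {})"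
proof -
  have "fam s A {} {} = fam s (A - H) {} {} \<union> {F \<in> fam s A {} {}. F \<inter> H \<noteq> {}}"
    by (auto simp: fam_def)
  moreover have "fam s (A - H) {} {} \<inter> {F \<in> fam s A {} {}. F \<inter> H \<noteq> {}} = {}" by (auto simp: fam_def)
  moreover have "finite (fam s A {} {})" by (rule finite_fam[OF assms])
  ultimately show ?thesis by (metis (no_types, lifting) card_Un_disjoint finite_Un)
qed

lemma hits_sum:
  assumes "finite A" "finite H"
  shows "card {F \<in> fam s A {} {}. F \<inter> H \<noteq> {}} = (\<Sum>F\<in>fam s A {} {}. if card (F \<inter> H) = 0 then 0 else 1)"
proof -
  have "card {F \<in> fam s A {} {}. F \<inter> H \<noteq> {}} = (\<Sum>F\<in>fam s A {} {}. if F \<inter> H \<noteq> {} then 1 else 0)"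
    by (rule card_filter_sum[OF finite_fam[OF assms(1)]])
  also have "\<dots> = (\<Sum>F\<in>fam s A {} {}. if card (F \<inter> H) = 0 then 0 else 1)"
    using assms(2) by (intro sum.cong) auto
  finally show ?thesis .
qed

lemma hits_lower:
  assumes A: "finite A" "finite H"
  shows "(\<Sum>K\<in>{K. K \<subseteq> H \<and> card K = 1}. card (fam s A K {}))
    \<le> card {F \<in> fam s A {} {}. F \<inter> H \<noteq> {}} + (\<Sum>K\<in>{K. K \<subseteq> H \<and> card K = 2}. card (fam s A K {}))"
  unfolding sum_fam_subsets[OF A] hits_sum[OF A] sum.distrib[symmetric]
  by (rule sum_mono) (simp only: choose_one bonferroni_lower)

lemma hits_upper:
  assumes A: "finite A" "finite H"
  shows "card {F \<in> fam s A {} {}. F \<inter> H \<noteq> {}} + (\<Sum>K\<in>{K. K \<subseteq> H \<and> card K = 2}. card (fam s A K {}))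
    \<le> (\<Sum>K\<in>{K. K \<subseteq> H \<and> card K = 1}. card (fam s A K {})) + (\<Sum>K\<in>{K. K \<subseteq> H \<and> card K = 3}. card (fam s A K {}))"
  unfolding sum_fam_subsets[OF A] hits_sum[OF A] sum.distrib[symmetric]
  by (rule sum_mono) (simp only: choose_one bonferroni_upper)

text \<open>\<open>H\<close> is the set of removed edges, so the fewest families should hit it.
  Bonferroni is used up to order two for \<open>H\<close> and up to order three for the star. The
  linear terms agree; each of the at least \<open>n - 6\<close> disjoint pairs in \<open>H\<close>
  costs one \<open>c2\<close>; the error of the star is \<open>((n - 1) choose 3) * c3\<close>, and
  \<open>third_edge\<close> bounds \<open>c3\<close> by
  \<open>2 * c2 / ((n - 5) * (n - 6))\<close>.\<close>

lemma star_defect_best: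
  assumes H: "H \<subseteq> edges" "card H = card V - 1" and n: "\<not> (\<exists>x\<in>V. H = star x)" and c: "c \<in> V"
  shows "card (fam s (big 2 - H) {} {}) < card (fam s (big 2 - star c) {} {})"
proof -
  let ?c = "\<lambda>K. card (fam s (big 2) K {})"
  let ?hit = "\<lambda>H. card {F \<in> fam s (big 2) {} {}. F \<inter> H \<noteq> {}}"
  let ?sub = "\<lambda>H j. {K. K \<subseteq> H \<and> card K = j}"
  have fH: "finite H" using H(1) finite_edges by (rule finite_subset)
  have fS: "finite (star c)" using finite_edges by (simp add: star_def)
  obtain L where L: "L \<subseteq> V - {c}" "card L = 3"
    by (rule obtain_subset_with_card_n[of 3 "V - {c}"]) (use c V21 in auto)
  then obtain z b d where zbd: "L = {z, b, d}" "z \<noteq> b" "z \<noteq> d" "b \<noteq> d"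
    by (metis card_3_iff)
  have zV: "z \<in> V" "b \<in> V" "d \<in> V" "c \<noteq> z" "b \<notin> {c, z}" "d \<notin> {c, z, b}" using L(1) zbd by auto
  let ?K1 = "{{c, z}}" and ?K2 = "{{c, z}, {c, b}}" and ?K3 = "{{c, d}, {c, z}, {c, b}}"
  have Kst: "?K1 \<subseteq> star c" "?K2 \<subseteq> star c" "?K3 \<subseteq> star c" using zV c by (auto simp: star_def edges_def)
  have cK: "card ?K1 = 1" "card ?K2 = 2" "card ?K3 = 3" using zbd zV by (auto simp: card_insert_if doubleton_eq_iff)
  define c1 c2 c3 where "c1 = ?c ?K1" and "c2 = ?c ?K2" and "c3 = ?c ?K3"
  have inst: "?c K = ?c K'" if "K \<subseteq> star x" "x \<in> V" "K' \<subseteq> star c" "card K = card K'" for K K' x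
    by (rule core_count_star[OF that(1,3,4,2) c])
  have e1: "?c K = c1" if K: "K \<subseteq> edges" "card K = 1" for K
  proof -
    obtain e where e: "K = {e}" using K(2) by (metis card_1_singletonE)
    then have "e \<noteq> {}" "e \<subseteq> V" "e \<in> edges" using K(1) by (auto simp: edges_def)
    then obtain x where "x \<in> e" "x \<in> V" by blast
    then show ?thesis unfolding c1_def using inst[of K x ?K1] cK(1) K(2) e \<open>e \<in> edges\<close> Kst(1) by (simp add: star_def)
  qed
  have e2: "?c K = (if intersecting K then c2 else 0)" if K: "K \<subseteq> edges" "card K = 2" for K
  proof (cases "intersecting K")
    case True
    obtain e f where ef: "K = {e, f}" using K(2) by (meson card_2_iff)
    then obtain x where x: "x \<in> e" "x \<in> f" using intersectingD[OF True, of e f] by blast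
    then have "x \<in> V" "K \<subseteq> star x" using K(1) ef by (auto simp: star_def edges_def)
    then show ?thesis unfolding c2_def using inst[of K x ?K2] cK(2) K(2) Kst(2) True by simp
  qed (simp add: fam_eq_0)
  have sumH1: "(\<Sum>K\<in>?sub H 1. ?c K) = (card V - 1) * c1"
  proof -
    have "(\<Sum>K\<in>?sub H 1. ?c K) = (\<Sum>K\<in>?sub H 1. c1)" by (intro sum.cong refl e1) (use H(1) in auto)
    also have "\<dots> = (card H choose 1) * c1" using n_subsets[OF fH] by simp
    finally show ?thesis using H(2) by simp
  qed
  define disj where "disj = card {K. K \<subseteq> H \<and> card K = 2 \<and> \<not> intersecting K}"
  have sumH2: "(\<Sum>K\<in>?sub H 2. ?c K) + disj * c2 = ((card V - 1) choose 2) * c2"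
  proof -
    have "(\<Sum>K\<in>?sub H 2. ?c K) = (\<Sum>K\<in>?sub H 2. if intersecting K then c2 else 0)"
      by (intro sum.cong refl e2) (use H(1) in auto)
    also have "\<dots> = (\<Sum>K\<in>{K \<in> ?sub H 2. intersecting K}. c2)" by (rule sum.inter_filter[symmetric]) (use fH in simp)
    also have "\<dots> = card {K \<in> ?sub H 2. intersecting K} * c2" by simp
    finally have 1: "(\<Sum>K\<in>?sub H 2. ?c K) = card {K \<in> ?sub H 2. intersecting K} * c2" .
    have "?sub H 2 = {K \<in> ?sub H 2. intersecting K} \<union> {K. K \<subseteq> H \<and> card K = 2 \<and> \<not> intersecting K}" by blast
    then have "card (?sub H 2) = card ({K \<in> ?sub H 2. intersecting K} \<union> {K. K \<subseteq> H \<and> card K = 2 \<and> \<not> intersecting K})"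
      by (rule arg_cong)
    also have "\<dots> = card {K \<in> ?sub H 2. intersecting K} + disj"
      unfolding disj_def by (rule card_Un_disjoint) (use fH in auto)
    finally have "card {K \<in> ?sub H 2. intersecting K} + disj = (card V - 1) choose 2"
      using n_subsets[OF fH, of 2] H(2) by simp
    then show ?thesis unfolding 1 by (metis add_mult_distrib)
  qed
  have sumS: "(\<Sum>K\<in>?sub (star c) j. ?c K) = ((card V - 1) choose j) * ?c K'" if "K' \<subseteq> star c" "card K' = j" for j K'
  proof -
    have "(\<Sum>K\<in>?sub (star c) j. ?c K) = (\<Sum>K\<in>?sub (star c) j. ?c K')"
      by (intro sum.cong refl inst) (use c that in auto)
    then show ?thesis using n_subsets[OF fS, of j] card_star[OF c] by simp
  qed
  have S1: "(\<Sum>K\<in>?sub (star c) 1. ?c K) = (card V - 1) * c1" using sumS[OF Kst(1) cK(1)] by (simp add: c1_def)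
  have S2: "(\<Sum>K\<in>?sub (star c) 2. ?c K) = ((card V - 1) choose 2) * c2" using sumS[OF Kst(2) cK(2)] by (simp add: c2_def)
  have S3: "(\<Sum>K\<in>?sub (star c) 3. ?c K) = ((card V - 1) choose 3) * c3" using sumS[OF Kst(3) cK(3)] by (simp add: c3_def)
  have "(card V - 1) * c1 + disj * c2 \<le> ?hit H + ((card V - 1) choose 2) * c2"
    using hits_lower[OF finite_big fH, of 2] sumH1 sumH2 by simp
  moreover have "?hit (star c) + ((card V - 1) choose 2) * c2 \<le> (card V - 1) * c1 + ((card V - 1) choose 3) * c3"
    using hits_upper[OF finite_big fS, of 2] S1 S2 S3 by simp
  ultimately have key: "?hit (star c) + disj * c2 \<le> ?hit H + ((card V - 1) choose 3) * c3" by simp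
  have disj: "card V - 1 \<le> disj + 5" unfolding disj_def
  proof (subst H(2)[symmetric], rule many_disjoint_pairs[OF fH])
    show "\<not> intersecting H" using n star_graph_unique[OF H] by blast
  qed (use H(1) in \<open>auto simp: edges_def\<close>)
  have c2pos: "0 < c2"
  proof -
    have "fam s (big 3 \<union> ?K2) ?K2 {} \<subseteq> fam s (big 2) ?K2 {}"
    proof -
      have "big 3 \<union> ?K2 \<subseteq> big 2" using zV c by (auto simp: big_def)
      then show ?thesis by (auto simp: fam_def)
    qed
    moreover have "fam s (big 3 \<union> ?K2) ?K2 {} \<noteq> {}" by (rule exact_two_edges) (use zV c in auto)
    moreover have "finite (fam s (big 2) ?K2 {})" by (rule finite_fam[OF finite_big])
    ultimately show ?thesis unfolding c2_def by (metis card_gt_0_iff subset_empty)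
  qed
  have c3: "real ((card V - 5) * (card V - 6)) / 2 * real c3 \<le> real c2"
    unfolding c2_def c3_def by (rule third_edge) (use zV c in auto)
  have "((card V - 1) choose 3) * c3 < disj * c2"
  proof -
    obtain m where m: "card V = m + 21" using V21 by (metis add.commute le_Suc_ex)
    define r where "r = real m"
    have r: "r \<ge> 0" by (simp add: r_def)
    have d: "real disj \<ge> r + 15" using disj m by (simp add: r_def)
    have V1: "card V - 1 = m + 20" using m by simp
    have "6 * ((card V - 1) choose 3) = (m + 20) * (m + 19) * (m + 18)"
      unfolding V1 using six_choose3[of "m + 20"] by (simp add: add.commute)
    then have C3: "6 * real ((card V - 1) choose 3) = (r + 20) * (r + 19) * (r + 18)"
      by (metis (no_types, lifting) of_nat_add of_nat_mult of_nat_numeral r_def)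
    have c3': "(r + 16) * (r + 15) / 2 * real c3 \<le> real c2" using c3 m by (simp add: r_def algebra_simps)
    have "real (((card V - 1) choose 3) * c3) < real (disj * c2)"
    proof (cases "c3 = 0")
      case True
      then show ?thesis using c2pos d r by simp
    next
      case False
      \<comment> \<open>In terms of \<open>n = r + 21\<close> this is
        \<open>(n - 1) * (n - 2) * (n - 3) < 3 * (n - 6)^2 * (n - 5)\<close>.\<close>
      have "(r + 20) * (r + 19) * (r + 18) < 3 * (r + 15) * ((r + 16) * (r + 15))"
        using r by (simp add: algebra_simps) (smt (verit) mult_nonneg_nonneg)
      moreover have "3 * (r + 15) * ((r + 16) * (r + 15)) = 6 * ((r + 15) * ((r + 16) * (r + 15) / 2))" by simp
      ultimately have "real ((card V - 1) choose 3) < (r + 15) * ((r + 16) * (r + 15) / 2)" using C3 by linarith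
      then have "real ((card V - 1) choose 3) * real c3 < (r + 15) * ((r + 16) * (r + 15) / 2) * real c3"
        using False by (intro mult_strict_right_mono) auto
      also have "\<dots> = (r + 15) * ((r + 16) * (r + 15) / 2 * real c3)" by simp
      also have "\<dots> \<le> (r + 15) * real c2" using c3' r by (intro mult_left_mono) auto
      also have "\<dots> \<le> real disj * real c2" using d by (intro mult_right_mono) auto
      finally show ?thesis by simp
    qed
    then show ?thesis by (simp only: of_nat_less_iff)
  qed
  then have "?hit (star c) < ?hit H" using key by simp
  then show ?thesis using avoid_plus_hits[OF finite_big, of 2 H] avoid_plus_hits[OF finite_big, of 2 "star c"] by simp
qed

end

section \<open>Families missing triples\<close>

locale flag = bounded_ground +
  fixes x y z :: 'a
  assumes xyz: "x \<in> V" "y \<in> V" "z \<in> V" "x \<noteq> y" "x \<noteq> z" "y \<noteq> z"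

context bounded_ground begin

text \<open>The pool consists of the sets that can occur in a family in which the triple \<open>T\<close> is a substitute for
  the edge \<open>Y \<subseteq> T\<close>. A marker in such a family stands for a further member of the original family.\<close>

definition pool :: "'a set \<Rightarrow> 'a set \<Rightarrow> 'a set set" where
  "pool T Y = {B. B \<subseteq> V \<and> 3 \<le> card B \<and> (B \<inter> Y = {} \<longrightarrow> card V - 4 \<le> card B) \<and> (Y \<subseteq> B \<and> card B = 3 \<longrightarrow> B = T)}"

definition markers :: "'a set \<Rightarrow> 'a set set" where
  "markers Y = {B. B \<subseteq> V - Y \<and> card B = card V - 4}"

text \<open>In a family containing \<open>Y\<close>, no member is the complement of \<open>Y\<close> or of a triple containing \<open>Y\<close>,
  so these complements can encode the triples that lie above \<open>Y\<close>.\<close>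

definition exchange :: "'a set \<Rightarrow> 'a set \<Rightarrow> 'a set \<Rightarrow> 'a set" where
  "exchange T Y B = (if B = Y then T else if Y \<subseteq> B \<and> card B = 3 then V - (if B = T then Y else B) else B)"

lemma finite_pool: "finite (pool T Y)"
  using finV by (auto simp: pool_def intro: finite_subset[of _ "Pow V"])

lemma card_compl: "B \<subseteq> V \<Longrightarrow> card (V - B) = card V - card B"
  using finV by (meson card_Diff_subset finite_subset)

end

context flag begin

abbreviation "T \<equiv> {x, y, z}"
abbreviation "Y \<equiv> {y, z}"

lemma card_TY: "card T = 3" "card Y = 2" "T \<subseteq> V" "Y \<subseteq> V"
  using xyz by (auto simp: card_insert_if)

lemma TY: "T \<noteq> Y" "Y \<subseteq> T"
  using xyz by auto

lemma flag_swap: "flag V s x z y"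
  using xyz by unfold_locales auto

section \<open>Exchanging an edge for a triple\<close>

text \<open>Pool members disjoint from \<open>Y\<close> have at least \<open>card V - 4\<close>
  elements, so a small one without \<open>z\<close> contains \<open>y\<close>. Removing the markers
  does no harm: they avoid \<open>Y\<close>, whereas a small set containing \<open>y\<close> but not
  \<open>z\<close> meets \<open>Y\<close>, and so does its complement.\<close>

lemma anchored_pool: "anchored (pool T Y) y z 3" and anchored_pool': "anchored (pool T Y - markers Y) y z 3"
proof -
  have i: "B \<in> pool T Y" "V - B \<in> pool T Y" "B \<notin> markers Y" "V - B \<notin> markers Y"
    if B: "B \<subseteq> V" "y \<in> B" "z \<notin> B" "3 \<le> card B" "card B \<le> 5" for B
  proof -
    show "B \<in> pool T Y" "B \<notin> markers Y" "V - B \<notin> markers Y" using B xyz by (auto simp: pool_def markers_def)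
    have c: "card (V - B) = card V - card B" using card_compl[OF B(1)] .
    then have "3 \<le> card (V - B)" using B(5) V21 by linarith
    then show "V - B \<in> pool T Y" using B xyz by (auto simp: pool_def)
  qed
  have o: "y \<in> B \<and> 3 \<le> card B" if "B \<in> pool T Y" "card B \<le> 5" "z \<notin> B" for B
  proof -
    have "\<not> card V - 4 \<le> card B" using that(2) V21 by linarith
    then show ?thesis using that by (auto simp: pool_def)
  qed
  have sub: "pool T Y \<subseteq> Pow V" by (auto simp: pool_def)
  show "anchored (pool T Y) y z 3" unfolding anchored_def
  proof (intro conjI allI ballI impI)
    fix B assume B: "B \<subseteq> V \<and> y \<in> B \<and> z \<notin> B \<and> 3 \<le> card B \<and> card B \<le> 5"
    then show "B \<in> pool T Y" "V - B \<in> pool T Y" using i[of B] by simp_all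
  next
    fix B assume "B \<in> pool T Y" "card B \<le> 5 \<and> z \<notin> B"
    then show "y \<in> B" "3 \<le> card B" using o[of B] by simp_all
  qed (use sub xyz in simp_all)
  show "anchored (pool T Y - markers Y) y z 3" unfolding anchored_def
  proof (intro conjI allI ballI impI)
    fix B assume B: "B \<subseteq> V \<and> y \<in> B \<and> z \<notin> B \<and> 3 \<le> card B \<and> card B \<le> 5"
    then show "B \<in> pool T Y - markers Y" "V - B \<in> pool T Y - markers Y" using i[of B] by simp_all
  next
    fix B assume "B \<in> pool T Y - markers Y" "card B \<le> 5 \<and> z \<notin> B"
    then show "y \<in> B" "3 \<le> card B" using o[of B] by simp_all
  qed (use sub xyz in auto)
qed

text \<open>The arguments meet \<open>Y\<close>, so an image disjoint from \<open>Y\<close> has to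
  be a complement, and \<open>T\<close> can only stand for \<open>Y\<close>.\<close>

lemma exchange_inj: "inj_on (exchange T Y) {B. B \<subseteq> V \<and> B \<inter> Y \<noteq> {}}"
proof (rule inj_on_inverseI)
  fix B assume "B \<in> {B. B \<subseteq> V \<and> B \<inter> Y \<noteq> {}}"
  then have B: "B \<subseteq> V" "B \<inter> Y \<noteq> {}" by auto
  let ?g = "\<lambda>C. if C = T then Y else if C \<inter> Y = {} then (if C = V - Y then T else V - C) else C"
  consider "B = Y" | "B = T" | "B \<noteq> Y" "B \<noteq> T" "Y \<subseteq> B" "card B = 3" | "B \<noteq> Y" "B \<noteq> T" "\<not> (Y \<subseteq> B \<and> card B = 3)" by argo
  then show "?g (exchange T Y B) = B"
  proof cases
    case 1 then show ?thesis by (simp add: exchange_def)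
  next
    case 2
    have "exchange T Y B = V - Y" unfolding exchange_def 2 using card_TY(1) TY by (simp only: if_False if_True simp_thms)
    moreover have "V - Y \<noteq> T" by auto
    ultimately show ?thesis using 2 by simp
  next
    case 3
    have "exchange T Y B = V - B" unfolding exchange_def using 3 by (simp only: if_False if_True simp_thms)
    moreover have d: "(V - B) \<inter> Y = {}" "V - (V - B) = B" using 3(3) B(1) by auto
    moreover have "V - B \<noteq> T" using d(1) by auto
    moreover have "V - B \<noteq> V - Y" using d(2) 3(1) card_TY(4) by (metis double_diff order_refl)
    ultimately show ?thesis by simp
  next
    case 4
    have c: "exchange T Y B = B" unfolding exchange_def using 4 by (simp only: if_False if_True simp_thms)
    show ?thesis unfolding c using 4(2) B(2) by (simp only: if_False)
  qed
qed

lemma exchange_cases: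
  assumes B: "B \<subseteq> V" "B \<inter> Y \<noteq> {}" "B \<in> big 3 \<union> {Y}"
  obtains (apex) "exchange T Y B = T" "B = Y"
    | (compl) X where "exchange T Y B = V - X" "Y \<subseteq> X" "x \<notin> X" "X \<subseteq> V" "card X \<le> 3"
    | (same) "exchange T Y B = B" "3 \<le> card B" "\<not> (Y \<subseteq> B \<and> card B = 3)"
proof -
  consider "B = Y" | "B = T" | "B \<noteq> Y" "B \<noteq> T" "Y \<subseteq> B" "card B = 3" | "B \<noteq> Y" "B \<noteq> T" "\<not> (Y \<subseteq> B \<and> card B = 3)" by argo
  then show thesis
  proof cases
    case 1 then show ?thesis using apex by (simp add: exchange_def)
  next
    case 2
    have e: "exchange T Y B = V - Y" unfolding exchange_def 2 using card_TY(1) TY by (simp only: if_False if_True simp_thms)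
    show ?thesis by (rule compl[OF e]) (use xyz card_TY in auto)
  next
    case 3
    have e: "exchange T Y B = V - B" unfolding exchange_def using 3 by (simp only: if_False if_True simp_thms)
    have "x \<notin> B"
    proof
      assume "x \<in> B"
      then have "T \<subseteq> B" using 3 by simp
      moreover have "finite B" using B(1) finV by (rule finite_subset)
      ultimately have "T = B" using card_seteq[of B T] 3(4) card_TY(1) by simp
      then show False using 3(2) by simp
    qed
    then show ?thesis by (intro compl[OF e]) (use 3 B in auto)
  next
    case 4
    have e: "exchange T Y B = B" unfolding exchange_def using 4 by (simp only: if_False if_True simp_thms)
    show ?thesis by (rule same[OF e]) (use 4 B in \<open>auto simp: big_def\<close>)
  qed
qed

text \<open>An unchanged member meets \<open>Y\<close> and hence \<open>T\<close>; it meets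
  \<open>V - X\<close> for the exchanged \<open>X\<close>, since lying inside such a small
  \<open>X\<close> would make it equal to \<open>X\<close>. The triple \<open>T\<close> meets
  \<open>V - X\<close> in \<open>x\<close>. The complements have at least \<open>card V - 3\<close>
  elements, so they meet each other and are not markers.\<close>

lemma exchange_fam:
  assumes F: "F \<in> fam r (big 3 \<union> {Y}) {Y} {}"
  shows "exchange T Y ` F \<in> fam r (pool T Y - markers Y) {T} {}" "F \<subseteq> {B. B \<subseteq> V \<and> B \<inter> Y \<noteq> {}}"
proof -
  have FA: "F \<subseteq> big 3 \<union> {Y}" "card F = r" "intersecting F" "Y \<in> F" using F by (auto simp: fam_def)
  have FY: "B \<subseteq> V" "B \<inter> Y \<noteq> {}" "B \<in> big 3 \<union> {Y}" if "B \<in> F" for B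
    using that FA card_TY(4) intersectingD[OF FA(3) that FA(4)] by (auto simp: big_def)
  then show sub: "F \<subseteq> {B. B \<subseteq> V \<and> B \<inter> Y \<noteq> {}}" by blast
  have in_pool: "exchange T Y B \<in> pool T Y - markers Y" if B: "B \<in> F" for B
  proof (rule exchange_cases[OF FY[OF B]])
    assume e: "exchange T Y B = T"
    show ?thesis unfolding e using card_TY by (auto simp: pool_def markers_def)
  next
    fix X assume e: "exchange T Y B = V - X" and X: "Y \<subseteq> X" "X \<subseteq> V" "card X \<le> 3"
    have "card (V - X) = card V - card X" using X(2) by (rule card_compl)
    then have "card V - 4 < card (V - X)" "3 \<le> card (V - X)" using X(3) V21 by linarith+
    then show ?thesis unfolding e using X xyz by (auto simp: pool_def markers_def)
  next
    assume e: "exchange T Y B = B" "3 \<le> card B" "\<not> (Y \<subseteq> B \<and> card B = 3)"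
    show ?thesis unfolding e(1) using e(2,3) FY[OF B] by (auto simp: pool_def markers_def)
  qed
  have xV: "card (V - X) = card V - card X" if "X \<subseteq> V" for X using that by (rule card_compl)
  have int: "exchange T Y B \<inter> exchange T Y C \<noteq> {}" if BC: "B \<in> F" "C \<in> F" for B C
  proof -
    have ts: "B \<inter> T \<noteq> {}" if "B \<in> F" for B using FY(2)[OF that] by auto
    have cs: "B \<inter> (V - X) \<noteq> {}" if B: "B \<in> F" "3 \<le> card B" "\<not> (Y \<subseteq> B \<and> card B = 3)"
      and X: "Y \<subseteq> X" "X \<subseteq> V" "card X \<le> 3" for B X
    proof
      assume "B \<inter> (V - X) = {}"
      then have "B \<subseteq> X" using FY(1)[OF B(1)] by blast
      moreover have "finite X" using X(2) finV by (rule finite_subset)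
      moreover have "card X \<le> card B" using X(3) B(2) by simp
      ultimately have "B = X" using card_seteq[of X B] by simp
      then show False using X B by simp
    qed
    have tc: "T \<inter> (V - X) \<noteq> {}" if "x \<notin> X" for X using that xyz by auto
    have cc: "(V - X) \<inter> (V - X') \<noteq> {}" if "X \<subseteq> V" "X' \<subseteq> V" "card X \<le> 3" "card X' \<le> 3" for X X'
      proof
      assume "(V - X) \<inter> (V - X') = {}"
      then have "X \<union> X' = V" using that(1,2) by blast
      then show False using union_small[of X X'] that(3,4) by simp
    qed
    show ?thesis
    proof (rule exchange_cases[OF FY[OF BC(1)]]; rule exchange_cases[OF FY[OF BC(2)]])
      fix X assume "exchange T Y B = T" "exchange T Y C = V - X" "x \<notin> X"
      then show ?thesis using tc by simp
    next
      fix X assume "exchange T Y C = T" "exchange T Y B = V - X" "x \<notin> X"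
      then show ?thesis using tc by (simp add: Int_commute)
    next
      fix X X' assume "exchange T Y B = V - X" "exchange T Y C = V - X'" "X \<subseteq> V" "X' \<subseteq> V" "card X \<le> 3" "card X' \<le> 3"
      then show ?thesis using cc by simp
    next
      assume e: "exchange T Y B = T" "exchange T Y C = C"
      show ?thesis unfolding e using ts[OF BC(2)] by blast
    next
      assume e: "exchange T Y C = T" "exchange T Y B = B"
      show ?thesis unfolding e using ts[OF BC(1)] .
    next
      assume "exchange T Y B = T" "exchange T Y C = T"
      then show ?thesis by (simp only:) blast
    next
      fix X assume e: "exchange T Y B = B" "exchange T Y C = V - X" and h: "3 \<le> card B" "\<not> (Y \<subseteq> B \<and> card B = 3)"
        "Y \<subseteq> X" "X \<subseteq> V" "card X \<le> 3"
      show ?thesis unfolding e using cs[OF BC(1) h] .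
    next
      fix X assume e: "exchange T Y C = C" "exchange T Y B = V - X" and h: "3 \<le> card C" "\<not> (Y \<subseteq> C \<and> card C = 3)"
        "Y \<subseteq> X" "X \<subseteq> V" "card X \<le> 3"
      show ?thesis unfolding e using cs[OF BC(2) h] by (subst Int_commute)
    next
      assume e: "exchange T Y B = B" "exchange T Y C = C"
      show ?thesis unfolding e using intersectingD[OF FA(3) BC] .
    qed
  qed
  have "exchange T Y Y = T" by (simp add: exchange_def)
  then have "T \<in> exchange T Y ` F" using FA(4) by (metis image_eqI)
  moreover have "card (exchange T Y ` F) = r"
    using card_image[OF inj_on_subset[OF exchange_inj sub]] FA(2) by simp
  moreover have "intersecting (exchange T Y ` F)" unfolding intersecting_def using int by blast
  moreover have "exchange T Y ` F \<subseteq> pool T Y - markers Y" using in_pool by blast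
  ultimately show "exchange T Y ` F \<in> fam r (pool T Y - markers Y) {T} {}" by (simp add: fam_def)
qed

text \<open>The exchange produces no markers, so the families with \<open>T\<close> that hit
  \<open>markers Y\<close> remain as a gain.\<close>

lemma edge_le_triple: "trace_count {Y} \<le> card (fam s (pool T Y - markers Y) {T} {})"
  unfolding trace_count_def
proof (rule card_inj_on_le)
  show "inj_on ((`) (exchange T Y)) (fam s (big 3 \<union> {Y}) {Y} {})"
  proof (rule inj_onI)
    fix F G assume FG: "F \<in> fam s (big 3 \<union> {Y}) {Y} {}" "G \<in> fam s (big 3 \<union> {Y}) {Y} {}" "exchange T Y ` F = exchange T Y ` G"
    then show "F = G" using inj_on_image_eq_iff[OF exchange_inj exchange_fam(2)[OF FG(1)] exchange_fam(2)[OF FG(2)]] by blast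
  qed
  show "(`) (exchange T Y) ` fam s (big 3 \<union> {Y}) {Y} {} \<subseteq> fam s (pool T Y - markers Y) {T} {}"
    using exchange_fam(1) by blast
  show "finite (fam s (pool T Y - markers Y) {T} {})" by (rule finite_fam) (simp add: finite_pool)
qed

section \<open>Inserting markers\<close>

definition pairs_off :: "'a set \<Rightarrow> 'a set set" where
  "pairs_off X = {e. e \<subseteq> V - X \<and> card e = 2}"

lemma pairs_off: "finite (pairs_off X)" "X \<subseteq> V \<Longrightarrow> card (pairs_off X) = (card V - card X) choose 2"
proof -
  show "finite (pairs_off X)" using finV by (auto simp: pairs_off_def intro: finite_subset[of _ "Pow V"])
  show "X \<subseteq> V \<Longrightarrow> card (pairs_off X) = (card V - card X) choose 2"
    unfolding pairs_off_def using n_subsets[of "V - X" 2] finV card_compl by simp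
qed

lemma marker:
  assumes e: "e \<subseteq> V - T" "card e = 2"
  shows "V - (Y \<union> e) \<in> markers Y" "x \<in> V - (Y \<union> e)" "V - (Y \<union> e) \<in> pool T Y" "card (Y \<union> e) = 4" "Y \<union> e \<subseteq> V"
proof -
  have "finite e" using e(2) by (metis card.infinite zero_neq_numeral)
  then show c4: "card (Y \<union> e) = 4" using card_Un_disjoint[of Y e] e card_TY(2) by auto
  show sV: "Y \<union> e \<subseteq> V" using e card_TY by auto
  then have c: "card (V - (Y \<union> e)) = card V - 4" using card_compl[OF sV] c4 by simp
  show "V - (Y \<union> e) \<in> markers Y" using c by (auto simp: markers_def)
  show "x \<in> V - (Y \<union> e)" using xyz e by auto
  have "3 \<le> card V - 4" using V21 by linarith
  then show "V - (Y \<union> e) \<in> pool T Y" using c by (auto simp: pool_def)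
qed

text \<open>These three sets are the only possible obstructions to inserting the marker
  \<open>V - (Y \<union> e)\<close>.\<close>

lemma below_marker:
  assumes e: "e \<subseteq> V - T" "card e = 2" and B: "B \<in> big 3" "B \<inter> Y \<noteq> {}" "\<not> (Y \<subseteq> B \<and> card B = 3)" "B \<subseteq> Y \<union> e"
  shows "B = insert y e \<or> B = insert z e \<or> B = Y \<union> e"
proof -
  obtain c d where cd: "e = {c, d}" "c \<noteq> d" using e(2) by (meson card_2_iff)
  have dist: "c \<notin> T" "d \<notin> T" using e(1) cd by auto
  have c3: "3 \<le> card B" using B(1) by (simp add: big_def)
  show ?thesis
  proof (cases "Y \<subseteq> B")
    case True
    have n: "B \<noteq> {y, z, c}" "B \<noteq> {y, z, d}"
      using B(3) True dist xyz by (auto simp: card_insert_if)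
    have sub: "B \<subseteq> {y, z, c, d}" using B(4) cd by auto
    have "c \<in> B"
    proof (rule ccontr)
      assume "c \<notin> B"
      then have "B \<subseteq> {y, z, d}" using sub by blast
      from eq_triple[OF this c3] show False using n(2) by simp
    qed
    moreover have "d \<in> B"
    proof (rule ccontr)
      assume "d \<notin> B"
      then have "B \<subseteq> {y, z, c}" using sub by blast
      from eq_triple[OF this c3] show False using n(1) by simp
    qed
    ultimately have "{y, z, c, d} \<subseteq> B" using True by simp
    then have "B = {y, z, c, d}" using sub by (rule subset_antisym[rotated])
    then show ?thesis using cd by auto
  next
    case False
    then consider "y \<notin> B" | "z \<notin> B" by auto
    then show ?thesis
    proof cases
      case 1
      then have "B \<subseteq> {z, c, d}" using B(4) cd by auto
      from eq_triple[OF this c3] show ?thesis using cd by simp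
    next
      case 2
      then have "B \<subseteq> {y, c, d}" using B(4) cd by auto
      from eq_triple[OF this c3] show ?thesis using cd by simp
    qed
  qed
qed

end

lemma insert_two: "a \<in> F \<Longrightarrow> b \<in> F \<Longrightarrow> insert a (insert b (F - {a, b})) = F"
  by blast

context flag begin

lemma marker_inj:
  assumes "e \<subseteq> V - T" "e' \<subseteq> V - T" "V - (Y \<union> e) = V - (Y \<union> e')"
  shows "e = e'"
proof -
  have "Y \<union> e \<subseteq> V" "Y \<union> e' \<subseteq> V" using assms(1,2) card_TY(4) by auto
  then have "Y \<union> e = Y \<union> e'" using assms(3) by (metis double_diff order_refl)
  moreover have "e = (Y \<union> e) - Y" "e' = (Y \<union> e') - Y" using assms(1,2) by auto
  ultimately show ?thesis by simp
qed

text \<open>The place of \<open>T' = {y, b, b'}\<close> is given to a marker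
  \<open>V - (Y \<union> e)\<close>. If \<open>Y \<union> e\<close> is a member, it is exchanged for
  \<open>V - T'\<close>. The triples \<open>insert y e\<close> and \<open>insert z e\<close> have to
  be absent, which has probability at least \<open>1 - 2 * 2/47 = 43/47\<close> by
  \<open>rare_triple\<close>. The marker reveals \<open>e\<close>, and the presence of
  \<open>V - T'\<close> reveals whether \<open>Y \<union> e\<close> was a member, so pairs of
  \<open>e\<close> and a family are mapped injectively.\<close>

lemma shift_triple:
  assumes b: "b \<in> V" "b' \<in> V" "b \<noteq> b'" "b \<notin> Y" "b' \<notin> Y" and T': "{y, b, b'} \<noteq> T"
  shows "43/47 * (real ((card V - 3) choose 2) - 1) * real (card (fam s (pool T Y - markers Y) {T, {y, b, b'}} {}))
    \<le> real (card (fam s (pool T Y) {T} (markers Y)))"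
proof -
  let ?A = "pool T Y - markers Y"
  define T' where "T' = {y, b, b'}"
  define FB where "FB = fam s ?A {T, T'} {}"
  define GG where "GG = fam s (pool T Y) {T} (markers Y)"
  \<comment> \<open>For \<open>e = {b, b'}\<close> the obstructing triple \<open>insert y e\<close>
    would be \<open>T'\<close> itself, which is always present.\<close>
  define E where "E = pairs_off T - {{b, b'}}"
  define L where "L e = {insert y e, insert z e}" for e
  define h where "h e F = insert (V - (Y \<union> e)) (if Y \<union> e \<in> F then insert (V - T') (F - {T', Y \<union> e}) else F - {T'})" for e F
  have T'V: "T' \<subseteq> V" "card T' = 3" "z \<notin> T'" "T' \<noteq> T" using b xyz T' by (auto simp: T'_def)
  have finA: "finite ?A" by (simp add: finite_pool)
  have fFB: "finite FB" unfolding FB_def by (rule finite_fam[OF finA])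
  have fGG: "finite GG" unfolding GG_def by (rule finite_fam[OF finite_pool])
  have Ee: "e \<subseteq> V - T" "card e = 2" "e \<noteq> {b, b'}" if "e \<in> E" for e using that by (auto simp: E_def pairs_off_def)
  have fE: "finite E" using pairs_off(1) by (simp add: E_def)
  have cE: "real ((card V - 3) choose 2) - 1 \<le> real (card E)"
  proof -
    have "card (pairs_off T) - card {{b, b'}} \<le> card E" unfolding E_def by (rule diff_card_le_card_Diff) simp
    then show ?thesis using pairs_off(2)[OF card_TY(3)] card_TY(1) by simp
  qed
  have often: "43/47 * real (card FB) \<le> real (card {F \<in> FB. F \<inter> L e = {}})" if e: "e \<in> E" for e
  proof -
    obtain c d where cd: "e = {c, d}" "c \<noteq> d" using Ee(2)[OF e] by (meson card_2_iff)
    have cdV: "c \<in> V" "d \<in> V" "c \<notin> Y" "d \<notin> Y" "c \<notin> {z, y}" "d \<notin> {z, y}" using Ee(1)[OF e] cd by auto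
    have ne: "{b, b'} - {c, d} \<noteq> {}"
      using Ee(3)[OF e] cd b(3) card_seteq[of "{c, d}" "{b, b'}"] by auto
    have 1: "47/2 * real (card (fam s ?A (insert {y, c, d} {T, T'}) {})) \<le> real (card (fam s ?A {T, T'} {}))"
    proof (rule rare_triple[OF anchored_pool', where X = "{b, b'} - {c, d}"])
      show "card ({b, b'} - {c, d}) \<le> 2" using card_mono[of "{b, b'}" "{b, b'} - {c, d}"] b(3) by simp
      show "({b, b'} - {c, d}) \<inter> {y, c, d} = {}" using b by auto
      show "\<forall>k\<in>{T, T'}. z \<in> k \<or> k \<inter> ({b, b'} - {c, d}) \<noteq> {}" using ne by (auto simp: T'_def)
    qed (use cdV cd in auto)
    \<comment> \<open>With the roles of \<open>y\<close> and \<open>z\<close> interchanged, both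
      conditioned triples contain the second anchor \<open>y\<close>, so \<open>X\<close> can be
      empty.\<close>
    have a2: "anchored ?A z y 3" using flag.anchored_pool'[OF flag_swap] by (simp add: insert_commute)
    have 2: "47/2 * real (card (fam s ?A (insert {z, c, d} {T, T'}) {})) \<le> real (card (fam s ?A {T, T'} {}))"
      by (rule rare_triple[OF a2, where X = "{}"]) (use cdV cd in \<open>auto simp: T'_def\<close>)
    have "insert y e \<noteq> insert z e" using xyz cdV cd by auto
    then have "(\<Sum>B\<in>L e. card (fam s ?A (insert B {T, T'}) {})) =
        card (fam s ?A (insert {y, c, d} {T, T'}) {}) + card (fam s ?A (insert {z, c, d} {T, T'}) {})"
      using cd by (simp add: L_def)
    moreover have "card FB \<le> card {F \<in> FB. F \<inter> L e = {}} + (\<Sum>B\<in>L e. card (fam s ?A (insert B {T, T'}) {}))"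
      unfolding FB_def by (rule card_avoid[OF finA]) (simp add: L_def)
    ultimately show ?thesis using 1 2 unfolding FB_def by linarith
  qed
  have FBd: "F \<subseteq> ?A" "card F = s" "intersecting F" "T \<in> F" "T' \<in> F" "finite F" "V - T' \<notin> F" if "F \<in> FB" for F
  proof -
    show F: "F \<subseteq> ?A" "card F = s" "intersecting F" "T \<in> F" "T' \<in> F" using that by (auto simp: FB_def fam_def)
    show "finite F" using F(1) finA by (rule finite_subset)
    show "V - T' \<notin> F" using intersectingD[OF F(3,5), of "V - T'"] by blast
  qed
  have cT': "card (V - T') = card V - 3" using card_compl[OF T'V(1)] T'V(2) by simp
  have big: "V - T' \<notin> markers Y" "V - T' \<in> pool T Y"
  proof -
    show "V - T' \<notin> markers Y" using T'V(3) xyz by (auto simp: markers_def)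
    have "3 < card V - 3" using V21 by linarith
    then show "V - T' \<in> pool T Y" unfolding pool_def using cT' V21 by auto
  qed
  have hmem: "h e F \<in> GG" "h e F \<inter> markers Y = {V - (Y \<union> e)}" "V - T' \<in> h e F \<longleftrightarrow> Y \<union> e \<in> F"
    "F = (if V - T' \<in> h e F then insert T' (insert (Y \<union> e) (h e F - {V - T', V - (Y \<union> e)})) else insert T' (h e F - {V - (Y \<union> e)}))"
    if e: "e \<in> E" and F: "F \<in> FB" "F \<inter> L e = {}" for e F
  proof -
    let ?M = "V - (Y \<union> e)"
    note m = marker[OF Ee(1,2)[OF e]] and Fd = FBd[OF F(1)]
    have MF: "?M \<notin> F" using Fd(1) m(1) by blast
    have MT': "?M \<noteq> V - T'" using big(1) m(1) by metis
    have YeT: "Y \<union> e \<noteq> T'" "Y \<union> e \<noteq> T" using m(4) T'V(2) card_TY(1) by auto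
    have "h e F \<inter> markers Y \<subseteq> {?M}" unfolding h_def using Fd(1) big(1) by (auto split: if_splits)
    moreover have "?M \<in> h e F" by (simp add: h_def)
    ultimately show mk: "h e F \<inter> markers Y = {?M}" using m(1) by blast
    show dec: "V - T' \<in> h e F \<longleftrightarrow> Y \<union> e \<in> F" using MT' Fd(7) by (auto simp: h_def)
    show "F = (if V - T' \<in> h e F then insert T' (insert (Y \<union> e) (h e F - {V - T', ?M})) else insert T' (h e F - {?M}))"
    proof (cases "Y \<union> e \<in> F")
      case True
      have "h e F - {V - T', ?M} = F - {T', Y \<union> e}" unfolding h_def if_P[OF True] using MF Fd(7) by blast
      then have "insert T' (insert (Y \<union> e) (h e F - {V - T', ?M})) = F"
        using insert_two[OF Fd(5) True] by simp
      then show ?thesis using dec True by (simp only: if_True simp_thms)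
    next
      case False
      have "h e F - {?M} = F - {T'}" unfolding h_def if_not_P[OF False] using MF by blast
      then have "insert T' (h e F - {?M}) = F" using Fd(5) by blast
      then show ?thesis using dec False by (simp only: if_False simp_thms)
    qed
    have sub: "h e F \<subseteq> pool T Y" unfolding h_def using Fd(1) big(2) m(3) by auto
    have crd: "card (h e F) = s"
    proof (cases "Y \<union> e \<in> F")
      case True
      have "card (F - {T', Y \<union> e}) = s - 2" using card_Diff_subset[of "{T', Y \<union> e}" F] True Fd YeT(1) by simp
      moreover have "card (insert ?M (insert (V - T') (F - {T', Y \<union> e}))) = Suc (Suc (card (F - {T', Y \<union> e})))"
        using Fd(6,7) MF MT' by (subst card_insert_disjoint, simp, blast) (subst card_insert_disjoint, simp, blast, rule refl)
      ultimately show ?thesis unfolding h_def if_P[OF True] using s2 by simp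
    next
      case False
      have "card (F - {T'}) = s - 1" using Fd by simp
      moreover have "card (insert ?M (F - {T'})) = Suc (card (F - {T'}))"
        using Fd(6) MF by (intro card_insert_disjoint) auto
      ultimately show ?thesis unfolding h_def if_not_P[OF False] using s2 by simp
    qed
    have Th: "T \<in> h e F" using Fd(4) T'V(4) YeT(2) by (auto simp: h_def)
    have FV: "B \<subseteq> V" "B \<in> big 3" "\<not> (Y \<subseteq> B \<and> card B = 3) \<or> B = T" "B \<noteq> T \<Longrightarrow> B \<inter> Y = {} \<Longrightarrow> card V - 4 < card B" if "B \<in> F" for B
    proof -
      have B: "B \<in> pool T Y" "B \<notin> markers Y" using that Fd(1) by auto
      show "B \<subseteq> V" "B \<in> big 3" "\<not> (Y \<subseteq> B \<and> card B = 3) \<or> B = T" using B(1) by (auto simp: pool_def big_def)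
      show "card V - 4 < card B" if "B \<inter> Y = {}" using B that by (fastforce simp: pool_def markers_def)
    qed
    have meetM: "B \<inter> ?M \<noteq> {}" if B: "B \<in> F" "B \<noteq> Y \<union> e" for B
    proof
      assume "B \<inter> ?M = {}"
      then have BYe: "B \<subseteq> Y \<union> e" using FV(1)[OF B(1)] by blast
      have nT: "B \<noteq> T" using m(2) BYe by auto
      have fYe: "finite (Y \<union> e)" using m(5) finV by (rule finite_subset)
      have "card B \<le> 4" using card_mono[OF fYe BYe] m(4) by simp
      then have BY: "B \<inter> Y \<noteq> {}" using FV(4)[OF B(1) nT] V21 by linarith
      have "B = insert y e \<or> B = insert z e \<or> B = Y \<union> e"
        by (rule below_marker[OF Ee(1,2)[OF e] FV(2)[OF B(1)] BY _ BYe]) (use FV(3)[OF B(1)] nT in blast)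
      then show False using F(2) B by (auto simp: L_def)
    qed
    have meetT': "B \<inter> (V - T') \<noteq> {}" if B: "B \<in> F" "B \<noteq> T'" for B
    proof
      assume "B \<inter> (V - T') = {}"
      then have "B \<subseteq> T'" using FV(1)[OF B(1)] by blast
      moreover have "finite T'" using T'V(1) finV by (rule finite_subset)
      moreover have "card T' \<le> card B" using FV(2)[OF B(1)] T'V(2) by (simp add: big_def)
      ultimately show False using card_seteq[of T' B] B(2) by simp
    qed
    have MM: "?M \<inter> ?M \<noteq> {}" using m(2) by blast
    have TM: "(V - T') \<inter> ?M \<noteq> {}"
    proof
      assume "(V - T') \<inter> ?M = {}"
      then have "T' \<union> (Y \<union> e) = V" using T'V(1) m(5) by blast
      then show False using union_small[of T' "Y \<union> e"] m(4) T'V(2) by simp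
    qed
    have TT: "(V - T') \<inter> (V - T') \<noteq> {}" using xyz T'V(3) by blast
    have FF: "B \<inter> C \<noteq> {}" if "B \<in> F" "C \<in> F" for B C using intersectingD[OF Fd(3) that] .
    have cases: "B = ?M \<or> (B = V - T') \<or> (B \<in> F \<and> B \<noteq> T' \<and> B \<noteq> Y \<union> e)" if "B \<in> h e F" for B
      using that by (auto simp: h_def split: if_splits)
    have mM: "B \<inter> ?M \<noteq> {}" if "B \<in> h e F" for B
      using cases[OF that]
    proof (elim disjE conjE)
      show "B \<inter> ?M \<noteq> {}" if "B = ?M" unfolding that by (rule MM)
      show "B \<inter> ?M \<noteq> {}" if "B = V - T'" unfolding that by (rule TM)
      show "B \<inter> ?M \<noteq> {}" if "B \<in> F" "B \<noteq> Y \<union> e" by (rule meetM[OF that])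
    qed
    have mT: "B \<inter> (V - T') \<noteq> {}" if "B \<in> h e F" for B
      using cases[OF that]
    proof (elim disjE conjE)
      show "B \<inter> (V - T') \<noteq> {}" if "B = ?M" unfolding that by (subst Int_commute, rule TM)
      show "B \<inter> (V - T') \<noteq> {}" if "B = V - T'" unfolding that by (rule TT)
      show "B \<inter> (V - T') \<noteq> {}" if "B \<in> F" "B \<noteq> T'" by (rule meetT'[OF that])
    qed
    have "B \<inter> C \<noteq> {}" if BC: "B \<in> h e F" "C \<in> h e F" for B C
      using cases[OF BC(2)]
    proof (elim disjE conjE)
      show "B \<inter> C \<noteq> {}" if "C = ?M" unfolding that by (rule mM[OF BC(1)])
      show "B \<inter> C \<noteq> {}" if "C = V - T'" unfolding that by (rule mT[OF BC(1)])
      assume C: "C \<in> F" "C \<noteq> T'" "C \<noteq> Y \<union> e"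
      show "B \<inter> C \<noteq> {}" using cases[OF BC(1)]
      proof (elim disjE conjE)
        show "B \<inter> C \<noteq> {}" if "B = ?M" unfolding that by (subst Int_commute, rule mM[OF BC(2)])
        show "B \<inter> C \<noteq> {}" if "B = V - T'" unfolding that by (subst Int_commute, rule mT[OF BC(2)])
        show "B \<inter> C \<noteq> {}" if "B \<in> F" by (rule FF[OF that C(1)])
      qed
    qed
    then have "intersecting (h e F)" by (simp add: intersecting_def)
    then show "h e F \<in> GG" using sub crd Th mk by (simp add: GG_def fam_def)
  qed
  define Dm where "Dm = (SIGMA e:E. {F \<in> FB. F \<inter> L e = {}})"
  have inj: "inj_on (\<lambda>(e, F). h e F) Dm"
  proof (rule inj_onI)
    fix p q assume pq: "p \<in> Dm" "q \<in> Dm" "(\<lambda>(e, F). h e F) p = (\<lambda>(e, F). h e F) q"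
    obtain e F where p: "p = (e, F)" by (cases p)
    obtain e' F' where q: "q = (e', F')" by (cases q)
    have eF: "e \<in> E" "F \<in> FB" "F \<inter> L e = {}" "e' \<in> E" "F' \<in> FB" "F' \<inter> L e' = {}" using pq p q by (auto simp: Dm_def)
    have eq: "h e F = h e' F'" using pq p q by simp
    have "{V - (Y \<union> e)} = {V - (Y \<union> e')}" using hmem(2)[OF eF(1-3)] hmem(2)[OF eF(4-6)] eq by simp
    then have ee: "e = e'" using marker_inj[OF Ee(1)[OF eF(1)] Ee(1)[OF eF(4)]] by blast
    have "F = F'" by (rule trans[OF hmem(4)[OF eF(1-3)] hmem(4)[OF eF(4-6), folded eq, folded ee, symmetric]])
    then show "p = q" using ee p q by simp
  qed
  have "(\<Sum>e\<in>E. 43/47 * real (card FB)) \<le> (\<Sum>e\<in>E. real (card {F \<in> FB. F \<inter> L e = {}}))"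
    by (intro sum_mono often)
  also have "\<dots> = real (card Dm)" unfolding Dm_def using fE fFB by simp
  also have "card Dm \<le> card GG"
    by (rule card_inj_on_le[OF inj _ fGG]) (use hmem(1) in \<open>auto simp: Dm_def\<close>)
  finally have "real (card E) * (43/47 * real (card FB)) \<le> real (card GG)" by simp
  moreover have "(real ((card V - 3) choose 2) - 1) * (43/47 * real (card FB)) \<le> real (card E) * (43/47 * real (card FB))"
    using cE by (intro mult_right_mono) auto
  ultimately show ?thesis unfolding FB_def GG_def T'_def by (simp add: algebra_simps)
qed

end

lemma remove_added: "a \<notin> R \<Longrightarrow> b \<notin> R \<Longrightarrow> E \<subseteq> {b} \<Longrightarrow> R = insert a (E \<union> R) - {a, b}"
  by blast

context flag begin

text \<open>\<open>Y\<close> is exchanged for \<open>T\<close>, and the place of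
  \<open>{y, w}\<close> goes to a marker \<open>V - (Y \<union> e)\<close>. Of the obstructions,
  \<open>Y \<union> e\<close> is exchanged for \<open>V - {y, w}\<close>, \<open>insert z e\<close>
  is impossible beside \<open>{y, w}\<close>, and \<open>insert y e\<close> is complemented away at
  the cost of the factor 2.\<close>

lemma two_edges:
  assumes w: "w \<in> V" "w \<notin> T"
  shows "trace_count {Y, {y, w}} * ((card V - 4) choose 2) \<le> 2 * card (fam s (pool T Y) {T} (markers Y))"
proof -
  let ?p = "{y, w}" and ?e = "exchange T Y"
  define A where "A = big 3 \<union> {Y, {y, w}}"
  define FB where "FB = fam s A {Y, ?p} {}"
  define GG where "GG = fam s (pool T Y) {T} (markers Y)"
  \<comment> \<open>Keeping \<open>w\<close> out of \<open>e\<close> makes \<open>insert z e\<close>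
    disjoint from \<open>{y, w}\<close>, and makes \<open>insert y e\<close> minimal in
    \<open>A\<close>.\<close>
  define E where "E = pairs_off {x, y, z, w}"
  define core where "core e F = (if Y \<union> e \<in> F then F - {?p, Y \<union> e} else F - {?p})" for e F
  define ext where "ext e F = (if Y \<union> e \<in> F then {V - ?p} else {})" for e and F :: "'a set set"
  define h where "h e F = insert (V - (Y \<union> e)) (ext e F \<union> ?e ` core e F)" for e F
  have wn: "w \<noteq> x" "w \<noteq> y" "w \<noteq> z" using w(2) by auto
  have pV: "?p \<subseteq> V" "card ?p = 2" "z \<notin> ?p" "?p \<noteq> Y" using w wn xyz by auto
  have AV: "A \<subseteq> Pow V" using pV card_TY by (auto simp: A_def big_def)
  have finA: "finite A" using AV finV by (meson finite_Pow_iff finite_subset)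
  have fFB: "finite FB" unfolding FB_def by (rule finite_fam[OF finA])
  have fGG: "finite GG" unfolding GG_def by (rule finite_fam[OF finite_pool])
  have Ee: "e \<subseteq> V - T" "card e = 2" "w \<notin> e" "y \<notin> e" "z \<notin> e" if "e \<in> E" for e using that by (auto simp: E_def pairs_off_def)
  have fE: "finite E" using pairs_off(1) by (simp add: E_def)
  have "card {x, y, z, w} = 4" using xyz wn by (auto simp: card_insert_if)
  then have cE: "card E = (card V - 4) choose 2"
    unfolding E_def using pairs_off(2)[of "{x, y, z, w}"] xyz w by simp
  have often: "card FB \<le> 2 * card {F \<in> FB. insert y e \<notin> F}" if e: "e \<in> E" for e
  proof -
    have fe: "finite e" using Ee(2)[OF e] by (metis card.infinite zero_neq_numeral)
    have c3: "card (insert y e) = 3" using Ee[OF e] fe by simp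
    have iV: "insert y e \<subseteq> V" using Ee(1)[OF e] xyz by auto
    have "card {F \<in> fam s A {Y, ?p} {}. F \<inter> {} = {}} \<le> 2 * card {F \<in> fam s A {Y, ?p} {}. F \<inter> insert (insert y e) {} = {}}"
    proof (rule flip_minimal[OF finV AV])
      show "insert y e \<in> A" using c3 iV by (auto simp: A_def big_def)
      have "card (V - insert y e) = card V - 3" using card_compl[OF iV] c3 by simp
      then show "V - insert y e \<in> A" using V21 by (auto simp: A_def big_def)
      show "insert y e \<notin> {Y, ?p}" using c3 card_TY(2) pV(2) by auto
      fix C assume C: "C \<in> A" "C \<subseteq> insert y e"
      have "C \<in> big 3"
        using C Ee[OF e] xyz wn by (auto simp: A_def)
      then have "card (insert y e) \<le> card C" using c3 by (simp add: big_def)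
      then show "C = insert y e \<or> C \<in> {}" using card_seteq[OF _ C(2)] fe by simp
    qed auto
    then show ?thesis by (simp add: FB_def)
  qed
  have FBd: "F \<subseteq> A" "card F = s" "intersecting F" "Y \<in> F" "?p \<in> F" "finite F" if "F \<in> FB" for F
  proof -
    show F: "F \<subseteq> A" "card F = s" "intersecting F" "Y \<in> F" "?p \<in> F" using that by (auto simp: FB_def fam_def)
    show "finite F" using F(1) finA by (rule finite_subset)
  qed
  have cp: "card (V - ?p) = card V - 2" using card_compl[OF pV(1)] pV(2) by simp
  have big: "V - ?p \<notin> markers Y" "V - ?p \<in> pool T Y"
  proof -
    show "V - ?p \<notin> markers Y" using pV(3) xyz by (auto simp: markers_def)
    have "3 < card V - 2" using V21 by linarith
    then show "V - ?p \<in> pool T Y" unfolding pool_def using cp V21 by auto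
  qed
  have cored: "core e F \<in> fam (card (core e F)) (big 3 \<union> {Y}) {Y} {}"
    "F = insert ?p (core e F \<union> (if Y \<union> e \<in> F then {Y \<union> e} else {}))"
    "card (core e F) + card (ext e F) + 1 = s" "finite (core e F)"
    if e: "e \<in> E" and F: "F \<in> FB" for e F
  proof -
    note Fd = FBd[OF F]
    have ne: "Y \<union> e \<noteq> ?p" "Y \<union> e \<noteq> Y" using marker(4)[OF Ee(1,2)[OF e]] pV(2) card_TY(2) by auto
    have cF: "core e F \<subseteq> F - {?p}" by (auto simp: core_def)
    have Yc: "Y \<in> core e F" using Fd(4) pV(4) ne(2) by (auto simp: core_def)
    show "finite (core e F)" using cF Fd(6) by (meson finite_Diff finite_subset)
    have "core e F \<subseteq> big 3 \<union> {Y}" using cF Fd(1) by (auto simp: A_def)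
    moreover have "intersecting (core e F)" using Fd(3) cF unfolding intersecting_def by blast
    ultimately show "core e F \<in> fam (card (core e F)) (big 3 \<union> {Y}) {Y} {}" using Yc by (simp add: fam_def)
    show "F = insert ?p (core e F \<union> (if Y \<union> e \<in> F then {Y \<union> e} else {}))"
      using Fd(5) insert_two[of ?p F "Y \<union> e"] by (cases "Y \<union> e \<in> F") (simp_all add: core_def insert_absorb)
    show "card (core e F) + card (ext e F) + 1 = s"
    proof (cases "Y \<union> e \<in> F")
      case True
      have "card (F - {?p, Y \<union> e}) = s - 2" using card_Diff_subset[of "{?p, Y \<union> e}" F] True Fd ne(1) by simp
      then show ?thesis using True s2 by (simp add: core_def ext_def)
    next
      case False
      have "card (F - {?p}) = s - 1" using Fd by simp
      then show ?thesis using False s2 by (simp add: core_def ext_def)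
    qed
  qed
  have hmem: "h e F \<in> GG" "h e F \<inter> markers Y = {V - (Y \<union> e)}" "V - ?p \<in> h e F \<longleftrightarrow> Y \<union> e \<in> F"
    "?e ` core e F = h e F - {V - (Y \<union> e), V - ?p}"
    if e: "e \<in> E" and F: "F \<in> FB" "insert y e \<notin> F" for e F
  proof -
    let ?M = "V - (Y \<union> e)" and ?c = "core e F"
    note m = marker[OF Ee(1,2)[OF e]] and Fd = FBd[OF F(1)] and cd = cored[OF e F(1)]
    have ef: "?e ` ?c \<in> fam (card ?c) (pool T Y - markers Y) {T} {}" "?c \<subseteq> {B. B \<subseteq> V \<and> B \<inter> Y \<noteq> {}}"
      using exchange_fam[OF cd(1)] by blast+
    have efd: "?e ` ?c \<subseteq> pool T Y - markers Y" "card (?e ` ?c) = card ?c" "intersecting (?e ` ?c)" "T \<in> ?e ` ?c"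
      using ef(1) by (auto simp: fam_def)
    have cin: "B \<subseteq> V" "B \<inter> Y \<noteq> {}" "B \<in> big 3 \<union> {Y}" "B \<in> F" "B \<noteq> Y \<union> e" if B: "B \<in> ?c" for B
    proof -
      show "B \<subseteq> V" "B \<inter> Y \<noteq> {}" using ef(2) B by blast+
      show "B \<in> big 3 \<union> {Y}" using cd(1) B by (auto simp: fam_def)
      show "B \<in> F" "B \<noteq> Y \<union> e" using B by (auto simp: core_def split: if_splits)
    qed
    have Mp: "?M \<noteq> V - ?p" using big(1) m(1) by metis
    have pM: "(V - ?p) \<inter> ?M \<noteq> {}"
    proof
      assume "(V - ?p) \<inter> ?M = {}"
      then have "?p \<union> (Y \<union> e) = V" using pV(1) m(5) by blast
      then show False using union_small[of ?p "Y \<union> e"] m(4) pV(2) by simp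
    qed
    have pp: "(V - ?p) \<inter> (V - ?p) \<noteq> {}" using xyz pV(3) by blast
    have MM: "?M \<inter> ?M \<noteq> {}" using m(2) by blast
    have eM: "?e B \<inter> ?M \<noteq> {}" and ep: "?e B \<inter> (V - ?p) \<noteq> {}" and en: "?e B \<noteq> V - ?p" if B: "B \<in> ?c" for B
    proof -
      have "?e B \<inter> ?M \<noteq> {} \<and> ?e B \<inter> (V - ?p) \<noteq> {} \<and> ?e B \<noteq> V - ?p"
      proof (rule exchange_cases[OF cin(1-3)[OF B]])
        assume q: "?e B = T"
        have "card T \<noteq> card (V - ?p)" using card_TY(1) cp V21 by linarith
        then have "T \<noteq> V - ?p" by metis
        then show ?thesis unfolding q using m(2) xyz pV(3) by blast
      next
        fix X assume q: "?e B = V - X" and X: "Y \<subseteq> X" "X \<subseteq> V" "card X \<le> 3"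
        have "V - X \<noteq> V - ?p" using X(1) xyz pV(3) by blast
        moreover have "(V - X) \<inter> (V - Z) \<noteq> {}" if "Z \<subseteq> V" "card Z \<le> 5" for Z
        proof
          assume "(V - X) \<inter> (V - Z) = {}"
          then have "X \<union> Z = V" using X(2) that(1) by blast
          then show False using union_small[of X Z] that(2) X(3) by simp
        qed
        ultimately show ?thesis unfolding q using m(4,5) pV(1,2) by simp
      next
        assume q: "?e B = B" and B3: "3 \<le> card B" "\<not> (Y \<subseteq> B \<and> card B = 3)"
        have "B \<noteq> Y" using B3(1) card_TY(2) by auto
        then have Bb: "B \<in> big 3" using cin(3)[OF B] by simp
        have "B \<inter> ?M \<noteq> {}"
        proof
          assume "B \<inter> ?M = {}"
          then have "B \<subseteq> Y \<union> e" using cin(1)[OF B] by blast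
          from below_marker[OF Ee(1,2)[OF e] Bb cin(2)[OF B] B3(2) this]
          have "B = insert z e" using F(2) cin(4,5)[OF B] by auto
          moreover have "insert z e \<inter> ?p = {}" using Ee[OF e] wn xyz by auto
          ultimately show False using intersectingD[OF Fd(3) cin(4)[OF B] Fd(5)] by simp
        qed
        moreover have "B \<inter> (V - ?p) \<noteq> {}"
        proof
          assume "B \<inter> (V - ?p) = {}"
          then have "B \<subseteq> ?p" using cin(1)[OF B] by blast
          then have "card B \<le> 2" using card_mono[of ?p B] pV(2) by simp
          then show False using B3 by simp
        qed
        moreover have "B \<noteq> V - ?p" using intersectingD[OF Fd(3) cin(4)[OF B] Fd(5)] by blast
        ultimately show ?thesis unfolding q by blast
      qed
      then show "?e B \<inter> ?M \<noteq> {}" "?e B \<inter> (V - ?p) \<noteq> {}" "?e B \<noteq> V - ?p" by blast+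
    qed
    have nM: "?M \<notin> ?e ` ?c" using efd(1) m(1) by blast
    have np: "V - ?p \<notin> ?e ` ?c" using en by blast
    have ext: "ext e F \<subseteq> {V - ?p}" by (simp add: ext_def)
    show mk: "h e F \<inter> markers Y = {?M}"
      unfolding h_def using efd(1) m(1) ext big(1) by blast
    have "V - ?p \<in> h e F \<longleftrightarrow> V - ?p \<in> ext e F" unfolding h_def using np Mp by blast
    then show "V - ?p \<in> h e F \<longleftrightarrow> Y \<union> e \<in> F" by (simp add: ext_def)
    show "?e ` core e F = h e F - {?M, V - ?p}" unfolding h_def by (rule remove_added[OF nM np ext])
    have "card (ext e F \<union> ?e ` ?c) = card (ext e F) + card ?c"
      using card_Un_disjoint[of "ext e F" "?e ` ?c"] cd(4) efd(2) np ext by (auto simp: finite_subset)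
    moreover have "?M \<notin> ext e F \<union> ?e ` ?c" using nM ext Mp by blast
    moreover have "finite (ext e F \<union> ?e ` ?c)" using cd(4) ext by (auto simp: finite_subset)
    ultimately have crd: "card (h e F) = s" unfolding h_def using cd(3) by simp
    have sub: "h e F \<subseteq> pool T Y" unfolding h_def using efd(1) ext big(2) m(3) by blast
    have cases: "B = ?M \<or> B = V - ?p \<or> B \<in> ?e ` ?c" if "B \<in> h e F" for B using that ext by (auto simp: h_def)
    have mM: "B \<inter> ?M \<noteq> {}" if "B \<in> h e F" for B
      using cases[OF that]
    proof (elim disjE imageE)
      show "B \<inter> ?M \<noteq> {}" if "B = ?M" unfolding that by (rule MM)
      show "B \<inter> ?M \<noteq> {}" if "B = V - ?p" unfolding that by (rule pM)
      show "B \<inter> ?M \<noteq> {}" if "B = ?e C" "C \<in> ?c" for C unfolding that(1) by (rule eM[OF that(2)])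
    qed
    have mp: "B \<inter> (V - ?p) \<noteq> {}" if "B \<in> h e F" for B
      using cases[OF that]
    proof (elim disjE imageE)
      show "B \<inter> (V - ?p) \<noteq> {}" if "B = ?M" unfolding that by (subst Int_commute, rule pM)
      show "B \<inter> (V - ?p) \<noteq> {}" if "B = V - ?p" unfolding that by (rule pp)
      show "B \<inter> (V - ?p) \<noteq> {}" if "B = ?e C" "C \<in> ?c" for C unfolding that(1) by (rule ep[OF that(2)])
    qed
    have "B \<inter> C \<noteq> {}" if BC: "B \<in> h e F" "C \<in> h e F" for B C
      using cases[OF BC(2)]
    proof (elim disjE)
      show "B \<inter> C \<noteq> {}" if "C = ?M" unfolding that by (rule mM[OF BC(1)])
      show "B \<inter> C \<noteq> {}" if "C = V - ?p" unfolding that by (rule mp[OF BC(1)])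
      assume C: "C \<in> ?e ` ?c"
      show "B \<inter> C \<noteq> {}" using cases[OF BC(1)]
      proof (elim disjE)
        show "B \<inter> C \<noteq> {}" if "B = ?M" unfolding that by (subst Int_commute, rule mM[OF BC(2)])
        show "B \<inter> C \<noteq> {}" if "B = V - ?p" unfolding that by (subst Int_commute, rule mp[OF BC(2)])
        show "B \<inter> C \<noteq> {}" if "B \<in> ?e ` ?c" by (rule intersectingD[OF efd(3) that C])
      qed
    qed
    then have "intersecting (h e F)" by (simp add: intersecting_def)
    moreover have "T \<in> h e F" using efd(4) by (simp add: h_def)
    ultimately show "h e F \<in> GG" using sub crd mk by (simp add: GG_def fam_def)
  qed
  define Dm where "Dm = (SIGMA e:E. {F \<in> FB. insert y e \<notin> F})"
  have inj: "inj_on (\<lambda>(e, F). h e F) Dm"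
  proof (rule inj_onI)
    fix p q assume pq: "p \<in> Dm" "q \<in> Dm" "(\<lambda>(e, F). h e F) p = (\<lambda>(e, F). h e F) q"
    obtain e F where p: "p = (e, F)" by (cases p)
    obtain e' F' where q: "q = (e', F')" by (cases q)
    have eF: "e \<in> E" "F \<in> FB" "insert y e \<notin> F" "e' \<in> E" "F' \<in> FB" "insert y e' \<notin> F'" using pq p q by (auto simp: Dm_def)
    have eq: "h e F = h e' F'" using pq p q by simp
    have "{V - (Y \<union> e)} = {V - (Y \<union> e')}" using hmem(2)[OF eF(1-3)] hmem(2)[OF eF(4-6)] eq by simp
    then have ee: "e = e'" using marker_inj[OF Ee(1)[OF eF(1)] Ee(1)[OF eF(4)]] by blast
    have fl: "Y \<union> e \<in> F \<longleftrightarrow> Y \<union> e' \<in> F'" using hmem(3)[OF eF(1-3)] hmem(3)[OF eF(4-6)] eq by simp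
    have "h e F - {V - (Y \<union> e), V - ?p} = h e' F' - {V - (Y \<union> e'), V - ?p}"
      by (subst eq, subst ee, rule refl)
    then have "?e ` core e F = ?e ` core e' F'"
      using hmem(4)[OF eF(1-3)] hmem(4)[OF eF(4-6)] by (simp only:)
    then have "core e F = core e' F'"
      using inj_on_image_eq_iff[OF exchange_inj exchange_fam(2)[OF cored(1)[OF eF(1,2)]] exchange_fam(2)[OF cored(1)[OF eF(4,5)]]] by blast
    moreover have "(if Y \<union> e \<in> F then {Y \<union> e} else {}) = (if Y \<union> e' \<in> F' then {Y \<union> e'} else {})"
      using fl ee by simp
    ultimately have "insert ?p (core e F \<union> (if Y \<union> e \<in> F then {Y \<union> e} else {}))
      = insert ?p (core e' F' \<union> (if Y \<union> e' \<in> F' then {Y \<union> e'} else {}))" by (simp only:)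
    then have "F = F'" by (rule trans[OF cored(2)[OF eF(1,2)] trans[OF _ cored(2)[OF eF(4,5), symmetric]]])
    then show "p = q" using ee p q by simp
  qed
  have "(\<Sum>e\<in>E. card FB) \<le> (\<Sum>e\<in>E. 2 * card {F \<in> FB. insert y e \<notin> F})"
    by (intro sum_mono often)
  also have "\<dots> = 2 * card Dm" unfolding Dm_def using fE fFB by (simp add: sum_distrib_left)
  also have "card Dm \<le> card GG"
    by (rule card_inj_on_le[OF inj _ fGG]) (use hmem(1) in \<open>auto simp: Dm_def\<close>)
  finally show ?thesis using cE by (simp add: GG_def FB_def A_def trace_count_def mult.commute)
qed

end

lemma real_choose_two: "real (k choose 2) = real k * (real k - 1) / 2"
  by (cases k) (simp_all add: choose_two real_of_nat_div algebra_simps)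

lemma subset_Diff_disjoint: "B \<subseteq> V - Y \<longleftrightarrow> B \<subseteq> V \<and> B \<inter> Y = {}"
  by blast

lemma image_eq_of_iff: "(\<And>B. f B \<in> S' \<longleftrightarrow> B \<in> S) \<Longrightarrow> (\<And>C. \<exists>B. C = f B) \<Longrightarrow> f ` S = S'"
  by (auto, metis imageI)

context flag begin

section \<open>Overlaps and surplus of substitute triples\<close>

text \<open>With \<open>N = (n - 4) * (n - 5)\<close>, families containing both triples and a marker
  number at most \<open>188/37 * e / N\<close> by \<open>rare_triple_strong\<close>, those without a
  marker at most \<open>94/43 * e / N\<close> by \<open>shift_triple\<close>; the two constants add
  up to less than 73/10.\<close>

lemma overlap_at:
  assumes b: "b \<in> V" "b' \<in> V" "b \<noteq> b'" "b \<notin> Y" "b' \<notin> Y" and T': "{y, b, b'} \<noteq> T"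
  shows "real ((card V - 4) * (card V - 5)) * real (card (fam s (pool T Y) {T, {y, b, b'}} {}))
    \<le> 73/10 * real (card (fam s (pool T Y) {T} (markers Y)))"
proof -
  let ?T' = "{y, b, b'}"
  define e where "e = real (card (fam s (pool T Y) {T} (markers Y)))"
  define cA where "cA = real (card (fam s (pool T Y) {T, ?T'} (markers Y)))"
  define cB where "cB = real (card (fam s (pool T Y - markers Y) {T, ?T'} {}))"
  obtain m where m: "card V = m + 21" using V21 by (metis add.commute le_Suc_ex)
  define r where "r = real m"
  define N where "N = (r + 17) * (r + 16)"
  have r: "r \<ge> 0" by (simp add: r_def)
  have N0: "N \<ge> 0" using r by (simp add: N_def)
  have Nn: "real ((card V - 4) * (card V - 5)) = N" by (simp add: m N_def r_def add.commute)
  have "(1 + 37/94 * real ((card V - 4) choose 2)) * real (card (fam s (pool T Y) (insert ?T' {T}) (markers Y)))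
      \<le> real (card (fam s (pool T Y) {T} (markers Y)))"
    by (rule rare_triple_strong[OF anchored_pool]) (use b in \<open>auto simp: markers_def\<close>)
  moreover have "insert ?T' {T} = {T, ?T'}" by (rule insert_commute)
  moreover have "real ((card V - 4) choose 2) = N / 2" by (simp add: real_choose_two m N_def r_def add.commute)
  ultimately have "(1 + 37/94 * (N / 2)) * cA \<le> e" unfolding cA_def e_def by (simp only:)
  moreover have "cA \<ge> 0" by (simp add: cA_def)
  ultimately have A: "N * cA \<le> 188/37 * e" by (simp add: algebra_simps)
  have "43/47 * (real ((card V - 3) choose 2) - 1) * cB \<le> e"
    unfolding cB_def e_def by (rule shift_triple) (use b T' in auto)
  moreover have "real ((card V - 3) choose 2) - 1 = N / 2 + (r + 16)"
    by (simp add: real_choose_two m N_def r_def field_simps)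
  ultimately have "43/47 * (N / 2 + (r + 16)) * cB \<le> e" by (simp only:)
  moreover have "43/47 * (N / 2) * cB \<le> 43/47 * (N / 2 + (r + 16)) * cB"
    using r by (intro mult_right_mono) (auto simp: cB_def)
  ultimately have B: "N * cB \<le> 94/43 * e" by simp
  have "card (fam s (pool T Y) {T, ?T'} {})
      \<le> card (fam s (pool T Y) {T, ?T'} (markers Y) \<union> fam s (pool T Y - markers Y) {T, ?T'} {})"
  proof (rule card_mono)
    show "finite (fam s (pool T Y) {T, ?T'} (markers Y) \<union> fam s (pool T Y - markers Y) {T, ?T'} {})"
      using finite_fam[OF finite_pool] finite_fam[OF finite_Diff[OF finite_pool]] by (intro finite_UnI)
  qed (auto simp: fam_def)
  also have "\<dots> \<le> card (fam s (pool T Y) {T, ?T'} (markers Y)) + card (fam s (pool T Y - markers Y) {T, ?T'} {})"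
    by (rule card_Un_le)
  finally have "real (card (fam s (pool T Y) {T, ?T'} {})) \<le> cA + cB" unfolding cA_def cB_def by linarith
  then have "N * real (card (fam s (pool T Y) {T, ?T'} {})) \<le> N * (cA + cB)" using N0 by (rule mult_left_mono)
  also have "\<dots> \<le> 188/37 * e + 94/43 * e" using A B by (simp add: distrib_left)
  also have "\<dots> \<le> 73/10 * e" by (simp add: e_def)
  finally show ?thesis unfolding Nn e_def .
qed

end

context bounded_ground begin

definition marked :: "'a set \<Rightarrow> 'a set \<Rightarrow> nat" where
  "marked T Y = card (fam s (pool T Y) {T} (markers Y))"

lemma flag_obtain:
  assumes T: "T \<subseteq> V" "card T = 3" and Y: "Y \<subseteq> T" "card Y = 2"
  obtains x y z where "flag V s x y z" "T = {x, y, z}" "Y = {y, z}"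
proof -
  obtain y z where yz: "Y = {y, z}" "y \<noteq> z" using Y(2) by (meson card_2_iff)
  have fT: "finite T" using T(1) finV by (rule finite_subset)
  have fY: "finite Y" using yz(1) by simp
  have "card (T - Y) = 1" using card_Diff_subset[OF fY Y(1)] T(2) Y(2) by simp
  then obtain x where x: "T - Y = {x}" by (rule card_1_singletonE)
  then have "T = insert x Y" using Y(1) by blast
  then have Te: "T = {x, y, z}" using yz by simp
  moreover have "x \<notin> Y" using x by blast
  ultimately have "flag V s x y z" using T(1) yz by unfold_locales auto
  then show ?thesis using that Te yz by blast
qed

text \<open>A second triple in the pool is too small to avoid \<open>Y\<close>, and containing
  \<open>Y\<close> would make it \<open>T\<close>. So it meets \<open>Y\<close> in one vertex, which
  by symmetry plays the role of \<open>y\<close> in \<open>overlap_at\<close>.\<close>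

lemma pool_overlap:
  assumes T: "T \<subseteq> V" "card T = 3" and Y: "Y \<subseteq> T" "card Y = 2" and T': "T' \<subseteq> V" "card T' = 3" "T' \<noteq> T"
  shows "F \<in> fam s (pool T Y) {T, T'} P \<Longrightarrow> card (T' \<inter> Y) = 1"
    and "real ((card V - 4) * (card V - 5)) * real (card (fam s (pool T Y) {T, T'} {})) \<le> 73/10 * real (marked T Y)"
proof -
  have fY: "finite Y" using Y(2) by (metis card.infinite zero_neq_numeral)
  show one: "card (T' \<inter> Y) = 1" if "F \<in> fam s (pool T Y) {T, T'} P" for F P
  proof -
    have p: "T' \<in> pool T Y" using that by (auto simp: fam_def)
    have "\<not> card V - 4 \<le> card T'" using T'(2) V21 by linarith
    then have "T' \<inter> Y \<noteq> {}" using p by (auto simp: pool_def)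
    then have "card (T' \<inter> Y) \<noteq> 0" using fY by simp
    moreover have "card (T' \<inter> Y) \<noteq> 2"
    proof
      assume "card (T' \<inter> Y) = 2"
      then have "T' \<inter> Y = Y" using card_seteq[OF fY, of "T' \<inter> Y"] Y(2) by simp
      then show False using p T' by (auto simp: pool_def)
    qed
    moreover have "card (T' \<inter> Y) \<le> 2" using card_mono[OF fY, of "T' \<inter> Y"] Y(2) by simp
    ultimately show ?thesis by linarith
  qed
  show "real ((card V - 4) * (card V - 5)) * real (card (fam s (pool T Y) {T, T'} {})) \<le> 73/10 * real (marked T Y)"
  proof (cases "fam s (pool T Y) {T, T'} {} = {}")
    case True then show ?thesis by simp
  next
    case False
    then have "card (T' \<inter> Y) = 1" using one by blast
    then obtain u where u: "T' \<inter> Y = {u}" by (rule card_1_singletonE)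
    obtain x y z where f: "flag V s x y z" "T = {x, y, z}" "Y = {y, z}" using flag_obtain[OF T Y] .
    have "card (T' - {u}) = 2" using u T'(2) by (metis Int_iff card_Diff_singleton diff_Suc_1 eval_nat_numeral(3) insertI1)
    then obtain b b' where b: "T' - {u} = {b, b'}" "b \<noteq> b'" by (meson card_2_iff)
    have Te: "T' = {u, b, b'}" using b u by blast
    have bY: "b \<notin> Y" "b' \<notin> Y" "b \<in> V" "b' \<in> V" using b u T'(1) by blast+
    have "u = y \<or> u = z" using u f(3) by blast
    then show ?thesis
    proof
      assume "u = y"
      then show ?thesis using flag.overlap_at[OF f(1), of b b'] bY b T' Te f(2,3) by (simp add: marked_def)
    next
      assume "u = z"
      moreover have "{x, z, y} = T" "{z, y} = Y" using f(2,3) by auto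
      ultimately show ?thesis using flag.overlap_at[OF flag.flag_swap[OF f(1)], of b b'] bY b T' Te
        by (simp add: marked_def)
    qed
  qed
qed

text \<open>Families without markers outnumber those of the edge, and families with a marker come on
  top.\<close>

lemma pool_count:
  assumes T: "T \<subseteq> V" "card T = 3" and Y: "Y \<subseteq> T" "card Y = 2"
  shows "trace_count {Y} + marked T Y \<le> card (fam s (pool T Y) {T} {})"
proof -
  obtain x y z where f: "flag V s x y z" "T = {x, y, z}" "Y = {y, z}" using flag_obtain[OF T Y] .
  let ?A = "fam s (pool T Y - markers Y) {T} {}" and ?B = "fam s (pool T Y) {T} (markers Y)"
  have "markers Y \<noteq> {}"
  proof -
    obtain e where e: "e \<subseteq> V - T" "card e = 2"
    proof -
      have "2 \<le> card (V - T)" using card_compl[OF T(1)] T(2) V21 by linarith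
      then show ?thesis using that by (rule obtain_subset_with_card_n)
    qed
    show ?thesis using flag.marker(1)[OF f(1), of e] e f(2,3) by auto
  qed
  then have "?A \<inter> ?B = {}" by (auto simp: fam_def)
  moreover have fin: "finite ?A" "finite ?B"
    by (rule finite_fam, simp add: finite_pool)+
  ultimately have "card ?A + card ?B = card (?A \<union> ?B)" by (simp add: card_Un_disjoint)
  also have "\<dots> \<le> card (fam s (pool T Y) {T} {})"
    by (rule card_mono[OF finite_fam[OF finite_pool]]) (auto simp: fam_def)
  finally show ?thesis using flag.edge_le_triple[OF f(1)] f(2,3) by (simp add: marked_def)
qed

lemma marked_eq:
  assumes T: "T \<subseteq> V" "card T = 3" "Y \<subseteq> T" "card Y = 2" and T': "T' \<subseteq> V" "card T' = 3" "Y' \<subseteq> T'" "card Y' = 2"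
  shows "marked T Y = marked T' Y'"
proof -
  obtain x y z where f: "flag V s x y z" "T = {x, y, z}" "Y = {y, z}" using flag_obtain[OF T] .
  obtain x' y' z' where f': "flag V s x' y' z'" "T' = {x', y', z'}" "Y' = {y', z'}" using flag_obtain[OF T'] .
  note d = flag.xyz[OF f(1)] and d' = flag.xyz[OF f'(1)]
  define g where "g u = (if u = x then x' else if u = y then y' else z')" for u
  have "inj_on g T" using d d' by (auto simp: g_def f(2) inj_on_def)
  moreover have "g ` T \<subseteq> V" using d' by (auto simp: g_def)
  ultimately obtain p where p: "p permutes V" "\<forall>u\<in>T. p u = g u"
    using extend_to_permutation[OF finV, of g T] T(1) by blast
  have px: "p x = x'" "p y = y'" "p z = z'" using p(2) f(2) d by (auto simp: g_def)
  have pT: "p ` T = T'" and pY: "p ` Y = Y'" using px f(2,3) f'(2,3) by auto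
  have inj: "inj p" using p(1) by (rule permutes_inj)
  have c: "card (p ` B) = card B" for B using inj by (simp add: card_image inj_on_subset)
  have pV: "p ` B \<subseteq> V \<longleftrightarrow> B \<subseteq> V" for B using permutes_image[OF p(1)] inj by (metis inj_image_subset_iff)
  have pool: "p ` B \<in> pool T' Y' \<longleftrightarrow> B \<in> pool T Y" and mark: "p ` B \<in> markers Y' \<longleftrightarrow> B \<in> markers Y" for B
  proof -
    have "p ` B \<inter> Y' = {} \<longleftrightarrow> B \<inter> Y = {}" "Y' \<subseteq> p ` B \<longleftrightarrow> Y \<subseteq> B" "p ` B = T' \<longleftrightarrow> B = T"
      unfolding pT[symmetric] pY[symmetric] using inj
      by (auto simp: image_Int[OF inj, symmetric] inj_image_subset_iff inj_image_eq_iff)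
    then show "p ` B \<in> pool T' Y' \<longleftrightarrow> B \<in> pool T Y" "p ` B \<in> markers Y' \<longleftrightarrow> B \<in> markers Y"
      unfolding pool_def markers_def mem_Collect_eq c subset_Diff_disjoint pV by simp_all
  qed
  have onto: "\<exists>B. C = p ` B" for C using permutes_surj[OF p(1)] by (metis image_f_inv_f)
  have "(`) p ` pool T Y = pool T' Y'" by (rule image_eq_of_iff[OF pool onto])
  moreover have "(`) p ` markers Y = markers Y'" by (rule image_eq_of_iff[OF mark onto])
  ultimately show ?thesis using fam_image[OF inj, of s "pool T Y" "{T}" "markers Y"] pT by (simp add: marked_def)
qed

end

section \<open>Fractional inclusion-exclusion\<close>

lemma weak_bonferroni:
  fixes l :: "'b \<Rightarrow> real"
  assumes "finite S" "\<And>T. T \<in> S \<Longrightarrow> 0 \<le> l T \<and> l T \<le> 1"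
  shows "(\<Sum>T\<in>S. l T) - (\<Sum>T\<in>S. \<Sum>T'\<in>S - {T}. l T * l T') / 2 \<le> 1"
  using assms
proof (induction S rule: finite_induct)
  case (insert u S)
  let ?p = "\<Sum>T\<in>S. \<Sum>T'\<in>S - {T}. l T * l T'" and ?e = "\<Sum>T\<in>S. l T"
  have p: "?p \<ge> 0" using insert.prems by (intro sum_nonneg mult_nonneg_nonneg) auto
  have u: "0 \<le> l u" "l u \<le> 1" using insert.prems by auto
  have "(\<Sum>T'\<in>insert u S - {T}. l T * l T') = l T * l u + (\<Sum>T'\<in>S - {T}. l T * l T')" if "T \<in> S" for T
  proof -
    have "insert u S - {T} = insert u (S - {T})" using that insert.hyps(2) by auto
    then show ?thesis using insert.hyps by simp
  qed
  then have "(\<Sum>T\<in>S. \<Sum>T'\<in>insert u S - {T}. l T * l T') = (\<Sum>T\<in>S. l T * l u + (\<Sum>T'\<in>S - {T}. l T * l T'))"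
    by (intro sum.cong) auto
  also have "\<dots> = l u * ?e + ?p" by (simp add: sum.distrib sum_distrib_left mult.commute)
  finally have "(\<Sum>T\<in>insert u S. \<Sum>T'\<in>insert u S - {T}. l T * l T') = 2 * (l u * ?e) + ?p"
    using insert.hyps by (simp add: sum_distrib_left)
  moreover have "(\<Sum>T\<in>insert u S. l T) = l u + ?e" using insert.hyps by simp
  moreover have "?e - ?p / 2 \<le> 1" using insert.IH insert.prems by simp
  then have "(1 - l u) * (?e - ?p / 2) \<le> (1 - l u) * 1" using u by (intro mult_left_mono) auto
  then have "?e - ?p / 2 - l u * ?e + l u * ?p / 2 \<le> 1 - l u" by (simp add: algebra_simps diff_divide_distrib)
  moreover have "0 \<le> l u * ?p" using u p by simp
  ultimately show ?case by linarith
qed simp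

text \<open>Two of the three vertices are both inside or both outside \<open>T'\<close>, and the
  pair they form does not meet \<open>T'\<close> in exactly one point.\<close>

lemma pairs_of_triple:
  assumes "card T = 3"
  shows "card {Y. Y \<subseteq> T \<and> card Y = 2} = 3" "card {Y \<in> {Y. Y \<subseteq> T \<and> card Y = 2}. card (T' \<inter> Y) = 1} \<le> 2"
proof -
  have fT: "finite T" using assms by (metis card.infinite zero_neq_numeral)
  show c: "card {Y. Y \<subseteq> T \<and> card Y = 2} = 3" using n_subsets[OF fT, of 2] assms by (simp add: choose_two)
  have fin: "finite {Y. Y \<subseteq> T \<and> card Y = 2}" using fT by simp
  obtain a b d where t: "T = {a, b, d}" "a \<noteq> b" "a \<noteq> d" "b \<noteq> d" using assms by (metis card_3_iff)
  have two: "card (T' \<inter> {u, v}) \<noteq> 1" if "u \<in> T' \<longleftrightarrow> v \<in> T'" "u \<noteq> v" for u v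
    using that by (cases "v \<in> T'") (auto simp: Int_insert_right)
  have "(a \<in> T' \<longleftrightarrow> b \<in> T') \<or> (a \<in> T' \<longleftrightarrow> d \<in> T') \<or> (b \<in> T' \<longleftrightarrow> d \<in> T')" by blast
  then have "\<exists>Y\<in>{Y. Y \<subseteq> T \<and> card Y = 2}. card (T' \<inter> Y) \<noteq> 1"
  proof (elim disjE)
    assume "a \<in> T' \<longleftrightarrow> b \<in> T'" from two[OF this t(2)] show ?thesis by (intro bexI[of _ "{a, b}"]) (use t in auto)
  next
    assume "a \<in> T' \<longleftrightarrow> d \<in> T'" from two[OF this t(3)] show ?thesis by (intro bexI[of _ "{a, d}"]) (use t in auto)
  next
    assume "b \<in> T' \<longleftrightarrow> d \<in> T'" from two[OF this t(4)] show ?thesis by (intro bexI[of _ "{b, d}"]) (use t in auto)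
  qed
  then have "{Y \<in> {Y. Y \<subseteq> T \<and> card Y = 2}. card (T' \<inter> Y) = 1} \<subset> {Y. Y \<subseteq> T \<and> card Y = 2}" by blast
  from psubset_card_mono[OF fin this] show "card {Y \<in> {Y. Y \<subseteq> T \<and> card Y = 2}. card (T' \<inter> Y) = 1} \<le> 2" using c by linarith
qed

context bounded_ground begin

text \<open>Each \<open>F\<close> is charged to a triple \<open>T\<close> with the fraction of the pairs \<open>Y \<subseteq> T\<close> that \<open>T\<close> can replace in
  \<open>F\<close>. Averaging over \<open>Y\<close> helps because for two triples at most four of the nine choices of pairs are
  compatible.\<close>

lemma triple_hits:
  assumes TT: "\<And>T. T \<in> TT \<Longrightarrow> T \<subseteq> V \<and> card T = 3" and T0: "T0 \<subseteq> V" "card T0 = 3" "Y0 \<subseteq> T0" "card Y0 = 2"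
    and rho: "rho = 73/10 / real ((card V - 4) * (card V - 5))"
  shows "real (card TT) * real (trace_count {Y0} + marked T0 Y0)
      - 2/9 * (real (card TT) * (real (card TT) - 1)) * rho * real (marked T0 Y0)
    \<le> real (card {F \<in> fam s (big 3) {} {}. F \<inter> TT \<noteq> {}})"
proof -
  define HH where "HH = {F \<in> fam s (big 3) {} {}. F \<inter> TT \<noteq> {}}"
  define pr where "pr T = {Y. Y \<subseteq> T \<and> card Y = 2}" for T :: "'a set"
  define Fm where "Fm T Y = fam s (pool T Y) {T} {}" for T Y
  define lam where "lam T F = (\<Sum>Y\<in>pr T. of_bool (F \<in> Fm T Y) :: real) / 3" for T F
  define e where "e = real (marked T0 Y0)"
  define v where "v = real (trace_count {Y0})"
  have fTT: "finite TT" by (rule finite_subset[of _ "Pow V"]) (use TT finV in auto)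
  have fHH: "finite HH" unfolding HH_def using finite_fam[OF finite_big] by simp
  have c3: "card (pr T) = 3" and fpr: "finite (pr T)" if "T \<in> TT" for T
  proof -
    show "card (pr T) = 3" using pairs_of_triple(1)[of T] TT[OF that] by (simp add: pr_def)
    then show "finite (pr T)" by (metis card.infinite zero_neq_numeral)
  qed
  have FmH: "Fm T Y \<subseteq> HH" if "T \<in> TT" for T Y using that by (auto simp: Fm_def HH_def fam_def pool_def big_def)
  have count: "(\<Sum>F\<in>HH. of_bool (F \<in> X) :: real) = real (card X)" if "X \<subseteq> HH" for X
  proof -
    have "HH \<inter> X = X" using that by blast
    then show ?thesis using fHH by simp
  qed
  have lam01: "0 \<le> lam T F \<and> lam T F \<le> 1" if "T \<in> TT" for T F
  proof -
    have "(\<Sum>Y\<in>pr T. of_bool (F \<in> Fm T Y) :: real) \<le> (\<Sum>Y\<in>pr T. 1)" by (intro sum_mono) auto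
    then show ?thesis using c3[OF that] unfolding lam_def by (auto intro!: sum_nonneg)
  qed
  have one: "v + e \<le> (\<Sum>F\<in>HH. lam T F)" if T: "T \<in> TT" for T
  proof -
    have "(\<Sum>F\<in>HH. lam T F) = (\<Sum>Y\<in>pr T. \<Sum>F\<in>HH. of_bool (F \<in> Fm T Y) :: real) / 3"
      unfolding lam_def sum_divide_distrib[symmetric] by (subst sum.swap) simp
    also have "\<dots> = (\<Sum>Y\<in>pr T. real (card (Fm T Y))) / 3" using count[OF FmH[OF T]] by simp
    finally have eq: "(\<Sum>F\<in>HH. lam T F) = (\<Sum>Y\<in>pr T. real (card (Fm T Y))) / 3" .
    have "v + e \<le> real (card (Fm T Y))" if "Y \<in> pr T" for Y
    proof -
      have Y: "Y \<subseteq> T" "card Y = 2" using that by (auto simp: pr_def)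
      have TV: "T \<subseteq> V" "card T = 3" using TT[OF T] by auto
      obtain p q where pq: "Y = {p, q}" "p \<in> V" using Y TV(1) by (metis card_2_iff insert_subset subset_trans)
      obtain p0 q0 where pq0: "Y0 = {p0, q0}" "p0 \<in> V" using T0 by (metis card_2_iff insert_subset subset_trans)
      have "{Y} \<subseteq> star p" "{Y0} \<subseteq> star p0" using pq pq0 Y TV(1) T0 by (auto simp: star_def edges_def)
      then have "trace_count {Y} = trace_count {Y0}" by (rule trace_count_star) (use pq pq0 in auto)
      then show ?thesis using pool_count[OF TV Y] marked_eq[OF TV Y T0] by (simp add: v_def e_def Fm_def)
    qed
    then have "(\<Sum>Y\<in>pr T. v + e) \<le> (\<Sum>Y\<in>pr T. real (card (Fm T Y)))" by (intro sum_mono)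
    then show ?thesis unfolding eq using c3[OF T] by simp
  qed
  have N0: "0 < real ((card V - 4) * (card V - 5))" using V21 by simp
  have two: "(\<Sum>F\<in>HH. lam T F * lam T' F) \<le> 4/9 * rho * e" if T: "T \<in> TT" "T' \<in> TT" "T' \<noteq> T" for T T'
  proof -
    have TV: "T \<subseteq> V" "card T = 3" "T' \<subseteq> V" "card T' = 3" using TT T by auto
    define P where "P = {Y \<in> pr T. card (T' \<inter> Y) = 1}"
    define P' where "P' = {Y \<in> pr T'. card (T \<inter> Y) = 1}"
    have fP: "finite P" "finite P'" using fpr T by (auto simp: P_def P'_def)
    have cP: "card P \<le> 2" "card P' \<le> 2"
      unfolding P_def P'_def pr_def using pairs_of_triple(2)[OF TV(2)] pairs_of_triple(2)[OF TV(4)] by blast+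
    have pt: "lam T F * lam T' F \<le> (\<Sum>Y\<in>P. \<Sum>Y'\<in>P'. of_bool (F \<in> fam s (pool T Y) {T, T'} {})) / 9" for F
    proof -
      have z: "of_bool (F \<in> Fm T Y) * of_bool (F \<in> Fm T' Y') = (0::real)"
        if "Y \<in> pr T" "Y' \<in> pr T'" "\<not> (Y \<in> P \<and> Y' \<in> P')" for Y Y'
      proof (rule ccontr)
        assume "\<not> ?thesis"
        then have m: "F \<in> Fm T Y" "F \<in> Fm T' Y'" by (auto split: if_splits)
        have "F \<in> fam s (pool T Y) {T, T'} {}" "F \<in> fam s (pool T' Y') {T', T} {}" using m by (auto simp: Fm_def fam_def)
        then have "card (T' \<inter> Y) = 1" "card (T \<inter> Y') = 1"
          using pool_overlap(1)[OF TV(1,2) _ _ TV(3,4) T(3)] pool_overlap(1)[OF TV(3,4) _ _ TV(1,2) T(3)[symmetric]] that(1,2)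
          by (auto simp: pr_def)
        then show False using that by (auto simp: P_def P'_def)
      qed
      have le: "of_bool (F \<in> Fm T Y) * of_bool (F \<in> Fm T' Y') \<le> (of_bool (F \<in> fam s (pool T Y) {T, T'} {}) :: real)" for Y Y'
        by (auto simp: Fm_def fam_def)
      have "lam T F * lam T' F = (\<Sum>Y\<in>pr T. \<Sum>Y'\<in>pr T'. of_bool (F \<in> Fm T Y) * of_bool (F \<in> Fm T' Y')) / 9"
        unfolding lam_def by (simp add: sum_product)
      also have "(\<Sum>Y\<in>pr T. \<Sum>Y'\<in>pr T'. of_bool (F \<in> Fm T Y) * of_bool (F \<in> Fm T' Y'))
          = (\<Sum>Y\<in>P. \<Sum>Y'\<in>pr T'. of_bool (F \<in> Fm T Y) * of_bool (F \<in> Fm T' Y') :: real)"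
        by (rule sum.mono_neutral_right) (use fpr T z in \<open>auto simp: P_def intro!: sum.neutral\<close>)
      also have "\<dots> = (\<Sum>Y\<in>P. \<Sum>Y'\<in>P'. of_bool (F \<in> Fm T Y) * of_bool (F \<in> Fm T' Y') :: real)"
      proof (rule sum.cong[OF refl])
        fix Y assume Y: "Y \<in> P"
        show "(\<Sum>Y'\<in>pr T'. of_bool (F \<in> Fm T Y) * of_bool (F \<in> Fm T' Y')) = (\<Sum>Y'\<in>P'. of_bool (F \<in> Fm T Y) * of_bool (F \<in> Fm T' Y') :: real)"
        proof (rule sum.mono_neutral_right)
          show "finite (pr T')" using fpr T by blast
          show "P' \<subseteq> pr T'" by (auto simp: P'_def)
          show "\<forall>Y'\<in>pr T' - P'. of_bool (F \<in> Fm T Y) * of_bool (F \<in> Fm T' Y') = (0::real)"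
            using Y by (intro ballI z) (auto simp: P_def)
        qed
      qed
      also have "\<dots> \<le> (\<Sum>Y\<in>P. \<Sum>Y'\<in>P'. of_bool (F \<in> fam s (pool T Y) {T, T'} {}))"
        by (intro sum_mono le)
      finally show ?thesis by simp
    qed
    have each: "(\<Sum>F\<in>HH. of_bool (F \<in> fam s (pool T Y) {T, T'} {}) :: real) \<le> rho * e" if "Y \<in> P" for Y
    proof -
      have Y: "Y \<subseteq> T" "card Y = 2" using that by (auto simp: P_def pr_def)
      have "fam s (pool T Y) {T, T'} {} \<subseteq> Fm T Y" by (auto simp: Fm_def fam_def)
      then have "(\<Sum>F\<in>HH. of_bool (F \<in> fam s (pool T Y) {T, T'} {}) :: real) = real (card (fam s (pool T Y) {T, T'} {}))"
        using FmH[OF T(1)] by (intro count) blast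
      moreover have "real ((card V - 4) * (card V - 5)) * real (card (fam s (pool T Y) {T, T'} {})) \<le> 73/10 * e"
        using pool_overlap(2)[OF TV(1,2) Y TV(3,4) T(3)] marked_eq[OF TV(1,2) Y T0] by (simp add: e_def)
      then have "real (card (fam s (pool T Y) {T, T'} {})) \<le> 73/10 * e / real ((card V - 4) * (card V - 5))"
        using N0 by (simp only: pos_le_divide_eq mult.commute)
      ultimately show ?thesis by (simp add: rho)
    qed
    have "(\<Sum>F\<in>HH. lam T F * lam T' F) \<le> (\<Sum>F\<in>HH. (\<Sum>Y\<in>P. \<Sum>Y'\<in>P'. of_bool (F \<in> fam s (pool T Y) {T, T'} {})) / 9)"
      by (intro sum_mono pt)
    also have "\<dots> = (\<Sum>F\<in>HH. \<Sum>Y\<in>P. real (card P') * of_bool (F \<in> fam s (pool T Y) {T, T'} {})) / 9"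
      by (simp add: sum_divide_distrib)
    also have "\<dots> = (\<Sum>Y\<in>P. real (card P') * (\<Sum>F\<in>HH. of_bool (F \<in> fam s (pool T Y) {T, T'} {}))) / 9"
      by (subst sum.swap) (simp only: sum_distrib_left)
    also have "\<dots> \<le> (\<Sum>Y\<in>P. real (card P') * (rho * e)) / 9"
      by (intro divide_right_mono sum_mono mult_left_mono each) auto
    also have "\<dots> = real (card P) * real (card P') * (rho * e) / 9" by simp
    also have "\<dots> \<le> 2 * 2 * (rho * e) / 9"
    proof -
      have "0 \<le> rho * e" using N0 by (simp add: rho e_def)
      moreover have "real (card P) * real (card P') \<le> 2 * 2" using cP by (intro mult_mono) auto
      ultimately show ?thesis by (intro divide_right_mono mult_right_mono) auto
    qed
    finally show ?thesis by simp
  qed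
  let ?t = "real (card TT)"
  have "(\<Sum>F\<in>HH. (\<Sum>T\<in>TT. lam T F) - (\<Sum>T\<in>TT. \<Sum>T'\<in>TT - {T}. lam T F * lam T' F) / 2) \<le> (\<Sum>F\<in>HH. 1)"
    by (intro sum_mono weak_bonferroni fTT lam01)
  then have up: "(\<Sum>F\<in>HH. \<Sum>T\<in>TT. lam T F) - (\<Sum>F\<in>HH. \<Sum>T\<in>TT. \<Sum>T'\<in>TT - {T}. lam T F * lam T' F) / 2 \<le> real (card HH)"
    by (simp add: sum_subtractf sum_divide_distrib)
  have "(\<Sum>T\<in>TT. v + e) \<le> (\<Sum>T\<in>TT. \<Sum>F\<in>HH. lam T F)" by (intro sum_mono one)
  also have "\<dots> = (\<Sum>F\<in>HH. \<Sum>T\<in>TT. lam T F)" by (rule sum.swap)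
  finally have lo: "?t * (v + e) \<le> (\<Sum>F\<in>HH. \<Sum>T\<in>TT. lam T F)" by simp
  have "(\<Sum>F\<in>HH. \<Sum>T\<in>TT. \<Sum>T'\<in>TT - {T}. lam T F * lam T' F) = (\<Sum>T\<in>TT. \<Sum>T'\<in>TT - {T}. \<Sum>F\<in>HH. lam T F * lam T' F)"
    by (subst sum.swap) (intro sum.cong refl sum.swap)
  also have "\<dots> \<le> (\<Sum>T\<in>TT. \<Sum>T'\<in>TT - {T}. 4/9 * rho * e)"
    by (intro sum_mono two) auto
  also have "\<dots> = (\<Sum>T\<in>TT. (?t - 1) * (4/9 * rho * e))"
  proof (rule sum.cong[OF refl])
    fix T assume T: "T \<in> TT"
    have "card TT \<ge> 1" using T fTT by (metis One_nat_def Suc_leI card_gt_0_iff empty_iff)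
    then have "real (card (TT - {T})) = ?t - 1" using T fTT by (simp add: of_nat_diff)
    then show "(\<Sum>T'\<in>TT - {T}. 4/9 * rho * e) = (?t - 1) * (4/9 * rho * e)" by simp
  qed
  also have "\<dots> = ?t * (?t - 1) * (4/9 * rho * e)" by simp
  finally have pairs: "(\<Sum>F\<in>HH. \<Sum>T\<in>TT. \<Sum>T'\<in>TT - {T}. lam T F * lam T' F) \<le> ?t * (?t - 1) * (4/9 * rho * e)" .
  \<comment> \<open>The sum \<open>pairs\<close> runs over ordered pairs of triples, so its constant
    4/9 is halved to 2/9.\<close>
  have "?t * (v + e) - ?t * (?t - 1) * (4/9 * rho * e) / 2 \<le> real (card HH)" using up lo pairs by linarith
  moreover have "?t * (?t - 1) * (4/9 * rho * e) / 2 = 2/9 * (?t * (?t - 1)) * rho * e" by simp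
  ultimately show ?thesis unfolding HH_def v_def e_def of_nat_add by (simp only:)
qed

end

lemma pair_meets_sides:
  assumes "p \<noteq> q" "z \<noteq> y" "z \<noteq> b" "y \<noteq> b" "{p, q} \<inter> {z, y} \<noteq> {}" "{p, q} \<inter> {z, b} \<noteq> {}" "{p, q} \<inter> {y, b} \<noteq> {}"
  shows "{p, q} \<in> {{z, y}, {z, b}, {y, b}}"
proof -
  have "(p = z \<or> p = y \<or> q = z \<or> q = y) \<and> (p = z \<or> p = b \<or> q = z \<or> q = b) \<and> (p = y \<or> p = b \<or> q = y \<or> q = b)"
    using assms by auto
  then show ?thesis using assms(1-4) by (auto simp: doubleton_eq_iff)
qed

context bounded_ground begin

section \<open>The cost of additional edges\<close>

text \<open>A further edge is \<open>{z, b}\<close> or some \<open>{y, c}\<close>: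
  \<open>n - 2\<close> cases, each with at most \<open>c2 / N\<close> families for
  \<open>N = (n - 5) * (n - 6) / 2\<close>. Since \<open>(n - 2) / N \<le> 1/6\<close>, at least 5/6
  of the families have just the two edges.\<close>

lemma cherry_bound:
  assumes x: "y \<in> V" "z \<in> V" "b \<in> V" "y \<noteq> z" "b \<notin> {y, z}"
  shows "real (card (fam s (big 2) {{y, z}, {y, b}} {})) \<le> 6/5 * real (trace_count {{y, z}, {y, b}})"
proof -
  let ?K = "{{y, z}, {y, b}}" and ?tri = "{{z, y}, {z, b}, {y, b}}"
  define c2 where "c2 = card (fam s (big 2) ?K {})"
  define N where "N = real ((card V - 5) * (card V - 6)) / 2"
  define C where "C = V - {y, z, b}"
  have N0: "N > 0" using V21 by (simp add: N_def)
  have "card {y, z, b} = 3" using x by (auto simp: card_insert_if)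
  then have cC: "card C = card V - 3" using card_compl[of "{y, z, b}"] x by (simp add: C_def)
  have fC: "finite C" using finV by (simp add: C_def)
  have fb: "finite (fam s (big k) K P)" for k K P by (rule finite_fam[OF finite_big])
  have third: "N * real (card (fam s (big 2) (insert {y, c} ?K) {})) \<le> real c2" if "c \<in> C" for c
    unfolding N_def c2_def by (rule third_edge) (use x that in \<open>auto simp: C_def\<close>)
  \<comment> \<open>No other edge meets all three sides of a triangle, so this count is a trace
    count. It is bounded by that of a star with three edges, which the case of a third edge at
    \<open>y\<close> covers.\<close>
  have "N * real (card (fam s (big 2) ?tri {})) \<le> real c2"
  proof -
    have "card C \<noteq> 0" using cC V21 by linarith
    then obtain c where c: "c \<in> C" by (metis card.empty ex_in_conv)
    have "fam s (big 2) ?tri {} \<subseteq> fam s (big 3 \<union> ?tri) ?tri {}"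
    proof
      fix F assume F: "F \<in> fam s (big 2) ?tri {}"
      then have F': "F \<subseteq> big 2" "intersecting F" "?tri \<subseteq> F" by (auto simp: fam_def)
      have "B \<in> big 3 \<union> ?tri" if B: "B \<in> F" for B
      proof (rule ccontr)
        assume n: "B \<notin> big 3 \<union> ?tri"
        then have "card B = 2" using F'(1) B by (fastforce simp: big_def)
        then obtain p q where pq: "B = {p, q}" "p \<noteq> q" by (meson card_2_iff)
        have sides: "{z, y} \<in> F" "{z, b} \<in> F" "{y, b} \<in> F" using F'(3) by simp_all
        have "B \<inter> {z, y} \<noteq> {}" "B \<inter> {z, b} \<noteq> {}" "B \<inter> {y, b} \<noteq> {}"
          by (rule intersectingD[OF F'(2) B]; rule sides)+
        then have "B \<in> ?tri" unfolding pq(1) by (intro pair_meets_sides) (use pq(2) x in auto)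
        then show False using n by simp
      qed
      then have "F \<subseteq> big 3 \<union> ?tri" by (rule subsetI)
      then show "F \<in> fam s (big 3 \<union> ?tri) ?tri {}" using F by (simp add: fam_def)
    qed
    then have "card (fam s (big 2) ?tri {}) \<le> trace_count ?tri"
      unfolding trace_count_def by (rule card_mono[OF finite_fam_big, rotated]) simp
    also have "\<dots> \<le> trace_count {{c, z}, {c, y}, {c, b}}"
      by (rule trace_count_triangle) (use x c in \<open>auto simp: C_def\<close>)
    also have "\<dots> = trace_count (insert {y, c} ?K)"
    proof (rule trace_count_star)
      show "{{c, z}, {c, y}, {c, b}} \<subseteq> star c" "insert {y, c} ?K \<subseteq> star y"
        using x c by (auto simp: star_def edges_def C_def)
      have "card {{c, z}, {c, y}, {c, b}} = 3" "card (insert {y, c} ?K) = 3"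
        using x c by (auto simp: C_def card_insert_if doubleton_eq_iff)
      then show "card {{c, z}, {c, y}, {c, b}} = card (insert {y, c} ?K)" by simp
    qed (use x c in \<open>auto simp: C_def\<close>)
    also have "\<dots> \<le> card (fam s (big 2) (insert {y, c} ?K) {})"
      unfolding trace_count_def
    proof (rule card_mono[OF fb])
      have "big 3 \<union> insert {y, c} ?K \<subseteq> big 2" using x c by (auto simp: big_def C_def)
      then show "fam s (big 3 \<union> insert {y, c} ?K) (insert {y, c} ?K) {} \<subseteq> fam s (big 2) (insert {y, c} ?K) {}"
        unfolding fam_def by blast
    qed
    finally have "N * real (card (fam s (big 2) ?tri {})) \<le> N * real (card (fam s (big 2) (insert {y, c} ?K) {}))"
      using N0 by simp
    also have "\<dots> \<le> real c2" by (rule third[OF c])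
    finally show ?thesis .
  qed
  then have tri: "real (card (fam s (big 2) ?tri {})) \<le> real c2 / N" using N0 by (simp add: pos_le_divide_eq mult.commute)
  have third': "real (card (fam s (big 2) (insert {y, c} ?K) {})) \<le> real c2 / N" if "c \<in> C" for c
    using third[OF that] N0 by (simp add: pos_le_divide_eq mult.commute)
  have "fam s (big 2) ?K {} \<subseteq> (fam s (big 3 \<union> ?K) ?K {} \<union> fam s (big 2) ?tri {}) \<union> (\<Union>c\<in>C. fam s (big 2) (insert {y, c} ?K) {})"
  proof
    fix F assume F: "F \<in> fam s (big 2) ?K {}"
    then have F': "F \<subseteq> big 2" "card F = s" "intersecting F" "{y, z} \<in> F" "{y, b} \<in> F" by (auto simp: fam_def)
    show "F \<in> (fam s (big 3 \<union> ?K) ?K {} \<union> fam s (big 2) ?tri {}) \<union> (\<Union>c\<in>C. fam s (big 2) (insert {y, c} ?K) {})"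
    proof (cases "F \<subseteq> big 3 \<union> ?K")
      case True
      then show ?thesis using F by (simp add: fam_def)
    next
      case False
      then obtain B where B: "B \<in> F" "B \<notin> big 3 \<union> ?K" by blast
      then have "card B = 2" "B \<subseteq> V" using F'(1) by (fastforce simp: big_def)+
      then obtain p q where pq: "B = {p, q}" "p \<noteq> q" "p \<in> V" "q \<in> V" by (metis card_2_iff insert_subset)
      have "B \<inter> {y, z} \<noteq> {}" "B \<inter> {y, b} \<noteq> {}"
        by (rule intersectingD[OF F'(3) B(1)]; rule F'(4,5))+
      then have "B = {z, b} \<or> (\<exists>c\<in>V. B = {y, c} \<and> c \<noteq> y)" using pq x by auto
      then show ?thesis
      proof
        assume "B = {z, b}"
        then have "F \<in> fam s (big 2) ?tri {}" using F' B(1) by (auto simp: fam_def insert_commute)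
        then show ?thesis by blast
      next
        assume "\<exists>c\<in>V. B = {y, c} \<and> c \<noteq> y"
        then obtain c where c: "c \<in> V" "B = {y, c}" "c \<noteq> y" by blast
        then have "c \<in> C" using B(2) by (auto simp: C_def)
        moreover have "F \<in> fam s (big 2) (insert {y, c} ?K) {}" using F' B(1) c by (simp add: fam_def)
        ultimately show ?thesis by blast
      qed
    qed
  qed
  then have "c2 \<le> card ((fam s (big 3 \<union> ?K) ?K {} \<union> fam s (big 2) ?tri {}) \<union> (\<Union>c\<in>C. fam s (big 2) (insert {y, c} ?K) {}))"
    unfolding c2_def by (rule card_mono[rotated]) (use fb fC finite_fam_big[of ?K] in simp)
  also have "\<dots> \<le> card (fam s (big 3 \<union> ?K) ?K {} \<union> fam s (big 2) ?tri {}) + card (\<Union>c\<in>C. fam s (big 2) (insert {y, c} ?K) {})"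
    by (rule card_Un_le)
  also have "\<dots> \<le> (card (fam s (big 3 \<union> ?K) ?K {}) + card (fam s (big 2) ?tri {})) + (\<Sum>c\<in>C. card (fam s (big 2) (insert {y, c} ?K) {}))"
    by (intro add_mono card_Un_le card_UN_le fC)
  finally have "real c2 \<le> real (trace_count ?K) + real (card (fam s (big 2) ?tri {})) + (\<Sum>c\<in>C. real (card (fam s (big 2) (insert {y, c} ?K) {})))"
    unfolding trace_count_def by (simp only: of_nat_add[symmetric] of_nat_sum[symmetric] of_nat_le_iff)
  also have "\<dots> \<le> real (trace_count ?K) + real c2 / N + (\<Sum>c\<in>C. real c2 / N)"
    using tri third' by (intro add_mono sum_mono) auto
  also have "\<dots> = real (trace_count ?K) + real (card V - 2) * (real c2 / N)"
  proof -
    have "real (card V - 2) = real (card C) + 1" using cC V21 by linarith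
    then show ?thesis by (simp add: algebra_simps)
  qed
  finally have main: "real c2 \<le> real (trace_count ?K) + real (card V - 2) / N * real c2" by simp
  have "real (card V - 2) / N \<le> 1 / 6"
  proof -
    obtain m where m: "card V = m + 21" using V21 by (metis add.commute le_Suc_ex)
    \<comment> \<open>With \<open>card V = m + 21\<close>; at \<open>m = 0\<close> it reads 228
      \<le> 240.\<close>
    have a: "12 * (real m + 19) \<le> (real m + 16) * (real m + 15)" by (simp add: algebra_simps)
    have b: "2 * N = (real m + 16) * (real m + 15)" by (simp add: N_def m add.commute)
    have c: "real (card V - 2) = real m + 19" using m by simp
    have "12 * (real m + 19) \<le> 2 * N" unfolding b by (rule a)
    then have "6 * real (card V - 2) \<le> N" unfolding c by simp
    then show ?thesis using N0 by (simp add: pos_divide_le_eq)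
  qed
  then have "real (card V - 2) / N * real c2 \<le> 1 / 6 * real c2" by (rule mult_right_mono) simp
  then show ?thesis using main unfolding c2_def by linarith
qed

lemma cherry_marked:
  assumes K: "K \<subseteq> star c" "card K = 2" "c \<in> V" and T: "T \<subseteq> V" "card T = 3" "Y \<subseteq> T" "card Y = 2"
  shows "trace_count K * ((card V - 4) choose 2) \<le> 2 * marked T Y"
proof -
  obtain x y z where f: "flag V s x y z" "T = {x, y, z}" "Y = {y, z}" using flag_obtain[OF T] .
  note d = flag.xyz[OF f(1)]
  have "card (V - T) \<noteq> 0" using card_compl[OF T(1)] T(2) V21 by linarith
  then obtain w where w: "w \<in> V - T" by (metis card.empty ex_in_conv)
  have "trace_count K = trace_count {{y, z}, {y, w}}"
  proof (rule trace_count_star[OF K(1)])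
    show "{{y, z}, {y, w}} \<subseteq> star y" using d w f(2) by (auto simp: star_def edges_def)
    have "card {{y, z}, {y, w}} = 2" using w f(2) by (auto simp: card_insert_if doubleton_eq_iff)
    then show "card K = card {{y, z}, {y, w}}" using K(2) by simp
  qed (use K d in auto)
  then show ?thesis using flag.two_edges[OF f(1), of w] w f(2,3) by (simp add: marked_def)
qed

text \<open>Either \<open>e\<close> is the only edge of the family, or the family contains
  \<open>e\<close> and one of the at most \<open>k\<close> adjacent edges, and
  \<open>cherry_bound\<close> applies.\<close>

lemma edge_hits:
  assumes G: "G \<subseteq> edges" and e: "e \<in> G" and adj: "card {f \<in> G. f \<noteq> e \<and> f \<inter> e \<noteq> {}} \<le> k"
    and K: "K \<subseteq> star c" "card K = 2" "c \<in> V" and e0: "e0 \<in> edges"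
  shows "real (card (fam s (big 3 \<union> G) {e} {})) \<le> real (trace_count {e0}) + real k * (6/5 * real (trace_count K))"
proof -
  let ?adj = "{f \<in> G. f \<noteq> e \<and> f \<inter> e \<noteq> {}}"
  have fG: "finite G" using G finite_edges by (rule finite_subset)
  have fa: "finite ?adj" using fG by simp
  have fb: "finite (fam s (big k) K P)" for k K P by (rule finite_fam[OF finite_big])
  have eE: "e \<in> edges" using e G by blast
  obtain p q where pq': "e = {p, q}" "p \<noteq> q" using eE by (auto simp: edges_def card_2_iff)
  then have pq: "e = {p, q}" "p \<noteq> q" "p \<in> V" "q \<in> V" using eE by (simp_all add: edges_def)
  obtain p0 q0 where "e0 = {p0, q0}" using e0 by (auto simp: edges_def card_2_iff)
  then have pq0: "e0 = {p0, q0}" "p0 \<in> V" using e0 by (simp_all add: edges_def)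
  have "{e} \<subseteq> star p" "{e0} \<subseteq> star p0" using pq pq0 eE e0 by (auto simp: star_def)
  then have v1: "trace_count {e} = trace_count {e0}" by (rule trace_count_star) (use pq pq0 in auto)
  have two: "real (card (fam s (big 2) {e, f} {})) \<le> 6/5 * real (trace_count K)" if f: "f \<in> ?adj" for f
  proof -
    obtain y where yf: "y \<in> f" "y \<in> e" using f by blast
    have f2: "f \<subseteq> V" "card f = 2" using f G by (auto simp: edges_def)
    then obtain b0 b1 where "f = {b0, b1}" "b0 \<noteq> b1" by (meson card_2_iff)
    then obtain b where "f = {y, b}" "y \<noteq> b" using yf(1) by (auto simp: insert_commute)
    then have y: "f = {y, b}" "y \<noteq> b" "y \<in> V" "b \<in> V" "y \<in> e" using f2(1) yf by auto
    obtain z where z: "e = {y, z}" "z \<noteq> y" "z \<in> V" using pq y(5) by (auto simp: insert_commute)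
    have bz: "b \<noteq> z" using f y z by auto
    have "trace_count {{y, z}, {y, b}} = trace_count K"
    proof (rule trace_count_star[OF _ K(1)])
      show "{{y, z}, {y, b}} \<subseteq> star y" using y z by (auto simp: star_def edges_def)
      have "card {{y, z}, {y, b}} = 2" using bz by (auto simp: card_insert_if doubleton_eq_iff)
      then show "card {{y, z}, {y, b}} = card K" using K(2) by simp
    qed (use y K in auto)
    then show ?thesis using cherry_bound[of y z b] y z bz by simp
  qed
  have "fam s (big 3 \<union> G) {e} {} \<subseteq> fam s (big 3 \<union> {e}) {e} {} \<union> (\<Union>f\<in>?adj. fam s (big 2) {e, f} {})"
  proof
    fix F assume F: "F \<in> fam s (big 3 \<union> G) {e} {}"
    then have F': "F \<subseteq> big 3 \<union> G" "intersecting F" "e \<in> F" "card F = s" by (auto simp: fam_def)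
    show "F \<in> fam s (big 3 \<union> {e}) {e} {} \<union> (\<Union>f\<in>?adj. fam s (big 2) {e, f} {})"
    proof (cases "F \<subseteq> big 3 \<union> {e}")
      case True
      then show ?thesis using F' by (simp add: fam_def)
    next
      case False
      then obtain f where f: "f \<in> F" "f \<in> G" "f \<noteq> e" using F'(1) by blast
      have "f \<in> ?adj" using f intersectingD[OF F'(2) f(1) F'(3)] by simp
      moreover have "F \<subseteq> big 2"
      proof
        fix B assume "B \<in> F"
        then have "B \<in> big 3 \<or> B \<in> edges" using F'(1) G by blast
        then show "B \<in> big 2" by (auto simp: big_def edges_def)
      qed
      then have "F \<in> fam s (big 2) {e, f} {}" using F' f by (simp add: fam_def)
      ultimately show ?thesis by blast
    qed
  qed
  then have "card (fam s (big 3 \<union> G) {e} {}) \<le> card (fam s (big 3 \<union> {e}) {e} {} \<union> (\<Union>f\<in>?adj. fam s (big 2) {e, f} {}))"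
    by (rule card_mono[rotated]) (use fb fa finite_fam_big[of "{e}"] in simp)
  also have "\<dots> \<le> trace_count {e} + (\<Sum>f\<in>?adj. card (fam s (big 2) {e, f} {}))"
    unfolding trace_count_def by (rule order_trans[OF card_Un_le add_left_mono[OF card_UN_le[OF fa]]])
  finally have "real (card (fam s (big 3 \<union> G) {e} {})) \<le> real (trace_count {e}) + (\<Sum>f\<in>?adj. real (card (fam s (big 2) {e, f} {})))"
    by (simp only: of_nat_add[symmetric] of_nat_sum[symmetric] of_nat_le_iff)
  also have "\<dots> \<le> real (trace_count {e}) + (\<Sum>f\<in>?adj. 6/5 * real (trace_count K))"
    by (intro add_mono sum_mono two) auto
  also have "(\<Sum>f\<in>?adj. 6/5 * real (trace_count K)) \<le> real k * (6/5 * real (trace_count K))"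
    using adj by (simp only: sum_constant) (intro mult_right_mono, auto)
  finally show ?thesis using v1 by simp
qed

end

lemma real_choose_three: "real (k choose 3) \<le> 35" if "k \<le> 7" for k
proof -
  have "k choose 3 \<le> 7 choose 3" using that by (rule binomial_right_mono)
  also have "\<dots> = 35" by (simp add: eval_nat_numeral)
  finally show ?thesis by simp
qed

text \<open>Here \<open>w\<close> is the number of points covered by the \<open>t\<close> missing
  triples. The constant \<open>73/45 = 2/9 * 73/10\<close> comes from overlaps of triples, and
  \<open>48/5 = 2 * (6/5) * 4\<close> from adjacent edges at both ends. If \<open>w \<le> 7\<close>,
  then \<open>t \<le> 35\<close> because 7 choose 3 is 35. If \<open>w \<ge> 8\<close>, the edges
  have to fit into at most \<open>n - 8\<close> points, which bounds \<open>t\<close>.\<close>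

lemma final_inequality:
  fixes n w t :: nat
  assumes n: "21 \<le> n" and w: "3 \<le> w" "w + 2 \<le> n" and t: "t \<le> w choose 3" "n - 1 + t \<le> (n - w) choose 2"
  shows "73/45 * (real t - 1) + 48/5 * real (n - w - 2) \<le> real ((n - 4) * (n - 5))"
proof -
  obtain k where k: "n = k + 21" using n by (metis add.commute le_Suc_ex)
  define r where "r = real k"
  have r: "r \<ge> 0" by (simp add: r_def)
  have N: "real ((n - 4) * (n - 5)) = (r + 17) * (r + 16)" by (simp add: k r_def add.commute)
  define M where "M = real (n - w - 2)"
  have m: "M = r + 19 - real w" using w by (simp add: M_def k r_def of_nat_diff)
  show ?thesis
  proof (cases "w \<le> 7")
    case True
    have "real t \<le> real (w choose 3)" using t(1) by simp
    then have "real t \<le> 35" using real_choose_three[OF True] by linarith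
    moreover have "M \<le> r + 16" using m w(1) by simp
    moreover have "17 * (r + 16) \<le> (r + 17) * (r + 16)" using r by (intro mult_right_mono) auto
    moreover have "73/45 * (35 - 1) + 48/5 * (r + 16) \<le> 17 * (r + 16)" using r by argo
    ultimately show ?thesis unfolding N M_def[symmetric] by argo
  next
    case False
    then have w8: "8 \<le> w" by simp
    have "(n - w) choose 2 \<le> (k + 13) choose 2" by (rule binomial_right_mono) (use w8 k in simp)
    then have "n - 1 + t \<le> (k + 13) choose 2" using t(2) by linarith
    then have "real (n - 1 + t) \<le> real ((k + 13) choose 2)" by (simp only: of_nat_le_iff)
    also have "real ((k + 13) choose 2) = (r + 13) * (r + 12) / 2" by (simp add: real_choose_two r_def)
    finally have "r + 20 + real t \<le> (r + 13) * (r + 12) / 2" using k by (simp add: r_def)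
    then have t': "real t \<le> r * r / 2 + 23/2 * r + 58" by (simp add: field_simps)
    have m': "M \<le> r + 11" using m w8 by simp
    have "73/45 * (r * r / 2 + 23/2 * r + 57) + 48/5 * (r + 11) \<le> (r + 17) * (r + 16)"
    proof -
      have "(r + 17) * (r + 16) = r * r + 33 * r + 272" by (simp add: algebra_simps)
      moreover have "0 \<le> r * r" using r by simp
      ultimately show ?thesis using r by argo
    qed
    then show ?thesis unfolding N M_def[symmetric] using t' m' by argo
  qed
qed

context bounded_ground begin

text \<open>From the \<open>n - 1 + t\<close> edges, \<open>n - 1\<close> are kept as
  \<open>G2\<close>. They do not form a star, since every star has an edge meeting
  \<open>T1\<close>. The other \<open>t\<close> edges contribute at most as many families as
  \<open>HH\<close>, which collects families lost with the triples, so the comparison with a star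
  for \<open>G2\<close> remains.\<close>

lemma missing_triples:
  assumes TT: "\<And>T. T \<in> TT \<Longrightarrow> T \<subseteq> V \<and> card T = 3" "TT \<noteq> {}" and G: "G \<subseteq> edges" "card G = card V - 1 + card TT"
    and disj: "\<And>e T. e \<in> G \<Longrightarrow> T \<in> TT \<Longrightarrow> e \<inter> T = {}" and c: "c \<in> V"
  shows "card (fam s ((big 3 - TT) \<union> G) {} {}) < card (fam s (big 3 \<union> star c) {} {})"
proof -
  define W where "W = \<Union>TT"
  define w where "w = card W"
  define t where "t = card TT"
  define m where "m = card V - w - 2"
  define n where "n = card V"
  have fTT: "finite TT" by (rule finite_subset[of _ "Pow V"]) (use TT finV in auto)
  have WV: "W \<subseteq> V" using TT(1) by (auto simp: W_def)
  have fW: "finite W" using WV finV by (rule finite_subset)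
  have fG: "finite G" using G(1) finite_edges by (rule finite_subset)
  have t1: "1 \<le> t" using TT(2) fTT by (simp add: t_def Suc_leI card_gt_0_iff)
  have cVW: "card (V - W) = n - w" using card_compl[OF WV] by (simp add: w_def n_def)
  obtain T1 where T1: "T1 \<in> TT" using TT(2) by blast
  have T1V: "T1 \<subseteq> V" "card T1 = 3" using TT(1)[OF T1] by auto
  have w3: "3 \<le> w" unfolding w_def using card_mono[OF fW, of T1] T1 T1V(2) by (auto simp: W_def)
  have GW: "e \<subseteq> V - W \<and> card e = 2" if "e \<in> G" for e using that G(1) disj[OF that] by (auto simp: edges_def W_def)
  have "card G \<le> card {e. e \<subseteq> V - W \<and> card e = 2}"
    by (rule card_mono) (use GW finV in \<open>auto intro: finite_subset[of _ "Pow V"]\<close>)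
  also have "\<dots> = (n - w) choose 2" using n_subsets[of "V - W" 2] finV cVW by simp
  finally have tG: "n - 1 + t \<le> (n - w) choose 2" using G(2) by (simp add: n_def t_def)
  have "card TT \<le> card {T. T \<subseteq> W \<and> card T = 3}"
    by (rule card_mono) (use TT(1) fW in \<open>auto simp: W_def intro: finite_subset[of _ "Pow W"]\<close>)
  also have "\<dots> = w choose 3" using n_subsets[OF fW, of 3] by (simp add: w_def)
  finally have tW: "t \<le> w choose 3" by (simp add: t_def)
  have "0 < card G" using G(2) V21 by simp
  then obtain e1 where e1: "e1 \<in> G" by (metis card.empty less_irrefl ex_in_conv)
  have fVW: "finite (V - W)" using finV by simp
  have "2 \<le> n - w" using card_mono[OF fVW, of e1] GW[OF e1] cVW by simp
  then have wn: "w + 2 \<le> n" using w3 by linarith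
  obtain G2 where G2: "G2 \<subseteq> G" "card G2 = card V - 1"
    by (rule obtain_subset_with_card_n[of "card V - 1" G]) (use G(2) in simp)
  have G2E: "G2 \<subseteq> edges" using G2(1) G(1) by blast
  have "card (G - G2) = card G - card G2" using G2(1) fG by (meson card_Diff_subset finite_subset)
  then have cR: "card (G - G2) = t" using G(2) G2(2) by (simp add: t_def)
  have "\<not> (\<exists>x\<in>V. G2 = star x)"
  proof
    assume "\<exists>x\<in>V. G2 = star x"
    then obtain x where x: "x \<in> V" "G2 = star x" by blast
    have "\<not> T1 \<subseteq> {x}" using card_mono[of "{x}" T1] T1V(2) by auto
    then obtain u where u: "u \<in> T1" "u \<noteq> x" by blast
    then have "{x, u} \<in> star x" using x(1) T1V(1) by (auto simp: star_def edges_def)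
    then show False using disj[of "{x, u}" T1] x(2) G2(1) T1 u(1) by auto
  qed
  then have strict: "card (fam s (big 3 \<union> G2) {} {}) < card (fam s (big 3 \<union> star c) {} {})"
    using star_graph_best[OF G2E G2(2) _ c] by blast

  define HH where "HH = {F \<in> fam s (big 3) {} {}. F \<inter> TT \<noteq> {}}"
  define X where "X e = fam s (big 3 \<union> G) {e} {}" for e
  have fb: "finite (fam s (big k \<union> H) K P)" if "H \<subseteq> G" for k H K P
    using finite_fam_big[OF finite_subset[OF that fG]] .
  have fHH: "finite HH" unfolding HH_def using finite_fam[OF finite_big] by simp
  obtain u where u: "u \<in> T1" using T1V(2) by (metis card.empty ex_in_conv zero_neq_numeral)
  have cu: "card (T1 - {u}) = 2" using u T1V(2) by (simp add: card_Diff_singleton)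
  define Y where "Y = T1 - {u}"
  have Y: "Y \<subseteq> T1" "card Y = 2" using cu by (auto simp: Y_def)
  define e where "e = real (marked T1 Y)"
  define v1 where "v1 = real (trace_count {Y})"
  define N where "N = real ((card V - 4) * (card V - 5))"
  have N0: "0 < N" using V21 by (simp add: N_def)
  have low: "real t * (v1 + e) - 2/9 * (real t * (real t - 1)) * (73/10 / N) * e \<le> real (card HH)"
    unfolding HH_def t_def v1_def e_def N_def of_nat_add[symmetric]
    by (rule triple_hits[OF TT(1) T1V Y refl])
  obtain K where K: "K \<subseteq> star c" "card K = 2"
    by (rule obtain_subset_with_card_n[of 2 "star c"]) (use card_star[OF c] V21 in simp)
  define v2 where "v2 = real (trace_count K)"
  have v2: "v2 * N \<le> 4 * e"
  proof -
    have "real (trace_count K * ((card V - 4) choose 2)) \<le> real (2 * marked T1 Y)"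
      using cherry_marked[OF K c T1V Y] by (simp only: of_nat_le_iff)
    moreover have "real ((card V - 4) choose 2) = N / 2"
      using V21 by (simp add: real_choose_two N_def of_nat_diff)
    ultimately show ?thesis by (simp add: v2_def e_def)
  qed
  have each: "real (card (X f)) \<le> v1 + real (2 * m) * (6/5 * v2)" if f: "f \<in> G" for f
    unfolding X_def v1_def v2_def
  proof (rule edge_hits[OF G(1) f _ K c])
    show "Y \<in> edges" using Y T1V by (auto simp: edges_def)
    obtain p q where pq: "f = {p, q}" "p \<noteq> q" using GW[OF f] by (meson card_2_iff)
    let ?R = "V - W - {p, q}"
    have fR: "finite ?R" using finV by simp
    have pqV: "p \<in> V - W" "q \<in> V - W" using GW[OF f] pq by auto
    have cRm: "card ?R = m" using cVW pqV pq(2) finV by (simp add: card_Diff_subset m_def n_def)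
    \<comment> \<open>No edge enters \<open>W\<close>, so each end of \<open>f\<close> has at most
      \<open>m = n - w - 2\<close> further neighbours.\<close>
    have "{g \<in> G. g \<noteq> f \<and> g \<inter> f \<noteq> {}} \<subseteq> (\<lambda>u. {p, u}) ` ?R \<union> (\<lambda>u. {q, u}) ` ?R"
    proof clarify
      fix g assume g: "g \<in> G" "g \<noteq> f" "g \<inter> f \<noteq> {}" "g \<notin> (\<lambda>u. {q, u}) ` ?R"
      obtain a where a: "a \<in> g" "a \<in> {p, q}" using g(3) pq(1) by blast
      obtain a0 a1 where "g = {a0, a1}" "a0 \<noteq> a1" using GW[OF g(1)] by (meson card_2_iff)
      then obtain b where b: "g = {a, b}" "a \<noteq> b" using a(1) by (auto simp: insert_commute)
      have "b \<in> ?R" using b GW[OF g(1)] a(2) g(2) pq by (auto simp: insert_commute)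
      then show "g \<in> (\<lambda>u. {p, u}) ` ?R" using a(2) b(1) g(4) by auto
    qed
    then have "card {g \<in> G. g \<noteq> f \<and> g \<inter> f \<noteq> {}} \<le> card ((\<lambda>u. {p, u}) ` ?R \<union> (\<lambda>u. {q, u}) ` ?R)"
      by (rule card_mono[rotated]) (use fR in simp)
    also have "\<dots> \<le> card ((\<lambda>u. {p, u}) ` ?R) + card ((\<lambda>u. {q, u}) ` ?R)" by (rule card_Un_le)
    also have "\<dots> \<le> m + m" unfolding cRm[symmetric] by (intro add_mono card_image_le fR)
    finally show "card {g \<in> G. g \<noteq> f \<and> g \<inter> f \<noteq> {}} \<le> 2 * m" by simp
  qed
  have up: "real (card (\<Union>f\<in>G - G2. X f)) \<le> real t * (v1 + real (2 * m) * (6/5 * v2))"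
  proof -
    have "card (\<Union>f\<in>G - G2. X f) \<le> (\<Sum>f\<in>G - G2. card (X f))" by (rule card_UN_le) (use fG in simp)
    then have "real (card (\<Union>f\<in>G - G2. X f)) \<le> (\<Sum>f\<in>G - G2. real (card (X f)))"
      by (simp only: of_nat_sum[symmetric] of_nat_le_iff)
    also have "\<dots> \<le> (\<Sum>f\<in>G - G2. v1 + real (2 * m) * (6/5 * v2))" by (intro sum_mono each) auto
    finally show ?thesis using cR by simp
  qed
  \<comment> \<open>The terms \<open>t * v1\<close> cancel. After dividing by \<open>t\<close> and
    multiplying by \<open>N\<close>, the bound \<open>v2 * N \<le> 4 * e\<close> reduces the claim
    to \<open>final_inequality\<close> times the surplus \<open>e\<close>.\<close>
  have le: "real (card (\<Union>f\<in>G - G2. X f)) \<le> real (card HH)"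
  proof -
    have fin: "73/45 * (real t - 1) + 48/5 * real m \<le> N"
      unfolding m_def N_def by (rule final_inequality) (use V21 w3 wn tW tG in \<open>simp_all add: n_def\<close>)
    have e0: "0 \<le> e" by (simp add: e_def)
    have "(real (2 * m) * (6/5 * v2) + 2/9 * (real t - 1) * (73/10 / N) * e) * N
        = 12/5 * real m * (v2 * N) + 73/45 * (real t - 1) * e"
      using N0 by (simp add: field_simps)
    also have "\<dots> \<le> 12/5 * real m * (4 * e) + 73/45 * (real t - 1) * e"
      using v2 by (intro add_right_mono mult_left_mono) auto
    also have "\<dots> = (73/45 * (real t - 1) + 48/5 * real m) * e" by (simp add: algebra_simps)
    also have "\<dots> \<le> N * e" using fin e0 by (rule mult_right_mono)
    finally have "real (2 * m) * (6/5 * v2) + 2/9 * (real t - 1) * (73/10 / N) * e \<le> e"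
      using N0 by (simp add: mult.commute)
    then have "real t * (real (2 * m) * (6/5 * v2) + 2/9 * (real t - 1) * (73/10 / N) * e) \<le> real t * e"
      by (rule mult_left_mono) simp
    then have "real t * (v1 + real (2 * m) * (6/5 * v2)) \<le> real t * (v1 + e) - 2/9 * (real t * (real t - 1)) * (73/10 / N) * e"
      by (simp add: algebra_simps)
    then show ?thesis using up low by linarith
  qed
  have sub: "fam s ((big 3 - TT) \<union> G) {} {} \<subseteq> (fam s (big 3 \<union> G2) {} {} - HH) \<union> (\<Union>f\<in>G - G2. X f)"
  proof
    fix F assume "F \<in> fam s ((big 3 - TT) \<union> G) {} {}"
    then have F: "F \<subseteq> (big 3 - TT) \<union> G" "card F = s" "intersecting F" by (auto simp: fam_def)
    show "F \<in> (fam s (big 3 \<union> G2) {} {} - HH) \<union> (\<Union>f\<in>G - G2. X f)"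
    proof (cases "F \<inter> (G - G2) = {}")
      case True
      have "F \<subseteq> big 3 \<union> G2" using F(1) True by blast
      moreover have "F \<inter> TT = {}"
      proof -
        have "g \<notin> TT" if "g \<in> G" for g using GW[OF that] TT(1)[of g] by auto
        then show ?thesis using F(1) by blast
      qed
      ultimately show ?thesis using F by (simp add: fam_def HH_def)
    next
      case False
      then obtain f where f: "f \<in> F" "f \<in> G - G2" by blast
      have "F \<in> X f" using F f(1) by (auto simp: X_def fam_def)
      then show ?thesis using f(2) by blast
    qed
  qed
  have fX: "finite (\<Union>f\<in>G - G2. X f)" using fG by (auto simp: X_def intro: fb)
  have fG2: "finite (fam s (big 3 \<union> G2) {} {})" using fb[OF G2(1)] .
  have HHs: "HH \<subseteq> fam s (big 3 \<union> G2) {} {}" by (auto simp: HH_def fam_def)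
  have "card (fam s ((big 3 - TT) \<union> G) {} {}) \<le> card ((fam s (big 3 \<union> G2) {} {} - HH) \<union> (\<Union>f\<in>G - G2. X f))"
    by (rule card_mono[OF _ sub]) (use fX fG2 in simp)
  also have "\<dots> \<le> card (fam s (big 3 \<union> G2) {} {} - HH) + card (\<Union>f\<in>G - G2. X f)" by (rule card_Un_le)
  also have "\<dots> \<le> (card (fam s (big 3 \<union> G2) {} {}) - card HH) + card HH"
    using le card_Diff_subset[OF fHH HHs] by simp
  also have "\<dots> = card (fam s (big 3 \<union> G2) {} {})" using card_mono[OF fG2 HHs] by simp
  finally show ?thesis using strict by linarith
qed

end

section \<open>Optimal families\<close>

context bounded_ground begin

definition low :: "'a set set" where "low = {B. B \<subseteq> V \<and> card B \<le> 1}"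

lemma card_low: "finite low" "card low = card V + 1"
proof -
  show "finite low" using finV by (auto simp: low_def intro: finite_subset[of _ "Pow V"])
  have "low = insert {} ((\<lambda>v. {v}) ` V)"
  proof
    show "low \<subseteq> insert {} ((\<lambda>v. {v}) ` V)"
    proof
      fix B assume B: "B \<in> low"
      then have "finite B" "card B = 0 \<or> card B = 1" using finV finite_subset by (auto simp: low_def)
      then have "B = {} \<or> (\<exists>v. B = {v})" using card_1_singletonE[of B] by auto
      then show "B \<in> insert {} ((\<lambda>v. {v}) ` V)" using B by (auto simp: low_def)
    qed
  qed (auto simp: low_def)
  moreover have "card ((\<lambda>v. {v}) ` V) = card V" by (rule card_image) simp
  moreover have "{} \<notin> (\<lambda>v. {v}) ` V" by blast
  ultimately show "card low = card V + 1" using finV by simp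
qed

lemma card_edges: "card edges = card V choose 2"
  unfolding edges_def using n_subsets[OF finV] .

lemma edges_minus_star: "x \<in> V \<Longrightarrow> card (edges - star x) = (card V - 1) choose 2"
proof -
  assume x: "x \<in> V"
  have sub: "star x \<subseteq> edges" by (auto simp: star_def)
  have "card (edges - star x) = card edges - card (star x)"
    using sub finite_edges by (meson card_Diff_subset finite_subset)
  moreover have "card V choose 2 = (card V - 1) + ((card V - 1) choose 2)"
    using choose_reduce_nat[of "card V" 2] V21 by simp
  ultimately show ?thesis using card_edges card_star[OF x] by simp
qed

lemma disjoint_levels: "low \<inter> edges = {}" "edges \<inter> big 3 = {}"
  by (auto simp: low_def edges_def big_def)

lemma level_cases:
  assumes "B \<subseteq> V" obtains "B \<in> low" | "B \<in> edges" | "B \<in> big 3"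
  using assms by (cases "card B \<le> 1"; cases "card B = 2") (auto simp: low_def edges_def big_def)

lemma big_two: "big 2 = big 3 \<union> edges"
  by (auto simp: big_def edges_def)

lemma card_big_three: "card (big 3) = (\<Sum>k=3..card V. card V choose k)"
proof -
  have "big 3 = (\<Union>k\<in>{3..card V}. {B. B \<subseteq> V \<and> card B = k})"
    using card_mono[OF finV] by (auto simp: big_def)
  also have "card \<dots> = (\<Sum>k=3..card V. card {B. B \<subseteq> V \<and> card B = k})"
    by (rule card_UN_disjoint) (use finV in \<open>auto intro: finite_subset[of _ "Pow V"]\<close>)
  finally show ?thesis by (simp add: card_subsets)
qed

lemma card_above_star: "x \<in> V \<Longrightarrow> card (big 3 \<union> star x) = (\<Sum>k=3..card V. card V choose k) + (card V - 1)"
proof -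
  assume x: "x \<in> V"
  have "star x \<subseteq> edges" by (auto simp: star_def)
  then have "finite (star x)" "big 3 \<inter> star x = {}" using finite_edges disjoint_levels(2) by (auto intro: finite_subset)
  then show ?thesis using card_Un_disjoint[OF finite_big] card_big_three card_star[OF x] by simp
qed

lemma card_off_star: "x \<in> V \<Longrightarrow> card (big 2 - star x) = (\<Sum>k=3..card V. card V choose k) + ((card V - 1) choose 2)"
proof -
  assume x: "x \<in> V"
  have "big 2 - star x = big 3 \<union> (edges - star x)" by (auto simp: big_two star_def edges_def big_def)
  moreover have "card (big 3 \<union> (edges - star x)) = card (big 3) + card (edges - star x)"
    by (rule card_Un_disjoint) (use finite_big finite_edges disjoint_levels(2) in auto)
  ultimately show ?thesis using edges_minus_star[OF x] card_big_three by simp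
qed

lemma complement_card:
  assumes "A \<subseteq> Pow V" "B \<subseteq> Pow V" "card A = card B"
  shows "card (Pow V - A) = card (Pow V - B)"
  using assms finV by (simp add: card_Diff_subset finite_subset[OF _ finite_Pow_iff[THEN iffD2]])

lemma complement_off_star: "x \<in> V \<Longrightarrow> card (Pow V - (big 2 - star x)) = 2 * card V"
proof -
  assume x: "x \<in> V"
  have "Pow V - (big 2 - star x) = low \<union> star x" (is "?L = ?R")
  proof
    show "?L \<subseteq> ?R" by (auto simp: low_def big_def)
    show "?R \<subseteq> ?L" by (auto simp: low_def big_def star_def edges_def)
  qed
  moreover have "card (low \<union> star x) = card low + card (star x)"
    by (rule card_Un_disjoint) (use card_low(1) finite_edges disjoint_levels(1) in \<open>auto simp: star_def\<close>)
  ultimately show ?thesis using card_low(2) card_star[OF x] V21 by simp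
qed

lemma complement_above_star: "x \<in> V \<Longrightarrow> card (Pow V - (big 3 \<union> star x)) = 1 + card V + ((card V - 1) choose 2)"
proof -
  assume x: "x \<in> V"
  have "Pow V - (big 3 \<union> star x) = low \<union> (edges - star x)" (is "?L = ?R")
  proof
    show "?L \<subseteq> ?R"
    proof
      fix B assume B: "B \<in> ?L"
      then have "B \<subseteq> V" by blast
      then show "B \<in> ?R" by (rule level_cases) (use B in auto)
    qed
    show "?R \<subseteq> ?L" by (auto simp: low_def big_def star_def edges_def)
  qed
  moreover have "card (low \<union> (edges - star x)) = card low + card (edges - star x)"
    by (rule card_Un_disjoint) (use card_low(1) finite_edges disjoint_levels(1) in auto)
  ultimately show ?thesis using card_low(2) edges_minus_star[OF x] by simp
qed

lemma perm_off_star: "p permutes V \<Longrightarrow> x \<in> V \<Longrightarrow> (`) p ` (big 2 - star x) = big 2 - star (p x)"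
proof -
  assume p: "p permutes V" and x: "x \<in> V"
  have "inj ((`) p)" using permutes_inj[OF p] by (simp add: inj_def inj_image_eq_iff)
  then show ?thesis using perm_big[OF p, of 2] perm_star[OF p x] by (simp add: image_set_diff)
qed

lemma perm_above_star: "p permutes V \<Longrightarrow> x \<in> V \<Longrightarrow> (`) p ` (big 3 \<union> star x) = big 3 \<union> star (p x)"
  using perm_big[of p 3] perm_star[of p x] by (simp add: image_Un)

lemma num_perm: "p permutes V \<Longrightarrow> A \<subseteq> Pow V \<Longrightarrow> num_intersecting s ((`) p ` A) = num_intersecting s A"
proof -
  assume p: "p permutes V" and A: "A \<subseteq> Pow V"
  have "finite A" using A finV by (meson finite_Pow_iff finite_subset)
  then show ?thesis using fam_image[OF permutes_inj[OF p], of s A "{}" "{}"] by (simp add: num_intersecting_fam)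
qed

lemma sub_Pow: "big k \<subseteq> Pow V" "star x \<subseteq> Pow V" "edges \<subseteq> Pow V"
  by (auto simp: big_def star_def edges_def)

lemma num_off_star: "x \<in> V \<Longrightarrow> y \<in> V \<Longrightarrow> num_intersecting s (big 2 - star x) = num_intersecting s (big 2 - star y)"
  using star_perm[of x y] num_perm[of _ "big 2 - star x"] perm_off_star sub_Pow(1)
  by (metis Diff_subset subset_trans)

lemma num_above_star: "x \<in> V \<Longrightarrow> y \<in> V \<Longrightarrow> num_intersecting s (big 3 \<union> star x) = num_intersecting s (big 3 \<union> star y)"
  using star_perm[of x y] num_perm[of _ "big 3 \<union> star x"] perm_above_star sub_Pow(1,2)
  by (metis Un_least)

section \<open>Optimality among all families\<close>

text \<open>A stable family of this size misses \<open>2 * card V\<close> sets. The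
  \<open>card V + 1\<close> sets of size at most one are among them, no set of size three or more
  is, so \<open>card V - 1\<close> edges remain for \<open>H\<close>.\<close>

lemma off_star_optimal:
  assumes c: "c \<in> V" and A: "A \<subseteq> Pow V" "card A = card (big 2 - star c)"
  shows "num_intersecting s A \<le> num_intersecting s (big 2 - star c) \<and>
    (num_intersecting s A = num_intersecting s (big 2 - star c) \<longrightarrow> (\<exists>x\<in>V. A = big 2 - star x))"
proof (rule reduce_to_stable[OF finV A])
  fix A assume A: "A \<subseteq> Pow V" "card A = card (big 2 - star c)" and st: "stable V A"
  have cM: "card (Pow V - A) = 2 * card V"
    using complement_card[OF A(1) _ A(2)] complement_off_star[OF c] sub_Pow(1) by (metis Diff_subset subset_trans)
  have lowA: "low \<inter> A = {}"
    using stable_pair[OF st A(1)] cM V21 by (auto simp: low_def)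
  have bigA: "big 3 \<subseteq> A" using stable_small_defect[OF st A(1) cM] by (auto simp: big_def)
  define H where "H = edges - A"
  have Ae: "A = big 2 - H"
  proof
    show "A \<subseteq> big 2 - H"
    proof
      fix B assume B: "B \<in> A"
      then have "B \<subseteq> V" using A(1) by blast
      then show "B \<in> big 2 - H" by (rule level_cases) (use B lowA disjoint_levels(2) in \<open>auto simp: H_def big_two\<close>)
    qed
    show "big 2 - H \<subseteq> A" using bigA by (auto simp: H_def big_two)
  qed
  have "Pow V - A = low \<union> H"
  proof
    show "Pow V - A \<subseteq> low \<union> H"
    proof
      fix B assume B: "B \<in> Pow V - A"
      then have "B \<subseteq> V" by blast
      then show "B \<in> low \<union> H" by (rule level_cases) (use B bigA in \<open>auto simp: H_def\<close>)
    qed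
    show "low \<union> H \<subseteq> Pow V - A" using lowA by (auto simp: H_def low_def edges_def)
  qed
  moreover have "card (low \<union> H) = card low + card H"
    by (rule card_Un_disjoint) (use card_low(1) finite_edges disjoint_levels(1) in \<open>auto simp: H_def\<close>)
  ultimately have cH: "card H = card V - 1" using cM card_low(2) by simp
  have HE: "H \<subseteq> edges" by (simp add: H_def)
  show "num_intersecting s A \<le> num_intersecting s (big 2 - star c) \<and>
    (num_intersecting s A = num_intersecting s (big 2 - star c) \<longrightarrow> (\<exists>x\<in>V. A = big 2 - star x))"
  proof (cases "\<exists>x\<in>V. H = star x")
    case True
    then obtain x where x: "x \<in> V" "H = star x" by blast
    then show ?thesis using num_off_star[OF x(1) c] Ae by auto
  next
    case False
    then show ?thesis using star_defect_best[OF HE cH False c] Ae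
      by (simp add: num_intersecting_fam finite_big)
  qed
next
  fix A A' assume A: "A \<subseteq> Pow V" "cstep V A A'" "\<exists>x\<in>V. A' = big 2 - star x"
  show "num_intersecting s A < num_intersecting s A'"
    by (rule strict_last_step[OF s2 sle A(1,2)]) (use A(3) in \<open>auto simp: big_def star_def edges_def\<close>)
qed

text \<open>In a stable family the missing sets are those of size at most one, the triples in
  \<open>TT\<close> and the edges outside \<open>G\<close>. Counting them gives one additional edge
  in \<open>G\<close> for each missing triple, and \<open>stable_triple\<close> keeps these edges
  away from the triples.\<close>

lemma above_star_optimal:
  assumes c: "c \<in> V" and A: "A \<subseteq> Pow V" "card A = card (big 3 \<union> star c)"
  shows "num_intersecting s A \<le> num_intersecting s (big 3 \<union> star c) \<and>
    (num_intersecting s A = num_intersecting s (big 3 \<union> star c) \<longrightarrow> (\<exists>x\<in>V. A = big 3 \<union> star x))"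
proof (rule reduce_to_stable[OF finV A])
  fix A assume A: "A \<subseteq> Pow V" "card A = card (big 3 \<union> star c)" and st: "stable V A"
  have cM: "card (Pow V - A) = 1 + card V + ((card V - 1) choose 2)"
    using complement_card[OF A(1) _ A(2)] complement_above_star[OF c] sub_Pow(1,2) by (metis Un_least)
  have ch: "card V choose 2 = (card V - 1) + ((card V - 1) choose 2)"
    using choose_reduce_nat[of "card V" 2] V21 by simp
  have "0 < (card V - 1) choose 2" using V21 by (simp add: zero_less_binomial)
  then have lowA: "low \<inter> A = {}"
    using stable_pair[OF st A(1)] cM by (auto simp: low_def)
  have four: "B \<in> A" if "B \<subseteq> V" "4 \<le> card B" for B using stable_large_defect[OF st A(1) cM that] .
  define TT where "TT = big 3 - A"
  define G where "G = edges \<inter> A"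
  have TTp: "T \<subseteq> V \<and> card T = 3" "T \<notin> A" if "T \<in> TT" for T
  proof -
    have T: "T \<subseteq> V" "3 \<le> card T" "T \<notin> A" using that by (auto simp: TT_def big_def)
    have "\<not> 4 \<le> card T" using four[OF T(1)] T(3) by blast
    then show "T \<subseteq> V \<and> card T = 3" "T \<notin> A" using T by auto
  qed
  have GE: "G \<subseteq> edges" by (simp add: G_def)
  have Ae: "A = (big 3 - TT) \<union> G"
  proof
    show "A \<subseteq> (big 3 - TT) \<union> G"
    proof
      fix B assume B: "B \<in> A"
      then have "B \<subseteq> V" using A(1) by blast
      then show "B \<in> (big 3 - TT) \<union> G" by (rule level_cases) (use B lowA in \<open>auto simp: G_def TT_def\<close>)
    qed
    show "(big 3 - TT) \<union> G \<subseteq> A" by (auto simp: G_def TT_def)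
  qed
  have fin: "finite low" "finite TT" "finite (edges - G)" "finite G"
    using card_low(1) finite_big finite_edges by (auto simp: TT_def G_def)
  have "Pow V - A = (low \<union> TT) \<union> (edges - G)"
  proof
    show "Pow V - A \<subseteq> (low \<union> TT) \<union> (edges - G)"
    proof
      fix B assume B: "B \<in> Pow V - A"
      then have "B \<subseteq> V" by blast
      then show "B \<in> (low \<union> TT) \<union> (edges - G)" by (rule level_cases) (use B in \<open>auto simp: G_def TT_def\<close>)
    qed
    show "(low \<union> TT) \<union> (edges - G) \<subseteq> Pow V - A" using lowA sub_Pow by (auto simp: G_def TT_def low_def)
  qed
  moreover have "card ((low \<union> TT) \<union> (edges - G)) = card (low \<union> TT) + card (edges - G)"
    by (rule card_Un_disjoint) (use fin disjoint_levels in \<open>auto simp: TT_def\<close>)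
  moreover have "card (low \<union> TT) = card low + card TT"
    by (rule card_Un_disjoint) (use fin in \<open>auto simp: TT_def low_def big_def\<close>)
  moreover have "card (edges - G) + card G = card V choose 2"
    using card_Diff_subset[OF fin(4) GE] card_mono[OF finite_edges GE] card_edges by simp
  ultimately have cG: "card G = card V - 1 + card TT" using cM card_low(2) ch by simp
  have disj: "e \<inter> T = {}" if e: "e \<in> G" and T: "T \<in> TT" for e T
  proof (rule ccontr)
    assume "e \<inter> T \<noteq> {}"
    then obtain x where x: "x \<in> e" "x \<in> T" by blast
    have "card e = 2" "e \<subseteq> V" "e \<in> A" using e by (auto simp: G_def edges_def)
    then obtain p q where pq: "e = {p, q}" "p \<noteq> q" by (meson card_2_iff)
    then obtain w where w: "e = {x, w}" "w \<noteq> x" using x(1) by (auto simp: insert_commute)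
    have TV: "T \<subseteq> V" "card T = 3" "T \<notin> A" using TTp[OF T] by auto
    have "w \<in> V" using w \<open>e \<subseteq> V\<close> by blast
    then have "{x, w} \<notin> A" using stable_triple[OF st A(1) TV x(2) _ w(2)] by blast
    then show False using w \<open>e \<in> A\<close> by simp
  qed
  show "num_intersecting s A \<le> num_intersecting s (big 3 \<union> star c) \<and>
    (num_intersecting s A = num_intersecting s (big 3 \<union> star c) \<longrightarrow> (\<exists>x\<in>V. A = big 3 \<union> star x))"
  proof (cases "TT = {}")
    case False
    have "card (fam s ((big 3 - TT) \<union> G) {} {}) < card (fam s (big 3 \<union> star c) {} {})"
      by (rule missing_triples[OF TTp(1) False GE cG disj c])
    moreover have "finite (big 3 \<union> star c)" "finite A" using finite_big finite_edges fin Ae by (auto simp: star_def)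
    ultimately show ?thesis using Ae by (simp add: num_intersecting_fam)
  next
    case True
    show ?thesis
    proof (cases "\<exists>x\<in>V. G = star x")
      case True
      then obtain x where x: "x \<in> V" "G = star x" by blast
      then show ?thesis using num_above_star[OF x(1) c] Ae \<open>TT = {}\<close> by auto
    next
      case False
      have "card G = card V - 1" using cG True by simp
      then have "card (fam s (big 3 \<union> G) {} {}) < card (fam s (big 3 \<union> star c) {} {})"
        by (rule star_graph_best[OF GE _ False c])
      moreover have "finite (big 3 \<union> star c)" "finite A" using finite_big finite_edges fin Ae by (auto simp: star_def)
      ultimately show ?thesis using Ae True by (simp add: num_intersecting_fam)
    qed
  qed
next
  fix A A' assume A: "A \<subseteq> Pow V" "cstep V A A'" "\<exists>x\<in>V. A' = big 3 \<union> star x"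
  show "num_intersecting s A < num_intersecting s A'"
    by (rule strict_last_step[OF s2 sle A(1,2)]) (use A(3) in \<open>auto simp: big_def star_def edges_def\<close>)
qed

end

lemma unique_maximiserI:
  assumes "A \<subseteq> Pow {1..n}" "card A = m"
    and "\<And>B. B \<subseteq> Pow {1..n} \<Longrightarrow> card B = m \<Longrightarrow> num_intersecting s B \<le> num_intersecting s A \<and>
      (num_intersecting s B = num_intersecting s A \<longrightarrow> (\<exists>p. p permutes {1..n} \<and> B = (`) p ` A))"
  shows "unique_maximiser_up_to_reordering n m s A"
  unfolding unique_maximiser_up_to_reordering_def maximises_intersecting_def same_up_to_reordering_def
  using assms by (metis le_antisym)

theorem theorem1:
  fixes n s :: nat
  assumes "n \<ge> 21" and "2 \<le> s" and "s \<le> 2 ^ (n - 1)"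
  shows "unique_maximiser_up_to_reordering n ((\<Sum>k=3..n. n choose k) + (n - 1)) s
           (nsets_ge {1..n} 3 \<union> {A \<in> nsets {1..n} 2. 1 \<in> A})
       \<and> unique_maximiser_up_to_reordering n ((\<Sum>k=3..n. n choose k) + ((n - 1) choose 2)) s
           (nsets_ge {1..n} 3 \<union> {A \<in> nsets {1..n} 2. n \<notin> A})"
proof -
  interpret bounded_ground "{1..n}" s using assms by unfold_locales auto
  have c1: "1 \<in> {1..n}" "n \<in> {1..n}" using assms(1) by auto
  have V: "card {1..n} = n" by simp
  have fin: "finite B" if "B \<subseteq> {1..n}" for B using that by (rule finite_subset) simp
  have ge: "nsets_ge {1..n} 3 = big 3" unfolding nsets_ge_def big_def using fin by blast
  have ed: "nsets {1..n} 2 = edges" unfolding nsets_def edges_def using fin by blast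
  have a: "nsets_ge {1..n} 3 \<union> {A \<in> nsets {1..n} 2. 1 \<in> A} = big 3 \<union> star 1"
    unfolding ge ed star_def ..
  \<comment> \<open>Edges avoiding \<open>n\<close> are all edges except the star at
    \<open>n\<close>, which puts case (b) into the form of a removed star.\<close>
  have b: "nsets_ge {1..n} 3 \<union> {A \<in> nsets {1..n} 2. n \<notin> A} = big 2 - star n"
    unfolding ge ed big_two star_def using disjoint_levels(2) by blast
  have "unique_maximiser_up_to_reordering n ((\<Sum>k=3..n. n choose k) + (n - 1)) s (big 3 \<union> star 1)"
  proof (rule unique_maximiserI)
    show "big 3 \<union> star 1 \<subseteq> Pow {1..n}" using sub_Pow by blast
    show card: "card (big 3 \<union> star 1) = (\<Sum>k=3..n. n choose k) + (n - 1)"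
      using card_above_star[OF c1(1)] unfolding V .
    fix B assume B: "B \<subseteq> Pow {1..n}" "card B = (\<Sum>k=3..n. n choose k) + (n - 1)"
    have opt: "num_intersecting s B \<le> num_intersecting s (big 3 \<union> star 1) \<and>
        (num_intersecting s B = num_intersecting s (big 3 \<union> star 1) \<longrightarrow> (\<exists>x\<in>{1..n}. B = big 3 \<union> star x))"
      by (rule above_star_optimal[OF c1(1) B(1)]) (simp only: B(2) card)
    have "\<exists>p. p permutes {1..n} \<and> big 3 \<union> star x = (`) p ` (big 3 \<union> star 1)" if "x \<in> {1..n}" for x
      using star_perm[OF c1(1) that] perm_above_star[OF _ c1(1)] by metis
    then show "num_intersecting s B \<le> num_intersecting s (big 3 \<union> star 1) \<and>
        (num_intersecting s B = num_intersecting s (big 3 \<union> star 1) \<longrightarrow> (\<exists>p. p permutes {1..n} \<and> B = (`) p ` (big 3 \<union> star 1)))"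
      using opt by blast
  qed
  moreover have "unique_maximiser_up_to_reordering n ((\<Sum>k=3..n. n choose k) + ((n - 1) choose 2)) s (big 2 - star n)"
  proof (rule unique_maximiserI)
    show "big 2 - star n \<subseteq> Pow {1..n}" using sub_Pow by blast
    show card: "card (big 2 - star n) = (\<Sum>k=3..n. n choose k) + ((n - 1) choose 2)"
      using card_off_star[OF c1(2)] unfolding V .
    fix B assume B: "B \<subseteq> Pow {1..n}" "card B = (\<Sum>k=3..n. n choose k) + ((n - 1) choose 2)"
    have opt: "num_intersecting s B \<le> num_intersecting s (big 2 - star n) \<and>
        (num_intersecting s B = num_intersecting s (big 2 - star n) \<longrightarrow> (\<exists>x\<in>{1..n}. B = big 2 - star x))"
      by (rule off_star_optimal[OF c1(2) B(1)]) (simp only: B(2) card)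
    have "\<exists>p. p permutes {1..n} \<and> big 2 - star x = (`) p ` (big 2 - star n)" if "x \<in> {1..n}" for x
      using star_perm[OF c1(2) that] perm_off_star[OF _ c1(2)] by metis
    then show "num_intersecting s B \<le> num_intersecting s (big 2 - star n) \<and>
        (num_intersecting s B = num_intersecting s (big 2 - star n) \<longrightarrow> (\<exists>p. p permutes {1..n} \<and> B = (`) p ` (big 2 - star n)))"
      using opt by blast
  qed
  ultimately show ?thesis unfolding a b by blast
qed

end
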